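(* For an integer $d\ge 1$ and a convex body $K\subset\mathbb{R}^d$, let $X_K$ be an $\mathbb{R}^d$-valued random vector with density $x\mapsto \frac{1}{W(K)}e^{-\pi\,\mathrm{dist}^2(x,K)}$, where $W(K)=\int_{\mathbb{R}^d}e^{-\pi\,\mathrm{dist}^2(x,K)}\,dx$, and define the real random variable $$F_K=\frac{\mathrm{dist}^2(X_K,K)-\mathbb{E}[\mathrm{dist}^2(X_K,K)]}{\sqrt{\mathrm{Var}\big(\mathrm{dist}^2(X_K,K)\big)}}.$$ Let $N\sim\mathcal{N}(0,1)$ be a standard Gaussian random variable. Then, for all $\alpha\ge 0$ and $c>0$, $$\sup_{d\ge 1}\ \sup_{K:\ \mathrm{diam}(K)\le 2c\,d^{\alpha}} d^{\frac12-\alpha}\,d_{TV}(F_K,N)<\infty,$$ where the second supremum runs over all convex bodies $K$ of $\mathbb{R}^d$ whose diameter is bounded by $2c\,d^{\alpha}$. In particular, if $\alpha\in[0,\frac12)$, if $(d_n)$ is a sequence of natural numbers diverging to infinity, and if $(K_n)$ is a sequence of convex bodies with $K_n\subset\mathbb{R}^{d_n}$ and $\mathrm{diam}(K_n)=O(d_n^{\alpha})$, then $F_{K_n}$ converges in law to $\mathcal{N}(0,1)$ as $n\to\infty$.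
   Context: A convex body of $\mathbb{R}^d$ is a compact convex subset of $\mathbb{R}^d$ with nonempty interior. $\mathrm{dist}(x,K)$ is the Euclidean distance from $x\in\mathbb{R}^d$ to $K$, $\mathrm{dist}^2(x,K)$ is its square, and $\mathrm{diam}(K)$ is the Euclidean diameter of $K$. For real random variables $F,G$, the total variation distance is $d_{TV}(F,G)=\sup_{A\in\mathcal{B}(\mathbb{R})}|\mathbb{P}(G\in A)-\mathbb{P}(F\in A)|$, where $\mathcal{B}(\mathbb{R})$ is the Borel $\sigma$-algebra of $\mathbb{R}$. *)

theory Defs
  imports "HOL-Probability.Probability" "HOL-Library.Landau_Symbols"
begin

text \<open>
  The dimension is bound inside the main statement, so it cannot be a type.  A vector of
  \<open>\<real>\<^sup>d\<close> is a function \<open>nat \<Rightarrow> real\<close> in \<open>{..<d} \<rightarrow>\<^sub>E UNIV\<close>, i.e. one that is \<open>undefined\<close> outside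
  \<open>{..<d}\<close>: this is both the topspace of the product topology and the space of the product
  measure below.
\<close>

abbreviation top_Rd :: "nat \<Rightarrow> (nat \<Rightarrow> real) topology" where
  "top_Rd d \<equiv> product_topology (\<lambda>_. euclideanreal) {..<d}"

abbreviation lborel_Rd :: "nat \<Rightarrow> (nat \<Rightarrow> real) measure" where
  "lborel_Rd d \<equiv> PiM {..<d} (\<lambda>_. lborel)"

definition dist_Rd :: "nat \<Rightarrow> (nat \<Rightarrow> real) \<Rightarrow> (nat \<Rightarrow> real) \<Rightarrow> real" where
  "dist_Rd d x y = L2_set (\<lambda>i. x i - y i) {..<d}"

text \<open>The next three definitions follow \<^const>\<open>infdist\<close>, \<^const>\<open>diameter\<close> and \<^const>\<open>convex\<close>.\<close>

definition infdist_Rd :: "nat \<Rightarrow> (nat \<Rightarrow> real) \<Rightarrow> (nat \<Rightarrow> real) set \<Rightarrow> real" where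
  "infdist_Rd d x K = (if K = {} then 0 else INF y\<in>K. dist_Rd d x y)"

definition diameter_Rd :: "nat \<Rightarrow> (nat \<Rightarrow> real) set \<Rightarrow> real" where
  "diameter_Rd d K = (if K = {} then 0 else SUP (x, y)\<in>K \<times> K. dist_Rd d x y)"

definition convex_Rd :: "nat \<Rightarrow> (nat \<Rightarrow> real) set \<Rightarrow> bool" where
  "convex_Rd d K \<longleftrightarrow>
     (\<forall>x\<in>K. \<forall>y\<in>K. \<forall>u\<ge>0. \<forall>v\<ge>0. u + v = 1 \<longrightarrow> (\<lambda>i\<in>{..<d}. u * x i + v * y i) \<in> K)"

definition convex_body :: "nat \<Rightarrow> (nat \<Rightarrow> real) set \<Rightarrow> bool" where
  "convex_body d K \<longleftrightarrow>
     compactin (top_Rd d) K \<and> convex_Rd d K \<and> top_Rd d interior_of K \<noteq> {}"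

definition wills :: "nat \<Rightarrow> (nat \<Rightarrow> real) set \<Rightarrow> real" where
  "wills d K = (\<integral>x. exp (- pi * (infdist_Rd d x K)\<^sup>2) \<partial>lborel_Rd d)"

definition wills_density :: "nat \<Rightarrow> (nat \<Rightarrow> real) set \<Rightarrow> (nat \<Rightarrow> real) \<Rightarrow> real" where
  "wills_density d K x = 1 / wills d K * exp (- pi * (infdist_Rd d x K)\<^sup>2)"

definition standardize :: "'w measure \<Rightarrow> ('w \<Rightarrow> real) \<Rightarrow> 'w \<Rightarrow> real" where
  "standardize M Y \<omega> =
     (Y \<omega> - prob_space.expectation M Y) / sqrt (prob_space.variance M Y)"

definition F_body ::
  "'w measure \<Rightarrow> ('w \<Rightarrow> nat \<Rightarrow> real) \<Rightarrow> nat \<Rightarrow> (nat \<Rightarrow> real) set \<Rightarrow> 'w \<Rightarrow> real" where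
  "F_body M X d K = standardize M (\<lambda>\<omega>. (infdist_Rd d (X \<omega>) K)\<^sup>2)"

text \<open>The two random variables may live on different probability spaces.\<close>

definition d_TV :: "'w measure \<Rightarrow> ('w \<Rightarrow> real) \<Rightarrow> 'v measure \<Rightarrow> ('v \<Rightarrow> real) \<Rightarrow> real" where
  "d_TV M F M' G =
     (SUP A\<in>sets borel. \<bar>\<P>(\<omega> in M'. G \<omega> \<in> A) - \<P>(\<omega> in M. F \<omega> \<in> A)\<bar>)"

end

theory Submission
  imports Defs
begin

text \<open>
  Put \<open>Y = \<pi> dist\<^sup>2(X, K)\<close>. By Steiner's formula (\<open>steiner_polynomial\<close>) the volume of the set where
  \<open>\<pi> dist\<^sup>2 \<le> u\<close> is \<open>v u = (\<Sum>k\<le>d. b k * sqrt u ^ k)\<close> with \<open>b k \<ge> 0\<close>. Hence the law of \<open>Y\<close> is a mixture of Gamma laws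
  with shapes \<open>k / 2\<close>, and adding an independent exponential variable gives a law \<open>Q\<close> with density proportional to
  \<open>v u * exp (- u)\<close>. If \<open>K\<close> were a single point, \<open>v\<close> would be a multiple of \<open>u powr (d / 2)\<close> and \<open>Q\<close> a Gamma law with
  shape \<open>d / 2 + 1\<close>, which is nearly normal. For a body of diameter \<open>R\<close> the question is how far the logarithmic derivative
  \<open>M u = u * v' u / v u\<close> is from the constant \<open>d / 2\<close>.

  Two geometric facts control \<open>M\<close>. First, \<open>a \<mapsto> vol (a K + t B)\<close> is log-concave by the Prekopa-Leindler inequality
  (\<open>prekopa_leindler_Rd\<close>), which bounds the variance of the index \<open>k\<close> under the weights \<open>b k * sqrt u ^ k\<close> by the mean of
  \<open>d - k\<close> (\<open>steiner_variance_le\<close>); so the increasing function \<open>M\<close> has slope at most \<open>(d / 2 - M u) / (2 * u)\<close>. Second, a homothety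
  of a parallel body of \<open>K\<close> with centre in \<open>K\<close> is contained in a slightly larger parallel body (\<open>steiner_degree_ge\<close>), whence
  \<open>d / 2 - M u\<close> is at most a constant times \<open>d * R / sqrt u\<close>. At \<open>u = d / 32\<close>, well below the mean of \<open>Y\<close>, this is
  of order \<open>R * sqrt d\<close>.

  Consequently the logarithmic derivative \<open>M u / u - 1\<close> of the density of \<open>Q\<close> differs from that of the normal density with the mean
  and variance of \<open>Y\<close> by \<open>O((1 + R) / d)\<close> on average (\<open>score_expectation\<close>), apart from an exponentially small part of the mass. Stein's
  method turns this into a total variation distance, with a loss of the factor \<open>sqrt d\<close>, the order of the standard deviation
  (\<open>gaussian_comparison\<close>). On the bulk the density of \<open>Y\<close> is that of \<open>Q\<close> times \<open>M u / u\<close>, which is 1 up to a mean error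
  of order \<open>1 / sqrt d\<close> (\<open>law_normal_approximation\<close>).

  The outcome is \<open>d_TV \<le> 120000 * (1 + diam K) / sqrt d\<close> for every convex body (\<open>d_TV_convex_body_le\<close>). The first assertion is
  immediate, and convergence in law follows because total variation dominates the difference of distribution functions.
\<close>

section \<open>The Prekopa-Leindler inequality\<close>

text \<open>Inner regularity of finite measures extends to sets of infinite length by intersecting with long intervals.\<close>

lemma lborel_inner_compact:
  fixes A :: "real set"
  assumes A: "A \<in> sets borel" and r: "r < emeasure lborel A"
  obtains K where "compact K" "K \<subseteq> A" "r < emeasure lborel K"
proof -
  have inc: "incseq (\<lambda>n. A \<inter> {- real n..real n})"
    by (auto simp: incseq_def)
  have "(SUP n. emeasure lborel (A \<inter> {- real n..real n})) = emeasure lborel (\<Union>n. A \<inter> {- real n..real n})"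
    using A by (intro SUP_emeasure_incseq inc) auto
  also have "(\<Union>n. A \<inter> {- real n..real n}) = A"
  proof -
    have "\<exists>n. x \<in> {- real n..real n}" for x :: real
    proof -
      obtain n where "\<bar>x\<bar> \<le> real n" using real_arch_simple by blast
      then show ?thesis by (intro exI[of _ n]) auto
    qed
    then show ?thesis by blast
  qed
  finally obtain n where n: "r < emeasure lborel (A \<inter> {- real n..real n})"
    using r by (auto simp: less_SUP_iff dest!: sym[of "Sup _"])
  let ?M = "density lborel (indicator {- real n..real n})"
  have em: "emeasure ?M B = emeasure lborel (B \<inter> {- real n..real n})" if "B \<in> sets borel" for B
    using that by (subst emeasure_restricted) (auto simp: Int_commute)
  have "emeasure ?M A = (SUP K \<in> {K. K \<subseteq> A \<and> compact K}. emeasure ?M K)"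
    using A by (intro inner_regular) (auto simp: em emeasure_lborel_Icc_eq)
  then have "r < (SUP K \<in> {K. K \<subseteq> A \<and> compact K}. emeasure ?M K)"
    using n em[OF A] by simp
  then obtain K where K: "K \<subseteq> A" "compact K" "r < emeasure ?M K"
    unfolding less_SUP_iff by blast
  have "K \<in> sets borel" using K by (auto intro: borel_compact)
  then have "r < emeasure lborel K"
    using K(3) em[of K] by (metis (no_types, lifting) Int_lower1 emeasure_mono leD leI order_less_le_trans sets_lborel)
  with K that show ?thesis by blast
qed

lemma emeasure_lborel_compact_affine_image:
  fixes K :: "real set"
  assumes "compact K"
  shows "2 * emeasure lborel ((\<lambda>x. (x + c) / 2) ` K) = emeasure lborel K"
proof -
  have im: "(\<lambda>x. (x + c) / 2) ` K = (\<lambda>x. (1/2) *\<^sub>R x + c/2) ` K"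
    by (intro image_cong) (auto simp: field_simps)
  have cim: "compact ((\<lambda>x. (x + c) / 2) ` K)"
    using assms by (intro compact_continuous_image continuous_intros) auto
  have "emeasure lborel ((\<lambda>x. (x + c) / 2) ` K) = emeasure lebesgue ((\<lambda>x. (1/2) *\<^sub>R x + c/2) ` K)"
    using borel_compact[OF cim] unfolding im by simp
  also have "\<dots> = ennreal (1/2) * emeasure lborel K"
    using assms by (subst emeasure_lebesgue_affine) (simp add: borel_compact)
  finally have eq: "emeasure lborel ((\<lambda>x. (x + c) / 2) ` K) = ennreal (1/2) * emeasure lborel K" .
  have "2 * ennreal (1/2) = 1"
    using ennreal_mult'[of 2 "1/2"] by simp
  then show ?thesis
    by (simp add: eq mult.assoc[symmetric])
qed

text \<open>For compact sets, translate one by the minimum of the other and the other by the maximum of the first: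
  after halving, the two copies lie in \<open>C\<close> and meet in a single point, so their lengths add up.
  Inner regularity gives the general case.\<close>

lemma brunn_minkowski_real:
  fixes A B C :: "real set"
  assumes A: "A \<in> sets borel" "A \<noteq> {}" and B: "B \<in> sets borel" "B \<noteq> {}" and C: "C \<in> sets borel"
    and mid: "\<And>x y. x \<in> A \<Longrightarrow> y \<in> B \<Longrightarrow> (x + y) / 2 \<in> C"
  shows "emeasure lborel A + emeasure lborel B \<le> 2 * emeasure lborel C"
proof -
  have comp: "emeasure lborel K + emeasure lborel L \<le> 2 * emeasure lborel C"
    if K: "compact K" "K \<subseteq> A" "K \<noteq> {}" and L: "compact L" "L \<subseteq> B" "L \<noteq> {}" for K L
  proof -
    obtain k where k: "k \<in> K" "\<And>x. x \<in> K \<Longrightarrow> x \<le> k"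
      using compact_attains_sup[OF K(1,3)] by auto
    obtain l where l: "l \<in> L" "\<And>x. x \<in> L \<Longrightarrow> l \<le> x"
      using compact_attains_inf[OF L(1,3)] by auto
    let ?K = "(\<lambda>x. (x + l) / 2) ` K" and ?L = "(\<lambda>x. (x + k) / 2) ` L"
    have [measurable]: "?K \<in> sets borel" "?L \<in> sets borel"
      using K L by (auto intro!: borel_compact compact_continuous_image continuous_intros)
    have int: "?K \<inter> ?L \<subseteq> {(k + l)/2}"
    proof
      fix z assume "z \<in> ?K \<inter> ?L"
      then obtain x y where "x \<in> K" "y \<in> L" "z = (x + l)/2" "z = (y + k)/2" by auto
      then show "z \<in> {(k + l)/2}" using k(2)[of x] l(2)[of y] by (auto simp: field_simps)
    qed
    have "emeasure lborel (?K \<inter> ?L) \<le> emeasure lborel {(k + l)/2}"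
      by (intro emeasure_mono int) auto
    then have null: "emeasure lborel (?K \<inter> ?L) = 0" by simp
    have "emeasure lborel K + emeasure lborel L = 2 * (emeasure lborel ?K + emeasure lborel ?L)"
      using K L by (simp add: distrib_left emeasure_lborel_compact_affine_image)
    also have "emeasure lborel ?K + emeasure lborel ?L = emeasure lborel (?K \<union> ?L)"
      using emeasure_Un_Int[of ?K lborel ?L] null by simp
    also have "emeasure lborel (?K \<union> ?L) \<le> emeasure lborel C"
    proof (intro emeasure_mono)
      have "(y + k) / 2 \<in> C" if "y \<in> L" for y
        using mid[of k y] k that K L by (auto simp: add.commute)
      moreover have "(x + l) / 2 \<in> C" if "x \<in> K" for x
        using mid[of x l] l that K L by auto
      ultimately show "?K \<union> ?L \<subseteq> C" by blast
    qed (use C in auto)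
    finally show ?thesis by (simp add: mult_left_mono)
  qed
  have ne: "\<exists>K'. compact K' \<and> K' \<subseteq> S \<and> K' \<noteq> {} \<and> r \<le> emeasure lborel K'"
    if S: "S \<in> sets borel" "S \<noteq> {}" "r < emeasure lborel S \<or> r = 0" for S :: "real set" and r
  proof (cases "r < emeasure lborel S")
    case True
    obtain K where "compact K" "K \<subseteq> S" "r < emeasure lborel K"
      by (rule lborel_inner_compact[OF S(1) True])
    moreover then have "K \<noteq> {}" by auto
    ultimately show ?thesis by (meson less_imp_le)
  next
    case False
    then show ?thesis using S by (auto intro!: exI[of _ "{SOME x. x \<in> S}"] some_in_eq[THEN iffD2])
  qed
  have *: "r + s \<le> 2 * emeasure lborel C"
    if "r < emeasure lborel A \<or> r = 0" "s < emeasure lborel B \<or> s = 0" for r s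
    using ne[OF A that(1)] ne[OF B that(2)] comp by (meson add_mono order_trans)
  have sup: "emeasure lborel S = (SUP r\<in>{r. r < emeasure lborel S \<or> r = 0}. r)" for S :: "real set"
  proof (rule antisym)
    show "emeasure lborel S \<le> (SUP r\<in>{r. r < emeasure lborel S \<or> r = 0}. r)"
      by (rule dense_le) (auto intro!: Sup_upper)
    show "(SUP r\<in>{r. r < emeasure lborel S \<or> r = 0}. r) \<le> emeasure lborel S"
      by (auto intro!: Sup_least)
  qed
  have "emeasure lborel A + s \<le> 2 * emeasure lborel C" if "s < emeasure lborel B \<or> s = 0" for s
  proof -
    have "emeasure lborel A + s = (SUP r\<in>{r. r < emeasure lborel A \<or> r = 0}. r) + s"
      using sup[of A] by simp
    also have "\<dots> = (SUP r\<in>{r. r < emeasure lborel A \<or> r = 0}. r + s)"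
      by (subst ennreal_SUP_add_left[symmetric]) auto
    finally show ?thesis using * that by (auto intro!: SUP_least)
  qed
  then have "(SUP s\<in>{s. s < emeasure lborel B \<or> s = 0}. emeasure lborel A + s) \<le> 2 * emeasure lborel C"
    by (auto intro!: SUP_least)
  also have "(SUP s\<in>{s. s < emeasure lborel B \<or> s = 0}. emeasure lborel A + s) = emeasure lborel A + emeasure lborel B"
    using sup[of B] by (subst ennreal_SUP_add_right[symmetric]) auto
  finally show ?thesis .
qed


lemma nn_integral_indicator_less:
  "(\<integral>\<^sup>+t. indicator {0<..<1} t * indicator {t. ennreal t < z} t \<partial>lborel) = min z 1"
proof (cases z)
  case (real r)
  have "(\<lambda>t. indicator {0<..<1} t * indicator {t. ennreal t < z} t) = (indicator {0<..<min r 1} :: real \<Rightarrow> ennreal)"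
    using real by (auto simp: fun_eq_iff indicator_def ennreal_less_iff)
  then show ?thesis using real
    by (simp add: min_def)
next
  case top
  have "(\<lambda>t. indicator {0<..<1} t * indicator {t. ennreal t < z} t) = (indicator {0<..<1} :: real \<Rightarrow> ennreal)"
    using top by (auto simp: fun_eq_iff indicator_def)
  then show ?thesis using top by simp
qed

lemma nn_integral_layer_cake_unit:
  fixes f :: "real \<Rightarrow> ennreal"
  assumes [measurable]: "f \<in> borel_measurable borel"
  shows "(\<integral>\<^sup>+x. min (f x) 1 \<partial>lborel) = (\<integral>\<^sup>+t. indicator {0<..<1} t * emeasure lborel {x. ennreal t < f x} \<partial>lborel)"
proof -
  have "(\<integral>\<^sup>+x. min (f x) 1 \<partial>lborel) = (\<integral>\<^sup>+x. \<integral>\<^sup>+t. indicator {0<..<1} t * indicator {t. ennreal t < f x} t \<partial>lborel \<partial>lborel)"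
    by (simp add: nn_integral_indicator_less)
  also have "\<dots> = (\<integral>\<^sup>+t. \<integral>\<^sup>+x. indicator {0<..<1} t * indicator {t. ennreal t < f x} t \<partial>lborel \<partial>lborel)"
    by (intro lborel_pair.Fubini') (unfold indicator_def, measurable)
  also have "\<dots> = (\<integral>\<^sup>+t. indicator {0<..<1} t * (\<integral>\<^sup>+x. indicator {x. ennreal t < f x} x \<partial>lborel) \<partial>lborel)"
  proof (intro nn_integral_cong, subst nn_integral_cmult[symmetric])
    fix t :: real
    show "(\<lambda>x. indicator {x. ennreal t < f x} x :: ennreal) \<in> borel_measurable lborel"
      by measurable
    show "(\<integral>\<^sup>+x. indicator {0<..<1} t * indicator {t. ennreal t < f x} t \<partial>lborel) = (\<integral>\<^sup>+x. indicator {0<..<1} t * indicator {x. ennreal t < f x} x \<partial>lborel)"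
      by (intro nn_integral_cong) (auto simp: indicator_def)
  qed
  also have "\<dots> = (\<integral>\<^sup>+t. indicator {0<..<1} t * emeasure lborel {x. ennreal t < f x} \<partial>lborel)"
    by (intro nn_integral_cong) (simp add: nn_integral_indicator)
  finally show ?thesis .
qed

text \<open>With both suprema equal to 1, the superlevel sets of \<open>f\<close> and \<open>g\<close> at every level in \<open>(0,1)\<close> are nonempty,
  so the one-dimensional Brunn-Minkowski inequality applies level by level. The additive conclusion is stronger than the
  multiplicative one by the inequality of arithmetic and geometric means.\<close>

lemma prekopa_leindler_real_normalized:
  fixes f g h :: "real \<Rightarrow> ennreal"
  assumes [measurable]: "f \<in> borel_measurable borel" "g \<in> borel_measurable borel" "h \<in> borel_measurable borel"
    and f: "(SUP x. f x) = 1" and g: "(SUP x. g x) = 1"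
    and le: "\<And>x y. f x * g y \<le> (h ((x + y) / 2))\<^sup>2"
  shows "(\<integral>\<^sup>+x. f x \<partial>lborel) + (\<integral>\<^sup>+x. g x \<partial>lborel) \<le> 2 * (\<integral>\<^sup>+x. h x \<partial>lborel)"
proof -
  have lev: "emeasure lborel {x. ennreal t < f x} + emeasure lborel {x. ennreal t < g x} \<le> 2 * emeasure lborel {x. ennreal t < h x}"
    if t: "0 < t" "t < 1" for t
  proof (rule brunn_minkowski_real)
    have t1: "ennreal t < 1" using t by (simp add: ennreal_less_one_iff)
    then have "ennreal t < (SUP x. f x)" "ennreal t < (SUP x. g x)" by (simp_all only: f g)
    then show "{x. ennreal t < f x} \<noteq> {}" "{x. ennreal t < g x} \<noteq> {}"
      unfolding less_SUP_iff by auto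
    fix x y assume "x \<in> {x. ennreal t < f x}" "y \<in> {x. ennreal t < g x}"
    then have fg: "ennreal t < f x" "ennreal t < g y" by auto
    show "(x + y) / 2 \<in> {x. ennreal t < h x}"
    proof (rule ccontr)
      assume "\<not> ?thesis"
      then have "(h ((x + y) / 2))\<^sup>2 \<le> (ennreal t)\<^sup>2"
        by (intro power_mono) auto
      then have "f x * g y \<le> ennreal t * ennreal t"
        using le[of x y] by (simp add: power2_eq_square)
      moreover have "ennreal t * ennreal t < ennreal t * g y"
        using fg t by (intro ennreal_mult_strict_left_mono) auto
      moreover have "ennreal t * g y \<le> f x * g y"
        using fg by (intro mult_right_mono) auto
      ultimately show False by (metis leD order_less_le_trans)
    qed
  qed measurable
  have f1: "f x = min (f x) 1" and g1: "g x = min (g x) 1" for x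
    using f g by (metis SUP_upper UNIV_I min.absorb1)+
  have "(\<integral>\<^sup>+x. f x \<partial>lborel) + (\<integral>\<^sup>+x. g x \<partial>lborel)
      = (\<integral>\<^sup>+t. indicator {0<..<1} t * emeasure lborel {x. ennreal t < f x} \<partial>lborel)
      + (\<integral>\<^sup>+t. indicator {0<..<1} t * emeasure lborel {x. ennreal t < g x} \<partial>lborel)"
    using nn_integral_layer_cake_unit[of f] nn_integral_layer_cake_unit[of g] by (simp add: f1[symmetric] g1[symmetric])
  also have "\<dots> = (\<integral>\<^sup>+t. indicator {0<..<1} t * (emeasure lborel {x. ennreal t < f x} + emeasure lborel {x. ennreal t < g x}) \<partial>lborel)"
    by (subst nn_integral_add[symmetric]) (auto simp: distrib_left)
  also have "\<dots> \<le> (\<integral>\<^sup>+t. 2 * (indicator {0<..<1} t * emeasure lborel {x. ennreal t < h x}) \<partial>lborel)"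
    using lev by (intro nn_integral_mono) (auto simp: indicator_def)
  also have "\<dots> = 2 * (\<integral>\<^sup>+x. min (h x) 1 \<partial>lborel)"
    by (subst nn_integral_cmult) (auto simp: nn_integral_layer_cake_unit)
  also have "\<dots> \<le> 2 * (\<integral>\<^sup>+x. h x \<partial>lborel)"
    by (intro mult_left_mono nn_integral_mono) auto
  finally show ?thesis .
qed

lemma prekopa_leindler_real_bounded:
  fixes f g h :: "real \<Rightarrow> ennreal"
  assumes [measurable]: "f \<in> borel_measurable borel" "g \<in> borel_measurable borel" "h \<in> borel_measurable borel"
    and f: "(SUP x. f x) < \<infinity>" and g: "(SUP x. g x) < \<infinity>"
    and le: "\<And>x y. f x * g y \<le> (h ((x + y) / 2))\<^sup>2"
  shows "(\<integral>\<^sup>+x. f x \<partial>lborel) * (\<integral>\<^sup>+x. g x \<partial>lborel) \<le> (\<integral>\<^sup>+x. h x \<partial>lborel)\<^sup>2"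
proof (cases "(SUP x. f x) = 0 \<or> (SUP x. g x) = 0")
  case True
  then have "(\<forall>x. f x = 0) \<or> (\<forall>x. g x = 0)"
    by (metis SUP_upper UNIV_I le_zero_eq)
  then show ?thesis by auto
next
  case False
  obtain a where a: "(SUP x. f x) = ennreal a" "0 < a"
    using f False by (cases "SUP x. f x") (auto simp: less_le)
  obtain b where b: "(SUP x. g x) = ennreal b" "0 < b"
    using g False by (cases "SUP x. g x") (auto simp: less_le)
  define c where "c = sqrt (a * b)"
  have c: "c > 0" "c * c = a * b" using a b by (auto simp: c_def)
  let ?F = "\<integral>\<^sup>+x. f x \<partial>lborel" and ?G = "\<integral>\<^sup>+x. g x \<partial>lborel" and ?H = "\<integral>\<^sup>+x. h x \<partial>lborel"
  have "(\<integral>\<^sup>+x. f x / ennreal a \<partial>lborel) + (\<integral>\<^sup>+x. g x / ennreal b \<partial>lborel) \<le> 2 * (\<integral>\<^sup>+x. h x / ennreal c \<partial>lborel)"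
  proof (rule prekopa_leindler_real_normalized)
    show "(SUP x. f x / ennreal a) = 1"
      using a by (simp add: SUP_divide_ennreal[symmetric] ennreal_divide_self)
    show "(SUP x. g x / ennreal b) = 1"
      using b by (simp add: SUP_divide_ennreal[symmetric] ennreal_divide_self)
    fix x y
    have "f x / ennreal a * (g y / ennreal b) = f x * g y / (ennreal a * ennreal b)"
      using a b by (simp add: divide_ennreal_def ennreal_inverse_mult mult_ac)
    also have "\<dots> = f x * g y / (ennreal c * ennreal c)"
      using a b c by (simp add: ennreal_mult[symmetric])
    also have "\<dots> \<le> (h ((x + y) / 2))\<^sup>2 / (ennreal c * ennreal c)"
      by (intro divide_right_mono_ennreal le)
    also have "\<dots> = (h ((x + y) / 2) / ennreal c)\<^sup>2"
      using c by (simp add: divide_ennreal_def ennreal_inverse_mult power2_eq_square mult_ac)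
    finally show "f x / ennreal a * (g y / ennreal b) \<le> (h ((x + y) / 2) / ennreal c)\<^sup>2" .
  qed measurable
  then have main: "?F / ennreal a + ?G / ennreal b \<le> 2 * (?H / ennreal c)"
    by (simp add: nn_integral_divide)
  show ?thesis
  proof (cases ?H)
    case top
    then show ?thesis by (simp add: power2_eq_square)
  next
    case H: (real H)
    have "2 * (?H / ennreal c) < \<infinity>"
      using H c by (simp add: divide_ennreal ennreal_mult_less_top)
    then have fin: "?F / ennreal a + ?G / ennreal b < \<infinity>"
      using main by (rule le_less_trans[rotated])
    obtain F where F: "?F = ennreal F" "F \<ge> 0"
      using fin a by (cases ?F) (auto simp: ennreal_top_divide)
    obtain G where G: "?G = ennreal G" "G \<ge> 0"
      using fin b by (cases ?G) (auto simp: ennreal_top_divide)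
    have "ennreal (F / a + G / b) \<le> ennreal (2 * (H / c))"
      using main F G H a b c ennreal_mult'[of 2 "H / c"] by (simp add: divide_ennreal)
    then have *: "F / a + G / b \<le> 2 * (H / c)"
      using H c by (subst (asm) ennreal_le_iff) auto
    have "4 * ((F / a) * (G / b)) \<le> (F / a + G / b)\<^sup>2"
      using zero_le_power2[of "F/a - G/b"] by (simp add: power2_sum power2_diff)
    also have "\<dots> \<le> (2 * (H / c))\<^sup>2"
      using * F G a b by (intro power_mono) auto
    finally have "(F * G) / (a * b) \<le> (H * H) / (a * b)"
      by (simp add: power2_eq_square c(2))
    then have "F * G \<le> H * H"
      using a b by (simp add: divide_le_cancel)
    then show ?thesis using F G H
      by (simp add: power2_eq_square ennreal_mult[symmetric])
  qed
qed

text \<open>Truncation of \<open>f\<close> and \<open>g\<close> reduces to bounded functions.\<close>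

theorem prekopa_leindler_real:
  fixes f g h :: "real \<Rightarrow> ennreal"
  assumes [measurable]: "f \<in> borel_measurable borel" "g \<in> borel_measurable borel" "h \<in> borel_measurable borel"
    and le: "\<And>x y. f x * g y \<le> (h ((x + y) / 2))\<^sup>2"
  shows "(\<integral>\<^sup>+x. f x \<partial>lborel) * (\<integral>\<^sup>+x. g x \<partial>lborel) \<le> (\<integral>\<^sup>+x. h x \<partial>lborel)\<^sup>2"
proof -
  have trunc: "(\<integral>\<^sup>+x. k x \<partial>lborel) = (SUP n::nat. \<integral>\<^sup>+x. min (k x) (of_nat n) \<partial>lborel)"
    if [measurable]: "k \<in> borel_measurable borel" for k :: "real \<Rightarrow> ennreal"
  proof -
    have "(SUP n::nat. min z (of_nat n)) = z" for z :: ennreal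
    proof (rule antisym)
      show "(SUP n::nat. min z (of_nat n)) \<le> z" by (intro SUP_least) auto
      have "z = (SUP n::nat. min z (of_nat n))" if "z \<noteq> top"
      proof -
        obtain n where "z < of_nat n"
          using ennreal_Ex_less_of_nat[of z] \<open>z \<noteq> top\<close> by (auto simp: less_top)
        then have "z \<le> of_nat n" by simp
        then show ?thesis
          by (intro antisym SUP_least SUP_upper2[of n]) auto
      qed
      moreover have "(SUP n::nat. min top (of_nat n)) = (top::ennreal)"
        by (simp add: ennreal_SUP_of_nat_eq_top)
      ultimately show "z \<le> (SUP n::nat. min z (of_nat n))" by (metis order_refl)
    qed
    then have "(\<integral>\<^sup>+x. k x \<partial>lborel) = (\<integral>\<^sup>+x. (SUP n::nat. min (k x) (of_nat n)) \<partial>lborel)" by simp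
    also have "\<dots> = (SUP n::nat. \<integral>\<^sup>+x. min (k x) (of_nat n) \<partial>lborel)"
      by (intro nn_integral_monotone_convergence_SUP)
        (auto simp: incseq_def le_fun_def min.coboundedI2 of_nat_mono min_le_iff_disj)
    finally show ?thesis .
  qed
  have *: "(\<integral>\<^sup>+x. min (f x) (of_nat n) \<partial>lborel) * (\<integral>\<^sup>+x. min (g x) (of_nat m) \<partial>lborel) \<le> (\<integral>\<^sup>+x. h x \<partial>lborel)\<^sup>2" for n m :: nat
  proof (rule prekopa_leindler_real_bounded)
    show "(SUP x. min (f x) (of_nat n)) < \<infinity>"
      by (rule le_less_trans[of _ "of_nat n"]) (auto intro: SUP_least simp: of_nat_less_top)
    show "(SUP x. min (g x) (of_nat m)) < \<infinity>"
      by (rule le_less_trans[of _ "of_nat m"]) (auto intro: SUP_least simp: of_nat_less_top)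
    show "min (f x) (of_nat n) * min (g y) (of_nat m) \<le> (h ((x + y) / 2))\<^sup>2" for x y
      by (rule order_trans[OF mult_mono le]) auto
  qed measurable
  have "(\<integral>\<^sup>+x. min (f x) (of_nat n) \<partial>lborel) * (\<integral>\<^sup>+x. g x \<partial>lborel) \<le> (\<integral>\<^sup>+x. h x \<partial>lborel)\<^sup>2" for n :: nat
    using * by (subst trunc[of g]) (auto simp: SUP_mult_left_ennreal intro!: SUP_least)
  then show ?thesis
    by (subst trunc[of f]) (auto simp: SUP_mult_right_ennreal intro!: SUP_least)
qed

text \<open>Induction on the dimension: the partial integrals over the first \<open>d\<close> coordinates satisfy the one-dimensional
  hypothesis by the induction hypothesis.\<close>

theorem prekopa_leindler_Rd:
  fixes f g h :: "(nat \<Rightarrow> real) \<Rightarrow> ennreal"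
  assumes "f \<in> borel_measurable (lborel_Rd d)" "g \<in> borel_measurable (lborel_Rd d)" "h \<in> borel_measurable (lborel_Rd d)"
    and "\<And>x y. x \<in> space (lborel_Rd d) \<Longrightarrow> y \<in> space (lborel_Rd d) \<Longrightarrow> f x * g y \<le> (h (\<lambda>i\<in>{..<d}. (x i + y i) / 2))\<^sup>2"
  shows "(\<integral>\<^sup>+x. f x \<partial>lborel_Rd d) * (\<integral>\<^sup>+x. g x \<partial>lborel_Rd d) \<le> (\<integral>\<^sup>+x. h x \<partial>lborel_Rd d)\<^sup>2"
  using assms
proof (induction d arbitrary: f g h)
  case 0
  interpret product_sigma_finite "\<lambda>_::nat. lborel :: real measure" ..
  have "f (\<lambda>_. undefined) * g (\<lambda>_. undefined) \<le> (h (\<lambda>_. undefined))\<^sup>2"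
    using 0(4)[of "\<lambda>_. undefined" "\<lambda>_. undefined"] by (simp add: space_PiM restrict_def)
  then show ?case by (simp add: nn_integral_empty)
next
  case (Suc d)
  interpret product_sigma_finite "\<lambda>_::nat. lborel :: real measure" ..
  have ins: "{..<Suc d} = insert d {..<d}" by auto
  note [measurable] = Suc.prems(1-3)[unfolded ins]
  have rev: "(\<integral>\<^sup>+x. k x \<partial>lborel_Rd (Suc d)) = (\<integral>\<^sup>+y. (\<integral>\<^sup>+x. k (x(d := y)) \<partial>lborel_Rd d) \<partial>lborel)"
    if "k \<in> borel_measurable (PiM (insert d {..<d}) (\<lambda>_. lborel))" for k
    unfolding ins using that by (intro product_nn_integral_insert_rev) auto
  interpret sigma_finite_measure "lborel_Rd d" by (rule sigma_finite) auto
  have meas: "(\<lambda>x. k (x(d := y))) \<in> borel_measurable (lborel_Rd d)"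
    "(\<lambda>y. \<integral>\<^sup>+x. k (x(d := y)) \<partial>lborel_Rd d) \<in> borel_measurable borel"
    if [measurable]: "k \<in> borel_measurable (PiM (insert d {..<d}) (\<lambda>_. lborel))" for k :: "(nat \<Rightarrow> real) \<Rightarrow> ennreal" and y
    by measurable
  have pt: "(\<integral>\<^sup>+x. f (x(d := s)) \<partial>lborel_Rd d) * (\<integral>\<^sup>+x. g (x(d := t)) \<partial>lborel_Rd d)
      \<le> (\<integral>\<^sup>+x. h (x(d := (s + t) / 2)) \<partial>lborel_Rd d)\<^sup>2" for s t
  proof (rule Suc.IH)
    fix x y assume xy: "x \<in> space (lborel_Rd d)" "y \<in> space (lborel_Rd d)"
    have "f (x(d := s)) * g (y(d := t)) \<le> (h (\<lambda>i\<in>{..<Suc d}. ((x(d := s)) i + (y(d := t)) i) / 2))\<^sup>2"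
      using xy by (intro Suc.prems(4)) (auto simp: space_PiM PiE_def extensional_def)
    also have "(\<lambda>i\<in>{..<Suc d}. ((x(d := s)) i + (y(d := t)) i) / 2) = (\<lambda>i\<in>{..<d}. (x i + y i) / 2)(d := (s + t) / 2)"
      by (auto simp: fun_eq_iff restrict_def)
    finally show "f (x(d := s)) * g (y(d := t)) \<le> (h ((\<lambda>i\<in>{..<d}. (x i + y i) / 2)(d := (s + t) / 2)))\<^sup>2" .
  qed (intro meas, measurable)+
  show ?case
    unfolding rev[OF Suc.prems(1)[unfolded ins]] rev[OF Suc.prems(2)[unfolded ins]] rev[OF Suc.prems(3)[unfolded ins]]
    by (intro prekopa_leindler_real pt meas) measurable
qed

section \<open>The coordinate space\<close>

lemma space_Rd: "space (lborel_Rd d) = PiE {..<d} (\<lambda>_. UNIV)"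
  by (simp add: space_PiM)

lemma Rd_restrict [simp, intro]: "(\<lambda>i\<in>{..<d}. f i) \<in> space (lborel_Rd d)"
  by (simp add: space_Rd)

lemma Rd_eqI:
  assumes "x \<in> space (lborel_Rd d)" "y \<in> space (lborel_Rd d)" "\<And>i. i < d \<Longrightarrow> x i = y i"
  shows "x = y"
  using assms unfolding space_Rd by (intro PiE_ext[of x "{..<d}" "\<lambda>_. UNIV" y]) auto

text \<open>Linear algebra takes place among all functions on \<open>nat\<close>: inner product and distance read the first \<open>d\<close> coordinates only,
  so that sums and multiples of vectors need not be restricted to \<open>{..<d}\<close> inside them.\<close>

definition ip :: "nat \<Rightarrow> (nat \<Rightarrow> real) \<Rightarrow> (nat \<Rightarrow> real) \<Rightarrow> real" where
  "ip d x y = (\<Sum>i<d. x i * y i)"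

lemma ip_cong: "(\<And>i. i < d \<Longrightarrow> x i = x' i) \<Longrightarrow> (\<And>i. i < d \<Longrightarrow> y i = y' i) \<Longrightarrow> ip d x y = ip d x' y'"
  by (simp add: ip_def)

lemma ip_restrict [simp]: "ip d (restrict x {..<d}) y = ip d x y" "ip d x (restrict y {..<d}) = ip d x y"
  by (simp_all add: ip_def)

lemma ip_commute: "ip d x y = ip d y x"
  by (simp add: ip_def mult.commute)

lemma ip_add_left: "ip d (\<lambda>i. x i + y i) z = ip d x z + ip d y z"
  by (simp add: ip_def distrib_right sum.distrib)
lemma ip_diff_left: "ip d (\<lambda>i. x i - y i) z = ip d x z - ip d y z"
  by (simp add: ip_def left_diff_distrib sum_subtractf)
lemma ip_scale_left: "ip d (\<lambda>i. c * x i) z = c * ip d x z"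
  by (simp add: ip_def sum_distrib_left mult.assoc)
lemma ip_sum_left: "ip d (\<lambda>i. \<Sum>j\<in>J. f j i) z = (\<Sum>j\<in>J. ip d (f j) z)"
  unfolding ip_def sum_distrib_right by (rule sum.swap)
lemma ip_add_right: "ip d z (\<lambda>i. x i + y i) = ip d z x + ip d z y"
  by (simp add: ip_commute[of d z] ip_add_left)
lemma ip_diff_right: "ip d z (\<lambda>i. x i - y i) = ip d z x - ip d z y"
  by (simp add: ip_commute[of d z] ip_diff_left)
lemma ip_scale_right: "ip d z (\<lambda>i. c * x i) = c * ip d z x"
  by (simp add: ip_commute[of d z] ip_scale_left)
lemma ip_sum_right: "ip d z (\<lambda>i. \<Sum>j\<in>J. f j i) = (\<Sum>j\<in>J. ip d z (f j))"
  by (simp add: ip_commute[of d z] ip_sum_left)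

lemmas ip_linear = ip_add_left ip_add_right ip_diff_left ip_diff_right ip_scale_left ip_scale_right

lemma ip_self_nonneg: "ip d x x \<ge> 0"
  by (simp add: ip_def sum_nonneg)

lemma ip_self_eq_0: "ip d x x = 0 \<Longrightarrow> i < d \<Longrightarrow> x i = 0"
  by (auto simp: ip_def sum_nonneg_eq_0_iff)

lemma dist_Rd_ip: "dist_Rd d x y = sqrt (ip d (\<lambda>i. x i - y i) (\<lambda>i. x i - y i))"
  by (simp add: dist_Rd_def L2_set_def ip_def power2_eq_square)

lemma dist_Rd_sq: "(dist_Rd d x y)\<^sup>2 = ip d (\<lambda>i. x i - y i) (\<lambda>i. x i - y i)"
  by (simp add: dist_Rd_ip ip_self_nonneg)

lemma dist_Rd_nonneg [simp]: "dist_Rd d x y \<ge> 0"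
  by (simp add: dist_Rd_def L2_set_nonneg)

lemma dist_Rd_self [simp]: "dist_Rd d x x = 0"
  by (simp add: dist_Rd_def L2_set_def)

lemma dist_Rd_cong: "(\<And>i. i < d \<Longrightarrow> x i = x' i) \<Longrightarrow> (\<And>i. i < d \<Longrightarrow> y i = y' i) \<Longrightarrow> dist_Rd d x y = dist_Rd d x' y'"
  unfolding dist_Rd_def by (intro L2_set_cong) auto

lemma dist_Rd_eq_0D: "dist_Rd d x y = 0 \<Longrightarrow> i < d \<Longrightarrow> x i = y i"
  by (auto simp: dist_Rd_def L2_set_eq_0_iff)

lemma dist_Rd_commute: "dist_Rd d x y = dist_Rd d y x"
  by (simp add: dist_Rd_def L2_set_def power2_commute)

lemma dist_Rd_triangle: "dist_Rd d x z \<le> dist_Rd d x y + dist_Rd d y z"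
  using L2_set_triangle_ineq[of "\<lambda>i. x i - y i" "\<lambda>i. y i - z i" "{..<d}"]
  by (simp add: dist_Rd_def)

lemma dist_Rd_scale: "dist_Rd d (\<lambda>i. c * x i) (\<lambda>i. c * y i) = \<bar>c\<bar> * dist_Rd d x y"
proof -
  have "dist_Rd d (\<lambda>i. c * x i) (\<lambda>i. c * y i) = sqrt (c\<^sup>2 * (dist_Rd d x y)\<^sup>2)"
    by (simp add: dist_Rd_def L2_set_def sum_distrib_left power_mult_distrib right_diff_distrib[symmetric] sum_nonneg)
  then show ?thesis by (simp add: real_sqrt_mult)
qed

lemma dist_Rd_add: "dist_Rd d (\<lambda>i. x i + x' i) (\<lambda>i. y i + y' i) \<le> dist_Rd d x y + dist_Rd d x' y'"
  using L2_set_triangle_ineq[of "\<lambda>i. x i - y i" "\<lambda>i. x' i - y' i" "{..<d}"]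
  by (simp add: dist_Rd_def algebra_simps)

lemma abs_diff_le_dist_Rd: "i < d \<Longrightarrow> \<bar>x i - y i\<bar> \<le> dist_Rd d x y"
  using member_le_L2_set[of "{..<d}" i "\<lambda>i. \<bar>x i - y i\<bar>"] by (simp add: dist_Rd_def L2_set_def)

lemma dist_Rd_le_sum: "dist_Rd d x y \<le> (\<Sum>i<d. \<bar>x i - y i\<bar>)"
  using L2_set_le_sum_abs by (simp add: dist_Rd_def)

subsection \<open>Distance to a set\<close>

lemma infdist_Rd_bdd: "bdd_below ((\<lambda>y. dist_Rd d x y) ` K)"
  by (rule bdd_belowI[of _ 0]) auto

lemma infdist_Rd_nonneg [simp]: "infdist_Rd d x K \<ge> 0"
  by (auto simp: infdist_Rd_def intro!: cINF_greatest)

lemma infdist_Rd_le: "y \<in> K \<Longrightarrow> infdist_Rd d x K \<le> dist_Rd d x y"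
  by (auto simp: infdist_Rd_def intro!: cINF_lower infdist_Rd_bdd)

lemma infdist_Rd_greatest: "K \<noteq> {} \<Longrightarrow> (\<And>y. y \<in> K \<Longrightarrow> r \<le> dist_Rd d x y) \<Longrightarrow> r \<le> infdist_Rd d x K"
  by (auto simp: infdist_Rd_def intro!: cINF_greatest)

lemma infdist_Rd_approx:
  assumes "K \<noteq> {}" "infdist_Rd d x K < r"
  obtains y where "y \<in> K" "dist_Rd d x y < r"
  using assms infdist_Rd_greatest by (meson not_le)

lemma infdist_Rd_lipschitz: "infdist_Rd d x K \<le> infdist_Rd d z K + dist_Rd d x z"
proof (cases "K = {}")
  case False
  have "infdist_Rd d x K - dist_Rd d x z \<le> infdist_Rd d z K"
  proof (rule infdist_Rd_greatest[OF False])
    fix y assume "y \<in> K"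
    then show "infdist_Rd d x K - dist_Rd d x z \<le> dist_Rd d z y"
      using infdist_Rd_le[of y K d x] dist_Rd_triangle[of d x y z] by linarith
  qed
  then show ?thesis by simp
qed (simp add: infdist_Rd_def)

lemma infdist_Rd_antimono: "L \<subseteq> K \<Longrightarrow> L \<noteq> {} \<Longrightarrow> infdist_Rd d x K \<le> infdist_Rd d x L"
  by (intro infdist_Rd_greatest) (auto intro: infdist_Rd_le)

lemma infdist_Rd_cong: "(\<And>i. i < d \<Longrightarrow> x i = y i) \<Longrightarrow> infdist_Rd d x K = infdist_Rd d y K"
  by (simp add: infdist_Rd_def cong: dist_Rd_cong)

lemma infdist_Rd_restrict [simp]: "infdist_Rd d (restrict x {..<d}) K = infdist_Rd d x K"
  by (rule infdist_Rd_cong) simp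

lemma infdist_Rd_convex:
  assumes "convex_Rd d K" "K \<noteq> {}" "u \<ge> 0" "v \<ge> 0" "u + v = 1"
  shows "infdist_Rd d (\<lambda>i. u * x i + v * y i) K \<le> u * infdist_Rd d x K + v * infdist_Rd d y K"
proof (rule field_le_epsilon)
  fix e :: real assume e: "e > 0"
  obtain a where a: "a \<in> K" "dist_Rd d x a < infdist_Rd d x K + e"
    using e by (auto intro: infdist_Rd_approx[OF assms(2), of d x "infdist_Rd d x K + e"])
  obtain b where b: "b \<in> K" "dist_Rd d y b < infdist_Rd d y K + e"
    using e by (auto intro: infdist_Rd_approx[OF assms(2), of d y "infdist_Rd d y K + e"])
  let ?c = "\<lambda>i. u * a i + v * b i"
  have "restrict ?c {..<d} \<in> K"
    using assms a b by (auto simp: convex_Rd_def)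
  then have "infdist_Rd d (\<lambda>i. u * x i + v * y i) K \<le> dist_Rd d (\<lambda>i. u * x i + v * y i) (restrict ?c {..<d})"
    by (rule infdist_Rd_le)
  also have "\<dots> = dist_Rd d (\<lambda>i. u * x i + v * y i) ?c"
    by (rule dist_Rd_cong) auto
  also have "\<dots> \<le> u * dist_Rd d x a + v * dist_Rd d y b"
    using dist_Rd_add[of d "\<lambda>i. u * x i" "\<lambda>i. v * y i" "\<lambda>i. u * a i" "\<lambda>i. v * b i"] assms
    by (simp add: dist_Rd_scale)
  also have "\<dots> \<le> u * (infdist_Rd d x K + e) + v * (infdist_Rd d y K + e)"
    using a b assms by (intro add_mono mult_left_mono) auto
  also have "\<dots> = u * infdist_Rd d x K + v * infdist_Rd d y K + (u + v) * e"
    by (simp add: algebra_simps)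
  finally show "infdist_Rd d (\<lambda>i. u * x i + v * y i) K \<le> u * infdist_Rd d x K + v * infdist_Rd d y K + e"
    using assms by simp
qed

subsection \<open>Measurability\<close>

lemma coord_measurable: "i < d \<Longrightarrow> (\<lambda>x. x i) \<in> borel_measurable (lborel_Rd d)"
  by (rule measurable_component_singleton[where M="\<lambda>_. lborel", simplified]) auto

lemma Rd_measurableI:
  assumes "\<And>i. i < d \<Longrightarrow> (\<lambda>x. f x i) \<in> borel_measurable M"
  shows "(\<lambda>x. \<lambda>i\<in>{..<d}. f x i) \<in> measurable M (lborel_Rd d)"
  using assms by (intro measurable_restrict) auto

lemma dist_Rd_measurable [measurable]: "(\<lambda>x. dist_Rd d x z) \<in> borel_measurable (lborel_Rd d)"
  unfolding dist_Rd_def L2_set_def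
  by (intro measurable_compose[OF _ borel_measurable_sqrt] borel_measurable_sum borel_measurable_power borel_measurable_diff coord_measurable) auto

lemma ip_measurable:
  assumes "\<And>i. i < d \<Longrightarrow> (\<lambda>x. f x i) \<in> borel_measurable M" "\<And>i. i < d \<Longrightarrow> (\<lambda>x. g x i) \<in> borel_measurable M"
  shows "(\<lambda>x. ip d (f x) (g x)) \<in> borel_measurable M"
  unfolding ip_def using assms by (intro borel_measurable_sum borel_measurable_times) auto

text \<open>The Borel structure of the product measure is reached through Lipschitz functions: the rational points
  are countable and dense, which makes every Lipschitz function measurable.\<close>

lemma rational_Rd_dense:
  assumes "x \<in> space (lborel_Rd d)" "e > 0"
  shows "\<exists>z\<in>PiE {..<d} (\<lambda>_. \<rat>). dist_Rd d x z < e"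
proof -
  have "\<exists>q\<in>\<rat>. \<bar>x i - q\<bar> < e / (d + 1)" for i
  proof -
    have "x i < x i + e / (d + 1)" using assms by simp
    then obtain q where "q \<in> \<rat>" "x i < q" "q < x i + e / (d + 1)"
      using Rats_dense_in_real by blast
    then show ?thesis by (intro bexI[of _ q]) auto
  qed
  then have "\<forall>i. \<exists>q. q \<in> \<rat> \<and> \<bar>x i - q\<bar> < e / (d + 1)" by blast
  then obtain q where q: "\<And>i. q i \<in> \<rat>" "\<And>i. \<bar>x i - q i\<bar> < e / (d + 1)"
    by (auto dest!: choice)
  have "dist_Rd d x (restrict q {..<d}) \<le> (\<Sum>i<d. \<bar>x i - q i\<bar>)"
    using dist_Rd_le_sum[of d x "restrict q {..<d}"] by simp
  also have "\<dots> \<le> (\<Sum>i<d. e / (d + 1))"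
    by (intro sum_mono less_imp_le q)
  also have "\<dots> < e"
  proof -
    have "real d * (e / (d + 1)) < (d + 1) * (e / (d + 1))"
      using assms by (intro mult_strict_right_mono) auto
    then show ?thesis by simp
  qed
  finally show ?thesis
    using q by (intro bexI[of _ "restrict q {..<d}"]) auto
qed

lemma Rd_lipschitz_measurable:
  fixes g :: "(nat \<Rightarrow> real) \<Rightarrow> real"
  assumes "\<And>x y. x \<in> space (lborel_Rd d) \<Longrightarrow> y \<in> space (lborel_Rd d) \<Longrightarrow> g x \<le> g y + dist_Rd d x y"
  shows "g \<in> borel_measurable (lborel_Rd d)"
proof (rule borel_measurable_iff_less[THEN iffD2], intro allI)
  fix r :: real
  let ?Q = "PiE {..<d} (\<lambda>_. \<rat>) :: (nat \<Rightarrow> real) set"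
  have Q: "?Q \<subseteq> space (lborel_Rd d)" by (auto simp: space_Rd)
  have "{w \<in> space (lborel_Rd d). g w < r} = (\<Union>z\<in>?Q. {w \<in> space (lborel_Rd d). g z + dist_Rd d w z < r})"
  proof (intro set_eqI iffI)
    fix w assume w: "w \<in> {w \<in> space (lborel_Rd d). g w < r}"
    then obtain z where z: "z \<in> ?Q" "dist_Rd d w z < (r - g w) / 2"
      using rational_Rd_dense[of w d "(r - g w)/2"] by auto
    have "g z \<le> g w + dist_Rd d w z"
      using assms[of z w] z w Q dist_Rd_commute[of d z w] by auto
    then have "g z + dist_Rd d w z < r" using z by (auto simp: field_simps)
    then show "w \<in> (\<Union>z\<in>?Q. {w \<in> space (lborel_Rd d). g z + dist_Rd d w z < r})"
      using z w by auto
  next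
    fix w assume "w \<in> (\<Union>z\<in>?Q. {w \<in> space (lborel_Rd d). g z + dist_Rd d w z < r})"
    then obtain z where z: "z \<in> ?Q" "w \<in> space (lborel_Rd d)" "g z + dist_Rd d w z < r" by blast
    have "g w \<le> g z + dist_Rd d w z" by (intro assms z subsetD[OF Q])
    with z show "w \<in> {w \<in> space (lborel_Rd d). g w < r}" by simp
  qed
  also have "\<dots> \<in> sets (lborel_Rd d)"
  proof (rule sets.countable_UN'')
    show "countable ?Q" by (intro countable_PiE) (auto simp: countable_rat)
  qed measurable
  finally show "{w \<in> space (lborel_Rd d). g w < r} \<in> sets (lborel_Rd d)" .
qed

lemma infdist_Rd_measurable [measurable]: "(\<lambda>x. infdist_Rd d x K) \<in> borel_measurable (lborel_Rd d)"
  by (intro Rd_lipschitz_measurable infdist_Rd_lipschitz)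

subsection \<open>Volume factors\<close>

text \<open>For a linear bijection \<open>\<phi>\<close> the number \<open>r\<close> is the inverse of the absolute value of its determinant. Determinants are
  avoided: the existence of the factor follows from the uniqueness of Haar measure, and its value is read off from the preimage
  of a single set or, for a reflection, from its being an involution.\<close>

definition vol_factor :: "nat \<Rightarrow> ((nat \<Rightarrow> real) \<Rightarrow> (nat \<Rightarrow> real)) \<Rightarrow> real \<Rightarrow> bool" where
  "vol_factor d \<phi> r \<longleftrightarrow> \<phi> \<in> measurable (lborel_Rd d) (lborel_Rd d) \<and> r > 0 \<and>
     (\<forall>B\<in>sets (lborel_Rd d). emeasure (lborel_Rd d) {x \<in> space (lborel_Rd d). \<phi> x \<in> B} = ennreal r * emeasure (lborel_Rd d) B)"

lemma vol_factor_compose: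
  assumes \<phi>: "vol_factor d \<phi> r" and \<psi>: "vol_factor d \<psi> s"
  shows "vol_factor d (\<lambda>x. \<phi> (\<psi> x)) (r * s)"
proof -
  have [measurable]: "\<phi> \<in> measurable (lborel_Rd d) (lborel_Rd d)" "\<psi> \<in> measurable (lborel_Rd d) (lborel_Rd d)"
    and rs: "r > 0" "s > 0"
    using assms by (auto simp: vol_factor_def)
  have "emeasure (lborel_Rd d) {x \<in> space (lborel_Rd d). \<phi> (\<psi> x) \<in> B} = ennreal (r * s) * emeasure (lborel_Rd d) B"
    if [measurable]: "B \<in> sets (lborel_Rd d)" for B
  proof -
    let ?C = "{x \<in> space (lborel_Rd d). \<phi> x \<in> B}"
    have C: "?C \<in> sets (lborel_Rd d)" by measurable
    have "{x \<in> space (lborel_Rd d). \<phi> (\<psi> x) \<in> B} = {x \<in> space (lborel_Rd d). \<psi> x \<in> ?C}"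
      using measurable_space[of \<psi> "lborel_Rd d" "lborel_Rd d"] by auto
    then have "emeasure (lborel_Rd d) {x \<in> space (lborel_Rd d). \<phi> (\<psi> x) \<in> B} = emeasure (lborel_Rd d) {x \<in> space (lborel_Rd d). \<psi> x \<in> ?C}"
      by (simp only:)
    also have "\<dots> = ennreal s * emeasure (lborel_Rd d) ?C"
      using \<psi> C unfolding vol_factor_def by blast
    also have "emeasure (lborel_Rd d) ?C = ennreal r * emeasure (lborel_Rd d) B"
      using \<phi> that unfolding vol_factor_def by blast
    finally show ?thesis
      using rs by (simp add: ennreal_mult mult_ac)
  qed
  then show ?thesis
    using rs unfolding vol_factor_def by auto
qed

lemma vol_factor_cong:
  assumes "vol_factor d \<phi> r" "\<And>x. x \<in> space (lborel_Rd d) \<Longrightarrow> \<phi> x = \<psi> x"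
  shows "vol_factor d \<psi> r"
proof -
  have "{x \<in> space (lborel_Rd d). \<phi> x \<in> B} = {x \<in> space (lborel_Rd d). \<psi> x \<in> B}" for B
    using assms(2) by auto
  then show ?thesis
    using assms(1) measurable_cong[of "lborel_Rd d" \<phi> \<psi>] assms(2) unfolding vol_factor_def by auto
qed

abbreviation Rd_cube :: "nat \<Rightarrow> (nat \<Rightarrow> real) set" where
  "Rd_cube d \<equiv> PiE {..<d} (\<lambda>_. {-1..1})"

lemma emeasure_Rd_box:
  assumes "\<And>i. i < d \<Longrightarrow> A i \<in> sets borel"
  shows "emeasure (lborel_Rd d) (PiE {..<d} A) = (\<Prod>i<d. emeasure lborel (A i))"
proof -
  interpret product_sigma_finite "\<lambda>_::nat. lborel :: real measure" ..
  show ?thesis using assms by (subst emeasure_PiM) auto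
qed

lemma Rd_box_sets: "(\<And>i. i < d \<Longrightarrow> A i \<in> sets borel) \<Longrightarrow> PiE {..<d} A \<in> sets (lborel_Rd d)"
  by (intro sets_PiM_I_finite) auto

lemma Rd_translation:
  "distr (lborel_Rd d) (lborel_Rd d) (\<lambda>x. \<lambda>i\<in>{..<d}. x i + c i) = lborel_Rd d"
proof -
  interpret product_sigma_finite "\<lambda>_::nat. lborel :: real measure" ..
  have m: "(\<lambda>x. \<lambda>i\<in>{..<d}. x i + c i) \<in> measurable (lborel_Rd d) (lborel_Rd d)"
    by (intro Rd_measurableI borel_measurable_add coord_measurable) auto
  show ?thesis
  proof (rule PiM_eqI)
    fix A :: "nat \<Rightarrow> real set" assume A: "\<And>i. i \<in> {..<d} \<Longrightarrow> A i \<in> sets lborel"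
    have A': "{y. y + c i \<in> A i} \<in> sets borel" "emeasure lborel {y. y + c i \<in> A i} = emeasure lborel (A i)" if "i < d" for i
    proof -
      have [measurable]: "A i \<in> sets borel" using A that by simp
      show "{y. y + c i \<in> A i} \<in> sets borel" by measurable
      have "emeasure lborel (A i) = emeasure (distr lborel borel ((+) (c i))) (A i)"
        by (simp add: lborel_distr_plus)
      also have "\<dots> = emeasure lborel {y. y + c i \<in> A i}"
        by (subst emeasure_distr) (auto simp: vimage_def add.commute)
      finally show "emeasure lborel {y. y + c i \<in> A i} = emeasure lborel (A i)" by simp
    qed
    have A: "A i \<in> sets borel" if "i < d" for i using A[of i] that by simp
    have pre: "(\<lambda>x. \<lambda>i\<in>{..<d}. x i + c i) -` (PiE {..<d} A) \<inter> space (lborel_Rd d) = PiE {..<d} (\<lambda>i. {y. y + c i \<in> A i})"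
      unfolding space_Rd
      by (intro set_eqI, simp only: PiE_iff vimage_eq Int_iff mem_Collect_eq UNIV_I simp_thms ball_simps)
        (simp add: restrict_extensional)
    have "emeasure (distr (lborel_Rd d) (lborel_Rd d) (\<lambda>x. \<lambda>i\<in>{..<d}. x i + c i)) (PiE {..<d} A)
      = emeasure (lborel_Rd d) (PiE {..<d} (\<lambda>i. {y. y + c i \<in> A i}))"
      unfolding pre[symmetric] by (rule emeasure_distr[OF m Rd_box_sets[OF A]])
    then show "emeasure (distr (lborel_Rd d) (lborel_Rd d) (\<lambda>x. \<lambda>i\<in>{..<d}. x i + c i)) (PiE {..<d} A) = (\<Prod>i\<in>{..<d}. emeasure lborel (A i))"
      using A' by (simp add: emeasure_Rd_box)
  qed auto
qed

lemma vol_factor_translation: "vol_factor d (\<lambda>x. \<lambda>i\<in>{..<d}. x i + c i) 1"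
proof -
  have m: "(\<lambda>x. \<lambda>i\<in>{..<d}. x i + c i) \<in> measurable (lborel_Rd d) (lborel_Rd d)"
    by (intro Rd_measurableI borel_measurable_add coord_measurable) auto
  have "emeasure (lborel_Rd d) {x \<in> space (lborel_Rd d). (\<lambda>i\<in>{..<d}. x i + c i) \<in> B} = emeasure (lborel_Rd d) B"
    if "B \<in> sets (lborel_Rd d)" for B
  proof -
    have "(\<lambda>x. \<lambda>i\<in>{..<d}. x i + c i) -` B \<inter> space (lborel_Rd d) = {x \<in> space (lborel_Rd d). (\<lambda>i\<in>{..<d}. x i + c i) \<in> B}"
      by auto
    then show ?thesis
      using emeasure_distr[OF m that] unfolding Rd_translation by simp
  qed
  then show ?thesis using m by (auto simp: vol_factor_def)
qed

text \<open>The argument that proves uniqueness of Haar measure: compute the integral of \<open>1\<^sub>A(x) 1\<^sub>B(x + \<phi> y)\<close>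
  over \<open>x\<close> and \<open>y\<close> in both orders, using invariance under translations. The symmetry of \<open>A\<close> turns
  \<open>x - \<phi> y \<in> A\<close> into \<open>\<phi> y - x \<in> A\<close>.\<close>

lemma Rd_additive_preimage:
  assumes m [measurable]: "\<phi> \<in> measurable (lborel_Rd d) (lborel_Rd d)"
    and add: "\<And>x y. x \<in> space (lborel_Rd d) \<Longrightarrow> y \<in> space (lborel_Rd d) \<Longrightarrow> \<phi> (\<lambda>i\<in>{..<d}. x i + y i) = (\<lambda>i\<in>{..<d}. \<phi> x i + \<phi> y i)"
    and surj: "\<And>x. x \<in> space (lborel_Rd d) \<Longrightarrow> \<exists>y\<in>space (lborel_Rd d). \<phi> y = x"
    and A [measurable]: "A \<in> sets (lborel_Rd d)" and B [measurable]: "B \<in> sets (lborel_Rd d)"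
    and sym: "\<And>x. x \<in> A \<Longrightarrow> (\<lambda>i\<in>{..<d}. - x i) \<in> A"
  shows "emeasure (lborel_Rd d) A * emeasure (lborel_Rd d) {x \<in> space (lborel_Rd d). \<phi> x \<in> B}
       = emeasure (lborel_Rd d) B * emeasure (lborel_Rd d) {x \<in> space (lborel_Rd d). \<phi> x \<in> A}"
proof -
  let ?M = "lborel_Rd d"
  interpret product_sigma_finite "\<lambda>_::nat. lborel :: real measure" ..
  interpret M: sigma_finite_measure ?M by (rule sigma_finite) auto
  interpret P: pair_sigma_finite ?M ?M ..
  have sp: "\<phi> x \<in> space ?M" if "x \<in> space ?M" for x using measurable_space[OF m that] .
  have [measurable]: "(\<lambda>p. \<lambda>i\<in>{..<d}. fst p i + \<phi> (snd p) i) \<in> measurable (?M \<Otimes>\<^sub>M ?M) ?M"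
    "(\<lambda>p. \<lambda>i\<in>{..<d}. fst p i - \<phi> (snd p) i) \<in> measurable (?M \<Otimes>\<^sub>M ?M) ?M"
    by (intro Rd_measurableI borel_measurable_add borel_measurable_diff
        measurable_compose[OF measurable_fst coord_measurable]
        measurable_compose[OF measurable_compose[OF measurable_snd m] coord_measurable]; simp)+
  have tr: "emeasure ?M {x \<in> space ?M. (\<lambda>i\<in>{..<d}. x i + c i) \<in> S} = emeasure ?M S" if "S \<in> sets ?M" for S c
    using vol_factor_translation[of d c] that by (simp add: vol_factor_def)
  have B1: "emeasure ?M {y \<in> space ?M. (\<lambda>i\<in>{..<d}. x i + \<phi> y i) \<in> B} = emeasure ?M {y \<in> space ?M. \<phi> y \<in> B}"
    if x: "x \<in> space ?M" for x
  proof -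
    obtain z where z: "z \<in> space ?M" "\<phi> z = x" using surj[OF x] by auto
    have eq: "{y \<in> space ?M. (\<lambda>i\<in>{..<d}. x i + \<phi> y i) \<in> B}
        = {y \<in> space ?M. (\<lambda>i\<in>{..<d}. y i + z i) \<in> {y \<in> space ?M. \<phi> y \<in> B}}"
      using add[OF _ z(1)] z(2) by (auto simp: add.commute)
    have "{y \<in> space ?M. \<phi> y \<in> B} \<in> sets ?M" by measurable
    from tr[OF this, of z] show ?thesis unfolding eq .
  qed
  have A1: "emeasure ?M {y \<in> space ?M. (\<lambda>i\<in>{..<d}. x i - \<phi> y i) \<in> A} = emeasure ?M {y \<in> space ?M. \<phi> y \<in> A}"
    if x: "x \<in> space ?M" for x
  proof -
    obtain z where z: "z \<in> space ?M" "\<phi> z = (\<lambda>i\<in>{..<d}. - x i)" using surj[of "\<lambda>i\<in>{..<d}. - x i"] by auto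
    have neg: "(\<lambda>i\<in>{..<d}. u i - v i) \<in> A \<Longrightarrow> (\<lambda>i\<in>{..<d}. v i - u i) \<in> A" for u v
    proof -
      assume "(\<lambda>i\<in>{..<d}. u i - v i) \<in> A"
      then have "(\<lambda>i\<in>{..<d}. - (\<lambda>i\<in>{..<d}. u i - v i) i) \<in> A" by (rule sym)
      then show ?thesis by (simp cong: restrict_cong)
    qed
    have "\<phi> (\<lambda>i\<in>{..<d}. y i + z i) = (\<lambda>i\<in>{..<d}. \<phi> y i - x i)" if "y \<in> space ?M" for y
      using add[OF that z(1)] z(2) by (simp cong: restrict_cong)
    then have eq: "{y \<in> space ?M. (\<lambda>i\<in>{..<d}. x i - \<phi> y i) \<in> A}
        = {y \<in> space ?M. (\<lambda>i\<in>{..<d}. y i + z i) \<in> {y \<in> space ?M. \<phi> y \<in> A}}"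
      using neg by auto
    have "{y \<in> space ?M. \<phi> y \<in> A} \<in> sets ?M" by measurable
    from tr[OF this, of z] show ?thesis unfolding eq .
  qed
  have shift: "(\<integral>\<^sup>+x. indicator A x * indicator B (\<lambda>i\<in>{..<d}. x i + \<phi> y i) \<partial>?M)
      = (\<integral>\<^sup>+x. indicator A (\<lambda>i\<in>{..<d}. x i - \<phi> y i) * indicator B x \<partial>?M)" if y: "y \<in> space ?M" for y
  proof -
    let ?T = "\<lambda>x. \<lambda>i\<in>{..<d}. x i + \<phi> y i"
    have T: "?T \<in> measurable ?M ?M"
      by (intro Rd_measurableI borel_measurable_add coord_measurable) auto
    have [measurable]: "(\<lambda>x. \<lambda>i\<in>{..<d}. x i - \<phi> y i) \<in> measurable ?M ?M"
      by (intro Rd_measurableI borel_measurable_diff coord_measurable) auto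
    have "(\<integral>\<^sup>+x. indicator A (\<lambda>i\<in>{..<d}. x i - \<phi> y i) * indicator B x \<partial>?M)
        = (\<integral>\<^sup>+x. indicator A (\<lambda>i\<in>{..<d}. x i - \<phi> y i) * indicator B x \<partial>distr ?M ?M ?T)"
      by (simp add: Rd_translation)
    also have "\<dots> = (\<integral>\<^sup>+x. indicator A (\<lambda>i\<in>{..<d}. ?T x i - \<phi> y i) * indicator B (?T x) \<partial>?M)"
      by (rule nn_integral_distr[OF T]) measurable
    also have "\<dots> = (\<integral>\<^sup>+x. indicator A x * indicator B (?T x) \<partial>?M)"
    proof (intro nn_integral_cong)
      fix x assume x: "x \<in> space ?M"
      have "(\<lambda>i\<in>{..<d}. ?T x i - \<phi> y i) = x"
        by (rule Rd_eqI[OF _ x]) auto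
      then show "indicator A (\<lambda>i\<in>{..<d}. ?T x i - \<phi> y i) * indicator B (?T x) = (indicator A x * indicator B (?T x) :: ennreal)" by simp
    qed
    finally show ?thesis by simp
  qed
  have "emeasure ?M A * emeasure ?M {x \<in> space ?M. \<phi> x \<in> B} = (\<integral>\<^sup>+x. indicator A x * emeasure ?M {x \<in> space ?M. \<phi> x \<in> B} \<partial>?M)"
    by (simp add: nn_integral_multc)
  also have "\<dots> = (\<integral>\<^sup>+x. \<integral>\<^sup>+y. indicator A x * indicator B (\<lambda>i\<in>{..<d}. x i + \<phi> y i) \<partial>?M \<partial>?M)"
  proof (intro nn_integral_cong)
    fix x assume x: "x \<in> space ?M"
    have [measurable]: "(\<lambda>y. \<lambda>i\<in>{..<d}. x i + \<phi> y i) \<in> measurable ?M ?M"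
      by (intro Rd_measurableI borel_measurable_add measurable_compose[OF m coord_measurable]) auto
    have "(\<integral>\<^sup>+y. indicator B (\<lambda>i\<in>{..<d}. x i + \<phi> y i) \<partial>?M) = (\<integral>\<^sup>+y. indicator {y \<in> space ?M. (\<lambda>i\<in>{..<d}. x i + \<phi> y i) \<in> B} y \<partial>?M)"
      by (intro nn_integral_cong) (auto simp: indicator_def)
    also have "\<dots> = emeasure ?M {y \<in> space ?M. (\<lambda>i\<in>{..<d}. x i + \<phi> y i) \<in> B}"
      by (rule nn_integral_indicator) measurable
    finally show "indicator A x * emeasure ?M {x \<in> space ?M. \<phi> x \<in> B} = (\<integral>\<^sup>+y. indicator A x * indicator B (\<lambda>i\<in>{..<d}. x i + \<phi> y i) \<partial>?M)"
      by (simp add: nn_integral_cmult B1[OF x])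
  qed
  also have "\<dots> = (\<integral>\<^sup>+y. \<integral>\<^sup>+x. indicator A x * indicator B (\<lambda>i\<in>{..<d}. x i + \<phi> y i) \<partial>?M \<partial>?M)"
  proof (rule P.Fubini'[symmetric])
    have "(\<lambda>p. indicator A (fst p) * indicator B (\<lambda>i\<in>{..<d}. fst p i + \<phi> (snd p) i) :: ennreal) \<in> borel_measurable (?M \<Otimes>\<^sub>M ?M)"
      by measurable
    then show "(\<lambda>(x, y). indicator A x * indicator B (\<lambda>i\<in>{..<d}. x i + \<phi> y i) :: ennreal) \<in> borel_measurable (?M \<Otimes>\<^sub>M ?M)"
      by (simp add: case_prod_beta)
  qed
  also have "\<dots> = (\<integral>\<^sup>+y. \<integral>\<^sup>+x. indicator A (\<lambda>i\<in>{..<d}. x i - \<phi> y i) * indicator B x \<partial>?M \<partial>?M)"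
    by (intro nn_integral_cong shift)
  also have "\<dots> = (\<integral>\<^sup>+x. \<integral>\<^sup>+y. indicator A (\<lambda>i\<in>{..<d}. x i - \<phi> y i) * indicator B x \<partial>?M \<partial>?M)"
  proof (rule P.Fubini')
    have "(\<lambda>p. indicator A (\<lambda>i\<in>{..<d}. fst p i - \<phi> (snd p) i) * indicator B (fst p) :: ennreal) \<in> borel_measurable (?M \<Otimes>\<^sub>M ?M)"
      by measurable
    then show "(\<lambda>(x, y). indicator A (\<lambda>i\<in>{..<d}. x i - \<phi> y i) * indicator B x :: ennreal) \<in> borel_measurable (?M \<Otimes>\<^sub>M ?M)"
      by (simp add: case_prod_beta)
  qed
  also have "\<dots> = (\<integral>\<^sup>+x. indicator B x * emeasure ?M {y \<in> space ?M. \<phi> y \<in> A} \<partial>?M)"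
  proof (intro nn_integral_cong)
    fix x assume x: "x \<in> space ?M"
    have [measurable]: "(\<lambda>y. \<lambda>i\<in>{..<d}. x i - \<phi> y i) \<in> measurable ?M ?M"
      by (intro Rd_measurableI borel_measurable_diff measurable_compose[OF m coord_measurable]) auto
    have "(\<integral>\<^sup>+y. indicator A (\<lambda>i\<in>{..<d}. x i - \<phi> y i) \<partial>?M) = (\<integral>\<^sup>+y. indicator {y \<in> space ?M. (\<lambda>i\<in>{..<d}. x i - \<phi> y i) \<in> A} y \<partial>?M)"
      by (intro nn_integral_cong) (auto simp: indicator_def)
    also have "\<dots> = emeasure ?M {y \<in> space ?M. (\<lambda>i\<in>{..<d}. x i - \<phi> y i) \<in> A}"
      by (rule nn_integral_indicator) measurable
    finally show "(\<integral>\<^sup>+y. indicator A (\<lambda>i\<in>{..<d}. x i - \<phi> y i) * indicator B x \<partial>?M) = indicator B x * emeasure ?M {y \<in> space ?M. \<phi> y \<in> A}"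
      by (simp add: nn_integral_cmult A1[OF x] mult.commute)
  qed
  also have "\<dots> = emeasure ?M B * emeasure ?M {x \<in> space ?M. \<phi> x \<in> A}"
    by (simp add: nn_integral_multc)
  finally show ?thesis .
qed

text \<open>Take the symmetric set in the preceding lemma to be the cube. Its preimage has positive finite volume,
  as one sees by applying the identity to the preimage of the cube under \<open>\<psi>\<close>.\<close>

lemma vol_factor_linear_bij:
  assumes m [measurable]: "\<phi> \<in> measurable (lborel_Rd d) (lborel_Rd d)" "\<psi> \<in> measurable (lborel_Rd d) (lborel_Rd d)"
    and add: "\<And>x y. x \<in> space (lborel_Rd d) \<Longrightarrow> y \<in> space (lborel_Rd d) \<Longrightarrow> \<phi> (\<lambda>i\<in>{..<d}. x i + y i) = (\<lambda>i\<in>{..<d}. \<phi> x i + \<phi> y i)"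
    and inv: "\<And>x. x \<in> space (lborel_Rd d) \<Longrightarrow> \<phi> (\<psi> x) = x" "\<And>x. x \<in> space (lborel_Rd d) \<Longrightarrow> \<psi> (\<phi> x) = x"
  shows "\<exists>r>0. vol_factor d \<phi> r \<and> emeasure (lborel_Rd d) {x \<in> space (lborel_Rd d). \<phi> x \<in> Rd_cube d} = ennreal (r * 2 ^ d)"
proof -
  let ?M = "lborel_Rd d" and ?Q = "Rd_cube d"
  have sp: "\<phi> x \<in> space ?M" "\<psi> x \<in> space ?M" if "x \<in> space ?M" for x
    using measurable_space[OF m(1) that] measurable_space[OF m(2) that] by auto
  have Q [measurable]: "?Q \<in> sets ?M" by (intro Rd_box_sets) auto
  have eQ: "emeasure ?M ?Q = ennreal (2 ^ d)"
    by (subst emeasure_Rd_box) (auto simp: ennreal_power[symmetric])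
  have main: "emeasure ?M ?Q * emeasure ?M {x \<in> space ?M. \<phi> x \<in> B} = emeasure ?M B * emeasure ?M {x \<in> space ?M. \<phi> x \<in> ?Q}"
    if "B \<in> sets ?M" for B
  proof (rule Rd_additive_preimage[OF m(1) add _ Q that])
    show "\<exists>y\<in>space ?M. \<phi> y = x" if "x \<in> space ?M" for x
      using inv(1)[OF that] sp(2)[OF that] by blast
    show "(\<lambda>i\<in>{..<d}. - x i) \<in> ?Q" if "x \<in> ?Q" for x
      using that by (auto simp: PiE_iff)
  qed
  let ?e = "emeasure ?M {x \<in> space ?M. \<phi> x \<in> ?Q}"
  have "{x \<in> space ?M. \<phi> x \<in> {y \<in> space ?M. \<psi> y \<in> ?Q}} = ?Q"
  proof (intro set_eqI iffI)
    fix x assume "x \<in> ?Q"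
    moreover then have "x \<in> space ?M" using sets.sets_into_space[OF Q] by blast
    ultimately show "x \<in> {x \<in> space ?M. \<phi> x \<in> {y \<in> space ?M. \<psi> y \<in> ?Q}}"
      using sp(1)[of x] inv(2)[of x] by simp
  next
    fix x assume "x \<in> {x \<in> space ?M. \<phi> x \<in> {y \<in> space ?M. \<psi> y \<in> ?Q}}"
    then show "x \<in> ?Q" using inv(2)[of x] by simp
  qed
  then have *: "emeasure ?M ?Q * emeasure ?M ?Q = emeasure ?M {y \<in> space ?M. \<psi> y \<in> ?Q} * ?e"
    using main[of "{y \<in> space ?M. \<psi> y \<in> ?Q}"] by simp
  have e0: "?e \<noteq> 0" "?e \<noteq> top"
  proof -
    have "emeasure ?M ?Q * emeasure ?M ?Q = ennreal (2 ^ d * 2 ^ d)"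
      unfolding eQ by (simp add: ennreal_mult)
    then have "emeasure ?M {y \<in> space ?M. \<psi> y \<in> ?Q} * ?e = ennreal (2 ^ d * 2 ^ d)"
      using * by simp
    moreover have "(0::real) < 2 ^ d * 2 ^ d" by simp
    then have "ennreal (2 ^ d * 2 ^ d) \<noteq> 0" by (metis ennreal_eq_0_iff not_le)
    moreover have "ennreal (2 ^ d * 2 ^ d) \<noteq> top" by (rule ennreal_neq_top)
    moreover have "b \<noteq> 0 \<and> b \<noteq> top" if "a * b = c" "c \<noteq> 0" "c \<noteq> top" for a b c :: ennreal
      using that by (auto simp: ennreal_mult_eq_top_iff)
    ultimately show "?e \<noteq> 0" "?e \<noteq> top"
      by blast+
  qed
  obtain s where s: "?e = ennreal s" "s > 0"
    using e0 by (cases ?e) (auto simp: less_le)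
  define r where "r = s / 2 ^ d"
  have r: "r > 0" "s = r * 2 ^ d" using s by (auto simp: r_def)
  have "emeasure ?M {x \<in> space ?M. \<phi> x \<in> B} = ennreal r * emeasure ?M B" if "B \<in> sets ?M" for B
  proof -
    have "ennreal (2 ^ d) * emeasure ?M {x \<in> space ?M. \<phi> x \<in> B} = ennreal (2 ^ d) * (ennreal r * emeasure ?M B)"
      using main[OF that] r unfolding eQ s by (simp add: ennreal_mult mult_ac)
    then show ?thesis
      by (subst (asm) ennreal_mult_cancel_left) auto
  qed
  then show ?thesis using r s m by (auto simp: vol_factor_def)
qed

section \<open>Volume factors of reflections, stretchings and partial scalings\<close>

lemma vol_factor_unique:
  assumes "vol_factor d \<phi> r" "vol_factor d \<phi> s"
  shows "r = s"
proof -
  have eQ: "emeasure (lborel_Rd d) (Rd_cube d) = ennreal (2 ^ d)"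
    by (subst emeasure_Rd_box) (auto simp: ennreal_power[symmetric])
  have Q: "Rd_cube d \<in> sets (lborel_Rd d)" by (intro Rd_box_sets) auto
  have "ennreal r * emeasure (lborel_Rd d) (Rd_cube d) = emeasure (lborel_Rd d) {x \<in> space (lborel_Rd d). \<phi> x \<in> Rd_cube d}"
    using assms(1) Q unfolding vol_factor_def by simp
  also have "\<dots> = ennreal s * emeasure (lborel_Rd d) (Rd_cube d)"
    using assms(2) Q unfolding vol_factor_def by simp
  finally have "ennreal r * emeasure (lborel_Rd d) (Rd_cube d) = ennreal s * emeasure (lborel_Rd d) (Rd_cube d)" .
  then have "ennreal (r * 2 ^ d) = ennreal (s * 2 ^ d)"
    using assms unfolding eQ by (simp add: ennreal_mult vol_factor_def)
  then show ?thesis using assms by (simp add: vol_factor_def)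
qed

lemma vol_factor_id: "vol_factor d (\<lambda>x. x) 1"
  by (rule vol_factor_cong[OF vol_factor_translation[of d "\<lambda>_. 0"]]) (rule Rd_eqI, auto)

lemma vol_factor_diag:
  assumes a: "\<And>i. i < d \<Longrightarrow> a i > 0"
  shows "vol_factor d (\<lambda>x. \<lambda>i\<in>{..<d}. a i * x i) (\<Prod>i<d. 1 / a i)"
proof -
  let ?D = "\<lambda>x. \<lambda>i\<in>{..<d}. a i * x i"
  have m: "(\<lambda>x. \<lambda>i\<in>{..<d}. b i * x i) \<in> measurable (lborel_Rd d) (lborel_Rd d)" for b :: "nat \<Rightarrow> real"
    by (intro Rd_measurableI borel_measurable_times coord_measurable) auto
  have inv: "(\<lambda>i\<in>{..<d}. a i * (\<lambda>i\<in>{..<d}. inverse (a i) * x i) i) = x"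
    "(\<lambda>i\<in>{..<d}. inverse (a i) * (\<lambda>i\<in>{..<d}. a i * x i) i) = x"
    if "x \<in> space (lborel_Rd d)" for x
    by (rule Rd_eqI[OF _ that]; use a in \<open>force simp: field_simps\<close>)+
  have add: "?D (\<lambda>i\<in>{..<d}. x i + y i) = (\<lambda>i\<in>{..<d}. ?D x i + ?D y i)" for x y
    by (rule restrict_ext) (simp add: distrib_left)
  obtain r where r: "r > 0" "vol_factor d ?D r"
    "emeasure (lborel_Rd d) {x \<in> space (lborel_Rd d). ?D x \<in> Rd_cube d} = ennreal (r * 2 ^ d)"
    using vol_factor_linear_bij[OF m[of a] m[of "\<lambda>i. inverse (a i)"] add inv] by blast
  have pre: "{x \<in> space (lborel_Rd d). ?D x \<in> Rd_cube d} = PiE {..<d} (\<lambda>i. {- (1 / a i)..1 / a i})"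
  proof -
    have "a i * y \<in> {-1..1} \<longleftrightarrow> y \<in> {- (1 / a i)..1 / a i}" if "i < d" for i y
      using a[OF that] by (auto simp: field_simps)
    then show ?thesis
      unfolding space_Rd
      by (intro set_eqI, simp only: PiE_iff mem_Collect_eq UNIV_I simp_thms ball_simps)
        (simp add: restrict_extensional conj_commute del: atLeastAtMost_iff)
  qed
  have "emeasure (lborel_Rd d) {x \<in> space (lborel_Rd d). ?D x \<in> Rd_cube d} = (\<Prod>i<d. ennreal (2 * (1 / a i)))"
    unfolding pre using a by (subst emeasure_Rd_box) (auto intro!: prod.cong simp: emeasure_lborel_Icc_eq less_imp_le)
  also have "\<dots> = ennreal (\<Prod>i<d. 2 * (1 / a i))"
    using a by (intro prod_ennreal) (auto simp: less_imp_le)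
  also have "(\<Prod>i<d. 2 * (1 / a i)) = (\<Prod>i<d. 1 / a i) * 2 ^ d"
    by (subst prod.distrib) simp
  finally have "ennreal (r * 2 ^ d) = ennreal ((\<Prod>i<d. 1 / a i) * 2 ^ d)"
    unfolding r(3) .
  moreover have "(\<Prod>i<d. 1 / a i) > 0" using a by (intro prod_pos) auto
  ultimately have "r = (\<Prod>i<d. 1 / a i)" using r(1) by simp
  with r(2) show ?thesis by simp
qed

definition reflection :: "nat \<Rightarrow> (nat \<Rightarrow> real) \<Rightarrow> (nat \<Rightarrow> real) \<Rightarrow> (nat \<Rightarrow> real)" where
  "reflection d n x = (\<lambda>i\<in>{..<d}. x i - 2 * ip d x n / ip d n n * n i)"

lemma reflection_apply: "i < d \<Longrightarrow> reflection d n x i = x i - 2 * ip d x n / ip d n n * n i"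
  by (simp add: reflection_def)

lemma reflection_involution:
  assumes "x \<in> space (lborel_Rd d)"
  shows "reflection d n (reflection d n x) = x"
proof (rule Rd_eqI[OF _ assms])
  fix i assume i: "i < d"
  have "ip d (\<lambda>i\<in>{..<d}. x i - c * n i) n = ip d x n - c * ip d n n" for c
    by (simp add: ip_linear)
  from this[of "2 * ip d x n / ip d n n"]
  have "ip d (reflection d n x) n = (if ip d n n = 0 then ip d x n else - ip d x n)"
    by (simp add: reflection_def)
  then show "reflection d n (reflection d n x) i = x i" using i by (simp add: reflection_apply)
qed (simp add: reflection_def)

text \<open>A reflection is an involution, so its factor squares to 1.\<close>

lemma vol_factor_reflection: "vol_factor d (reflection d n) 1"
proof -
  have m: "reflection d n \<in> measurable (lborel_Rd d) (lborel_Rd d)"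
    unfolding reflection_def
    by (intro Rd_measurableI borel_measurable_times borel_measurable_diff borel_measurable_divide
        coord_measurable ip_measurable) auto
  have add: "reflection d n (\<lambda>i\<in>{..<d}. x i + y i) = (\<lambda>i\<in>{..<d}. reflection d n x i + reflection d n y i)" for x y
    unfolding reflection_def
    by (rule restrict_ext) (simp add: ip_add_left add_divide_distrib distrib_left distrib_right)
  obtain r where r: "r > 0" "vol_factor d (reflection d n) r"
    using vol_factor_linear_bij[OF m m add reflection_involution reflection_involution] by blast
  have "vol_factor d (\<lambda>x. x) (r * r)"
    by (rule vol_factor_cong[OF vol_factor_compose[OF r(2) r(2)] reflection_involution])
  from vol_factor_unique[OF this vol_factor_id] have "r = 1"
    using r(1) by (simp add: square_eq_1_iff)
  with r(2) show ?thesis by simp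
qed

text \<open>Stretching in the direction of a unit vector \<open>w\<close> is conjugate, by the reflection that exchanges \<open>w\<close> with the
  first basis vector, to stretching the first coordinate.\<close>

lemma vol_factor_stretch:
  assumes w: "ip d w w = 1" and t: "t > 0"
  shows "vol_factor d (\<lambda>x. \<lambda>i\<in>{..<d}. x i + (t - 1) * ip d x w * w i) (1 / t)"
proof -
  have d: "0 < d" 
  proof (rule ccontr)
    assume "\<not> 0 < d"
    then have "d = 0" by simp
    then have "ip d w w = 0" unfolding ip_def by (simp only: lessThan_0 sum.empty)
    with w show False by simp
  qed
  define e where "e = (\<lambda>i::nat. if i = 0 then 1 else 0 :: real)"
  \<comment> \<open>The reflection in the hyperplane orthogonal to \<open>w - e\<close> exchanges \<open>w\<close> and \<open>e\<close>; for \<open>w = e\<close> division by zero makes it the identity.\<close>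
  define n where "n = (\<lambda>i. w i - e i)"
  let ?R = "reflection d n"
  let ?D = "\<lambda>x. \<lambda>i\<in>{..<d}. (if i = 0 then t else 1) * x i"
  have ipe: "ip d x e = x 0" for x
  proof -
    have "ip d x e = (\<Sum>i<d. if i = 0 then x i else 0)"
      unfolding ip_def e_def by (intro sum.cong) auto
    then show ?thesis using d by simp
  qed
  have ipn: "ip d x n = ip d x w - x 0" for x
    unfolding n_def by (simp add: ip_diff_right ipe)
  have nn: "ip d n n = 2 - 2 * w 0"
  proof -
    have "ip d n n = ip d n w - n 0" by (rule ipn)
    also have "ip d n w = ip d w n" by (rule ip_commute)
    also have "ip d w n = 1 - w 0" using ipn[of w] w by simp
    finally show ?thesis by (simp add: n_def e_def)
  qed
  have R0: "?R x 0 = ip d x w" for x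
  proof (cases "ip d n n = 0")
    case True
    then have "n i = 0" if "i < d" for i using ip_self_eq_0 that by blast
    then have "ip d x n = 0" by (simp add: ip_def)
    then show ?thesis using True ipn[of x] d by (simp add: reflection_apply)
  next
    case False
    have "2 * ip d x n / ip d n n * n 0 = - ip d x n"
      using False unfolding nn by (simp add: n_def e_def field_simps)
    then show ?thesis using d ipn[of x] by (simp add: reflection_apply)
  qed
  have Re: "e i - 2 * ip d e n / ip d n n * n i = w i" if "i < d" for i
  proof (cases "ip d n n = 0")
    case True
    then have "n i = 0" using ip_self_eq_0 that by blast
    then show ?thesis using True by (simp add: n_def)
  next
    case False
    have "e 0 = 1" by (simp add: e_def)
    then have "ip d e n = w 0 - 1" using ipn[of e] ipe[of w] ip_commute[of d e w] by linarith
    then have "2 * ip d e n / ip d n n = -1"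
      using False unfolding nn by (simp add: field_simps)
    then show ?thesis by (simp add: n_def)
  qed
  have "(\<Prod>i<d. 1 / (if i = 0 then t else 1)) = 1 / t"
    using d by (subst prod.remove[of _ 0]) auto
  then have D: "vol_factor d ?D (1 / t)"
    using vol_factor_diag[of d "\<lambda>i. if i = 0 then t else 1"] t by simp
  have "vol_factor d (\<lambda>x. ?R (?D (?R x))) (1 * ((1 / t) * 1))"
    by (intro vol_factor_compose[OF vol_factor_reflection] vol_factor_compose[OF D] vol_factor_reflection)
  then have "vol_factor d (\<lambda>x. ?R (?D (?R x))) (1 / t)" by simp
  then show ?thesis
  proof (rule vol_factor_cong)
    fix x assume x: "x \<in> space (lborel_Rd d)"
    define y where "y = ?R x"
    have Dy: "?D y i = y i + (t - 1) * ip d x w * e i" if "i < d" for i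
      using that R0[of x, folded y_def] by (auto simp: e_def algebra_simps)
    have ipD: "ip d (?D y) n = ip d y n + (t - 1) * ip d x w * ip d e n"
      using ip_cong[of d "?D y" "\<lambda>i. y i + (t - 1) * ip d x w * e i" n n] Dy by (simp add: ip_linear)
    show "?R (?D (?R x)) = (\<lambda>i\<in>{..<d}. x i + (t - 1) * ip d x w * w i)"
      unfolding y_def[symmetric] reflection_def[of d n "?D y"]
    proof (rule restrict_ext)
      fix i assume "i \<in> {..<d}"
      then have i: "i < d" by simp
      have "?D y i - 2 * ip d (?D y) n / ip d n n * n i
          = (y i - 2 * ip d y n / ip d n n * n i) + (t - 1) * ip d x w * (e i - 2 * ip d e n / ip d n n * n i)"
        unfolding ipD Dy[OF i] by (simp add: add_divide_distrib diff_divide_distrib algebra_simps)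
      also have "y i - 2 * ip d y n / ip d n n * n i = x i"
        using reflection_apply[OF i, of n y] reflection_involution[OF x, of n] by (simp add: y_def)
      finally show "?D y i - 2 * ip d (?D y) n / ip d n n * n i = x i + (t - 1) * ip d x w * w i"
        unfolding Re[OF i] .
    qed
  qed
qed

subsection \<open>Orthonormal systems\<close>

definition orthonormal :: "nat \<Rightarrow> nat \<Rightarrow> (nat \<Rightarrow> nat \<Rightarrow> real) \<Rightarrow> bool" where
  "orthonormal d n w \<longleftrightarrow> (\<forall>j<n. \<forall>k<n. ip d (w j) (w k) = (if j = k then 1 else 0))"

lemma orthonormal_sum:
  assumes "orthonormal d n w" "k < n"
  shows "(\<Sum>j<n. c j * ip d (w j) (w k)) = c k"
proof -
  have "(\<Sum>j<n. c j * ip d (w j) (w k)) = (\<Sum>j<n. if j = k then c j else 0)"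
    using assms by (intro sum.cong) (auto simp: orthonormal_def)
  then show ?thesis using assms by simp
qed

text \<open>The map scales by \<open>1 / t\<close> on the orthogonal complement of an \<open>n\<close>-dimensional space and fixes that space. It arises from the
  scaling by \<open>1 / t\<close> by stretching the \<open>n\<close> orthonormal directions back, one after another.\<close>

lemma vol_factor_orthonormal_scaling:
  assumes "orthonormal d n w" "t > 0"
  shows "vol_factor d (\<lambda>x. \<lambda>i\<in>{..<d}. x i / t + (1 - 1 / t) * (\<Sum>j<n. ip d x (w j) * w j i)) (t ^ d / t ^ n)"
  using assms(1)
proof (induction n)
  case 0
  have p: "(\<Prod>i<d. 1 / (1 / t)) = t ^ d / t ^ 0" by simp
  have "vol_factor d (\<lambda>x. \<lambda>i\<in>{..<d}. 1 / t * x i) (t ^ d / t ^ 0)"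
    by (rule vol_factor_diag[of d "\<lambda>_. 1 / t", unfolded p]) (use assms(2) in simp)
  then show ?case
    by (rule vol_factor_cong) (intro restrict_ext, simp)
next
  case (Suc n)
  have on: "orthonormal d n w" using Suc.prems by (auto simp: orthonormal_def)
  have wn: "ip d (w n) (w n) = 1" using Suc.prems by (auto simp: orthonormal_def)
  have orth: "ip d (w n) (w j) = 0" if "j < n" for j using Suc.prems that by (auto simp: orthonormal_def)
  have "vol_factor d (\<lambda>x. \<lambda>i\<in>{..<d}. (\<lambda>i\<in>{..<d}. x i + (t - 1) * ip d x (w n) * w n i) i / t
      + (1 - 1 / t) * (\<Sum>j<n. ip d (\<lambda>i\<in>{..<d}. x i + (t - 1) * ip d x (w n) * w n i) (w j) * w j i)) (t ^ d / t ^ n * (1 / t))"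
    by (rule vol_factor_compose[OF Suc.IH[OF on] vol_factor_stretch[OF wn assms(2)]])
  then have "vol_factor d (\<lambda>x. \<lambda>i\<in>{..<d}. x i / t + (1 - 1 / t) * (\<Sum>j<Suc n. ip d x (w j) * w j i)) (t ^ d / t ^ n * (1 / t))"
  proof (rule vol_factor_cong, intro restrict_ext)
    fix x i assume i: "i \<in> {..<d}"
    have "(\<Sum>j<n. ip d (\<lambda>i\<in>{..<d}. x i + (t - 1) * ip d x (w n) * w n i) (w j) * w j i) = (\<Sum>j<n. ip d x (w j) * w j i)"
      by (intro sum.cong) (auto simp: ip_linear orth)
    then show "(\<lambda>i\<in>{..<d}. x i + (t - 1) * ip d x (w n) * w n i) i / t
      + (1 - 1 / t) * (\<Sum>j<n. ip d (\<lambda>i\<in>{..<d}. x i + (t - 1) * ip d x (w n) * w n i) (w j) * w j i)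
      = x i / t + (1 - 1 / t) * (\<Sum>j<Suc n. ip d x (w j) * w j i)"
      using i assms(2) by (simp add: field_simps)
  qed
  moreover have "t ^ d / t ^ n * (1 / t) = t ^ d / t ^ Suc n" by simp
  ultimately show ?case by (simp only:)
qed

text \<open>Bessel's inequality for each standard basis vector, summed over the basis.\<close>

lemma orthonormal_card_le:
  assumes on: "orthonormal d n w"
  shows "n \<le> d"
proof -
  have bessel: "(\<Sum>j<n. (w j i)\<^sup>2) \<le> 1" if i: "i < d" for i
  proof -
    define e where "e = (\<lambda>k. if k = i then 1 else 0 :: real)"
    have ipe: "ip d e x = x i" for x
    proof -
      have "ip d e x = (\<Sum>k<d. if k = i then x k else 0)"
        unfolding ip_def e_def by (intro sum.cong) auto
      then show ?thesis using i by simp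
    qed
    define s where "s = (\<lambda>k. \<Sum>j<n. w j i * w j k)"
    have sw: "ip d s (w k) = w k i" if "k < n" for k
      unfolding s_def ip_sum_left ip_scale_left using orthonormal_sum[OF on that] by simp
    have ss: "ip d s s = (\<Sum>j<n. (w j i)\<^sup>2)"
    proof -
      have "ip d s s = (\<Sum>j<n. w j i * ip d s (w j))"
        by (subst (2) s_def) (simp add: ip_sum_right ip_scale_right)
      then show ?thesis by (simp add: sw power2_eq_square)
    qed
    have es: "ip d e s = (\<Sum>j<n. (w j i)\<^sup>2)" by (simp add: ipe s_def power2_eq_square)
    have "0 \<le> ip d (\<lambda>k. e k - s k) (\<lambda>k. e k - s k)" by (rule ip_self_nonneg)
    also have "\<dots> = 1 - (\<Sum>j<n. (w j i)\<^sup>2)"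
    proof -
      have "ip d e e = 1" unfolding ipe by (simp add: e_def)
      then show ?thesis by (simp add: ip_diff_left ip_diff_right ss es ip_commute[of d s e])
    qed
    finally show ?thesis by simp
  qed
  have "real n = (\<Sum>j<n. ip d (w j) (w j))" using on by (simp add: orthonormal_def)
  also have "\<dots> = (\<Sum>i<d. \<Sum>j<n. (w j i)\<^sup>2)"
    unfolding ip_def power2_eq_square by (rule sum.swap)
  also have "\<dots> \<le> (\<Sum>i<d. 1)" by (intro sum_mono bessel) simp
  finally show ?thesis by simp
qed

text \<open>The third clause says that the system lies in the span of \<open>S\<close>, in the form in which it is used: what is orthogonal to \<open>S\<close>
  is orthogonal to the system.\<close>

lemma gram_schmidt:
  assumes "finite S"
  shows "\<exists>n w. orthonormal d n w \<and> (\<forall>s\<in>S. \<forall>i<d. s i = (\<Sum>j<n. ip d s (w j) * w j i)) \<and>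
     (\<forall>y. (\<forall>s\<in>S. ip d y s = 0) \<longrightarrow> (\<forall>j<n. ip d y (w j) = 0))"
  using assms
proof induction
  case empty
  show ?case by (rule exI[of _ 0]) (simp add: orthonormal_def)
next
  case (insert v S)
  then obtain n w where on: "orthonormal d n w" and ex: "\<And>s i. s \<in> S \<Longrightarrow> i < d \<Longrightarrow> s i = (\<Sum>j<n. ip d s (w j) * w j i)"
    and pp: "\<And>y j. (\<forall>s\<in>S. ip d y s = 0) \<Longrightarrow> j < n \<Longrightarrow> ip d y (w j) = 0" by blast
  define u where "u = (\<lambda>i. v i - (\<Sum>j<n. ip d v (w j) * w j i))"
  have uw: "ip d u (w k) = 0" if "k < n" for k
    unfolding u_def ip_diff_left ip_sum_left ip_scale_left using orthonormal_sum[OF on that] by simp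
  have wu: "ip d (w k) u = 0" if "k < n" for k
    using uw[OF that] by (simp only: ip_commute)
  show ?case
  proof (cases "ip d u u = 0")
    case True
    then have "v i = (\<Sum>j<n. ip d v (w j) * w j i)" if "i < d" for i
      using ip_self_eq_0[OF True that] by (simp add: u_def)
    then show ?thesis using on ex pp by (intro exI[of _ n] exI[of _ w]) auto
  next
    case False
    then have pos: "ip d u u > 0" using ip_self_nonneg[of d u] by linarith
    define c where "c = 1 / sqrt (ip d u u)"
    have c2: "c * c * ip d u u = 1" using pos by (simp add: c_def)
    define w' where "w' = w(n := (\<lambda>i. c * u i))"
    have w': "w' j = w j" if "j < n" for j using that by (simp add: w'_def)
    have w'n: "w' n = (\<lambda>i. c * u i)" by (simp add: w'_def)
    have on': "orthonormal d (Suc n) w'"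
      unfolding orthonormal_def
    proof (intro allI impI)
      fix j k assume "j < Suc n" "k < Suc n"
      then consider "j < n" "k < n" | "j = n" "k < n" | "j < n" "k = n" | "j = n" "k = n" by linarith
      then show "ip d (w' j) (w' k) = (if j = k then 1 else 0)"
      proof cases
        case 1 then show ?thesis using on by (simp add: w' orthonormal_def)
      next
        case 2 then show ?thesis by (simp add: w' w'n ip_scale_left uw)
      next
        case 3 then show ?thesis by (simp add: w' w'n ip_scale_right wu)
      next
        case 4 then show ?thesis using c2 by (simp add: w'n ip_scale_left ip_scale_right mult.assoc)
      qed
    qed
    have us: "ip d s u = 0" if "s \<in> S" for s
    proof -
      have "ip d s u = ip d (\<lambda>i. \<Sum>j<n. ip d s (w j) * w j i) u"
        using ex[OF that] by (intro ip_cong) auto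
      also have "\<dots> = 0" by (simp add: ip_sum_left ip_scale_left wu)
      finally show ?thesis .
    qed
    have vu: "ip d v u = ip d u u"
    proof -
      have "ip d v u = ip d (\<lambda>i. u i + (\<Sum>j<n. ip d v (w j) * w j i)) u"
        by (rule ip_cong) (simp_all add: u_def)
      also have "\<dots> = ip d u u" by (simp add: ip_add_left ip_sum_left ip_scale_left wu)
      finally show ?thesis .
    qed
    have sum': "(\<Sum>j<Suc n. ip d s (w' j) * w' j i) = (\<Sum>j<n. ip d s (w j) * w j i) + c * c * ip d s u * u i" for s i
      by (simp add: w' w'n ip_scale_right)
    show ?thesis
    proof (intro exI conjI ballI allI impI)
      show "orthonormal d (Suc n) w'" by (rule on')
      fix s i assume s: "s \<in> insert v S" and i: "i < d"
      show "s i = (\<Sum>j<Suc n. ip d s (w' j) * w' j i)"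
      proof (cases "s = v")
        case True
        have "c * c * ip d v u * u i = u i" using c2 vu by simp
        moreover have "v i = (\<Sum>j<n. ip d v (w j) * w j i) + u i" by (simp add: u_def)
        ultimately show ?thesis unfolding sum' True by linarith
      next
        case False
        then show ?thesis unfolding sum' using s ex[of s i] i us[of s] by simp
      qed
    next
      fix y j assume y: "\<forall>s\<in>insert v S. ip d y s = 0" and j: "j < Suc n"
      then have yw: "ip d y (w k) = 0" if "k < n" for k using pp that by blast
      have "ip d y u = 0" using y by (simp add: u_def ip_diff_right ip_sum_right ip_scale_right yw)
      then show "ip d y (w' j) = 0"
        using yw j by (cases "j = n") (auto simp: w' w'n ip_scale_right)
    qed
  qed
qed

section \<open>Nearest points and polytopes\<close>

lemma topspace_top_Rd: "topspace (top_Rd d) = space (lborel_Rd d)"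
  by (simp add: space_Rd)

lemma continuous_map_dist_Rd: "continuous_map (top_Rd d) euclideanreal (\<lambda>y. dist_Rd d x y)"
proof -
  have "continuous_map (top_Rd d) euclideanreal (\<lambda>y. \<Sum>i<d. (x i - y i)\<^sup>2)"
    by (intro continuous_intros continuous_map_product_projection) auto
  then show ?thesis
    unfolding dist_Rd_def L2_set_def continuous_map_atin by (auto intro: tendsto_real_sqrt)
qed

lemma convex_combination_Rd:
  assumes "convex_Rd d K" "x \<in> K" "y \<in> K" "0 \<le> u" "u \<le> 1"
  shows "(\<lambda>i\<in>{..<d}. (1 - u) * x i + u * y i) \<in> K"
  using assms by (auto simp: convex_Rd_def)

lemma nearest_exists:
  assumes K: "compactin (top_Rd d) K" "K \<noteq> {}"
  shows "\<exists>p\<in>K. dist_Rd d x p = infdist_Rd d x K"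
proof -
  have "compact ((\<lambda>y. dist_Rd d x y) ` K)"
    using image_compactin[OF K(1) continuous_map_dist_Rd[of d x]] by (simp add: compactin_euclidean_iff)
  then obtain r where r: "r \<in> (\<lambda>y. dist_Rd d x y) ` K" "\<And>s. s \<in> (\<lambda>y. dist_Rd d x y) ` K \<Longrightarrow> r \<le> s"
    using compact_attains_inf[of "(\<lambda>y. dist_Rd d x y) ` K"] K(2) by auto
  then obtain p where p: "p \<in> K" "r = dist_Rd d x p" by auto
  have "dist_Rd d x p \<le> infdist_Rd d x K"
    using r(2) p K(2) by (intro infdist_Rd_greatest) auto
  with p infdist_Rd_le[OF p(1), of d x] show ?thesis by force
qed

lemma dist_sq_expand:
  "(dist_Rd d x y)\<^sup>2 = (dist_Rd d x p)\<^sup>2 - 2 * ip d (\<lambda>i. x i - p i) (\<lambda>i. y i - p i) + (dist_Rd d y p)\<^sup>2"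
proof -
  have "ip d (\<lambda>i. x i - y i) (\<lambda>i. x i - y i)
      = ip d (\<lambda>i. (x i - p i) - (y i - p i)) (\<lambda>i. (x i - p i) - (y i - p i))" by simp
  also have "\<dots> = ip d (\<lambda>i. x i - p i) (\<lambda>i. x i - p i) - 2 * ip d (\<lambda>i. x i - p i) (\<lambda>i. y i - p i)
      + ip d (\<lambda>i. y i - p i) (\<lambda>i. y i - p i)"
    unfolding ip_diff_left[of d "\<lambda>i. x i - p i" "\<lambda>i. y i - p i"] ip_diff_right[of d _ "\<lambda>i. x i - p i" "\<lambda>i. y i - p i"]
    using ip_commute[of d "\<lambda>i. x i - p i" "\<lambda>i. y i - p i"] by linarith
  finally show ?thesis by (simp add: dist_Rd_sq)
qed

text \<open>If the angle at \<open>p\<close> were acute, a short step from \<open>p\<close> towards \<open>y\<close> would stay in \<open>K\<close> and come closer to \<open>x\<close>.\<close>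

lemma nearest_variational:
  assumes K: "convex_Rd d K" and p: "p \<in> K" "dist_Rd d x p = infdist_Rd d x K" and y: "y \<in> K"
  shows "ip d (\<lambda>i. x i - p i) (\<lambda>i. y i - p i) \<le> 0"
proof (rule ccontr)
  let ?c = "ip d (\<lambda>i. x i - p i) (\<lambda>i. y i - p i)" and ?D = "(dist_Rd d y p)\<^sup>2"
  assume "\<not> ?c \<le> 0"
  then have c: "?c > 0" by simp
  have D: "?D \<noteq> 0"
  proof
    assume "?D = 0"
    then have "y i - p i = 0" if "i < d" for i using dist_Rd_eq_0D[of d y p i] that by simp
    then have "?c = 0" unfolding ip_def by simp
    with c show False by simp
  qed
  then have D: "?D > 0" by simp
  define u where "u = min 1 (?c / ?D)"
  have u: "0 < u" "u \<le> 1" "u * ?D \<le> ?c"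
    using c D by (auto simp: u_def min_def field_simps)
  define z where "z = (\<lambda>i\<in>{..<d}. (1 - u) * p i + u * y i)"
  have "z \<in> K" unfolding z_def using K p(1) y u by (intro convex_combination_Rd) auto
  then have "dist_Rd d x p \<le> dist_Rd d x z" using infdist_Rd_le p(2) by metis
  then have le: "(dist_Rd d x p)\<^sup>2 \<le> (dist_Rd d x z)\<^sup>2" by (intro power_mono) auto
  have zp: "z i - p i = u * (y i - p i)" if "i < d" for i using that by (simp add: z_def algebra_simps)
  have 1: "ip d (\<lambda>i. x i - p i) (\<lambda>i. z i - p i) = u * ?c"
    unfolding ip_scale_right[symmetric] by (intro ip_cong zp refl)
  have 2: "(dist_Rd d z p)\<^sup>2 = u * (u * ?D)"
  proof -
    have "ip d (\<lambda>i. z i - p i) (\<lambda>i. z i - p i) = ip d (\<lambda>i. u * (y i - p i)) (\<lambda>i. u * (y i - p i))"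
      by (intro ip_cong zp)
    then show ?thesis unfolding dist_Rd_sq ip_scale_left ip_scale_right .
  qed
  have "2 * (u * ?c) \<le> u * (u * ?D)"
    using le unfolding dist_sq_expand[of d x z p] 1 2 by linarith
  then have "2 * ?c \<le> u * ?D" using u by simp
  with u c show False by linarith
qed

text \<open>Conversely, if no angle at \<open>p\<close> towards a point of \<open>K\<close> is acute, then \<open>p\<close> is the only nearest point. This identifies the
  nearest point of any other point on the ray from \<open>p\<close> through \<open>x\<close>.\<close>

lemma nearest_characterization:
  assumes "p \<in> K" "\<And>y. y \<in> K \<Longrightarrow> ip d (\<lambda>i. x i - p i) (\<lambda>i. y i - p i) \<le> 0"
  shows "dist_Rd d x p = infdist_Rd d x K"
    and "q \<in> K \<Longrightarrow> dist_Rd d x q = infdist_Rd d x K \<Longrightarrow> i < d \<Longrightarrow> q i = p i"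
proof -
  have *: "(dist_Rd d x p)\<^sup>2 + (dist_Rd d y p)\<^sup>2 \<le> (dist_Rd d x y)\<^sup>2" if "y \<in> K" for y
    using assms(2)[OF that] dist_sq_expand[of d x y p] by linarith
  have "dist_Rd d x p \<le> dist_Rd d x y" if "y \<in> K" for y
  proof (rule power2_le_imp_le)
    show "(dist_Rd d x p)\<^sup>2 \<le> (dist_Rd d x y)\<^sup>2"
      using *[OF that] zero_le_power2[of "dist_Rd d y p"] by linarith
  qed simp
  then have "dist_Rd d x p \<le> infdist_Rd d x K"
    using assms(1) by (intro infdist_Rd_greatest) auto
  then show eq: "dist_Rd d x p = infdist_Rd d x K"
    using infdist_Rd_le[OF assms(1), of d x] by linarith
  assume q: "q \<in> K" "dist_Rd d x q = infdist_Rd d x K" "i < d"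
  have "(dist_Rd d q p)\<^sup>2 \<le> 0" using *[OF q(1)] unfolding q(2) eq by simp
  then have "dist_Rd d q p = 0" by simp
  then show "q i = p i" using q(3) by (rule dist_Rd_eq_0D)
qed

lemma ip_le_dist: "ip d (\<lambda>i. x i - y i) (\<lambda>i. p i - q i) \<le> dist_Rd d x y * dist_Rd d p q"
proof -
  have "(ip d (\<lambda>i. x i - y i) (\<lambda>i. p i - q i))\<^sup>2 \<le> (dist_Rd d x y)\<^sup>2 * (dist_Rd d p q)\<^sup>2"
    unfolding dist_Rd_def L2_set_def ip_def
    using Cauchy_Schwarz_ineq_sum[of "\<lambda>i. x i - y i" "\<lambda>i. p i - q i" "{..<d}"] by (simp add: sum_nonneg)
  then have "\<bar>ip d (\<lambda>i. x i - y i) (\<lambda>i. p i - q i)\<bar> \<le> \<bar>dist_Rd d x y * dist_Rd d p q\<bar>"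
    unfolding abs_le_square_iff power_mult_distrib .
  then show ?thesis using mult_nonneg_nonneg[OF dist_Rd_nonneg[of d x y] dist_Rd_nonneg[of d p q]] by linarith
qed

text \<open>The nearest-point map is a contraction; hence it is measurable.\<close>

lemma nearest_lipschitz:
  assumes x: "p \<in> K" "\<And>y. y \<in> K \<Longrightarrow> ip d (\<lambda>i. x i - p i) (\<lambda>i. y i - p i) \<le> 0"
    and x': "q \<in> K" "\<And>y. y \<in> K \<Longrightarrow> ip d (\<lambda>i. x' i - q i) (\<lambda>i. y i - q i) \<le> 0"
  shows "dist_Rd d p q \<le> dist_Rd d x x'"
proof (cases "dist_Rd d p q = 0")
  case False
  then have pos: "dist_Rd d p q > 0" using dist_Rd_nonneg[of d p q] by linarith
  have 1: "ip d (\<lambda>i. x i - p i) (\<lambda>i. q i - p i) \<le> 0" and 2: "ip d (\<lambda>i. x' i - q i) (\<lambda>i. p i - q i) \<le> 0"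
    using x(2)[OF x'(1)] x'(2)[OF x(1)] by auto
  have "ip d (\<lambda>i. x i - x' i) (\<lambda>i. p i - q i) - (dist_Rd d p q)\<^sup>2
      = - ip d (\<lambda>i. x i - p i) (\<lambda>i. q i - p i) - ip d (\<lambda>i. x' i - q i) (\<lambda>i. p i - q i)"
    unfolding dist_Rd_sq by (simp add: ip_def sum_subtractf[symmetric] sum_negf[symmetric] algebra_simps)
  then have "(dist_Rd d p q)\<^sup>2 \<le> dist_Rd d x x' * dist_Rd d p q"
    using 1 2 ip_le_dist[of d x x' p q] by linarith
  then show ?thesis using pos by (simp add: power2_eq_square)
qed simp

subsection \<open>Polytopes\<close>

definition hull_Rd :: "nat \<Rightarrow> (nat \<Rightarrow> real) set \<Rightarrow> (nat \<Rightarrow> real) set" where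
  "hull_Rd d A = {(\<lambda>i\<in>{..<d}. \<Sum>a\<in>A. l a * a i) | l. (\<forall>a\<in>A. 0 \<le> l a) \<and> sum l A = 1}"

lemma hull_Rd_subset_space: "hull_Rd d A \<subseteq> space (lborel_Rd d)"
  by (auto simp: hull_Rd_def)

lemma hull_Rd_superset:
  assumes "finite A" "A \<subseteq> space (lborel_Rd d)"
  shows "A \<subseteq> hull_Rd d A"
proof
  fix a assume a: "a \<in> A"
  have "a = (\<lambda>i\<in>{..<d}. \<Sum>b\<in>A. (if b = a then 1 else 0) * b i)"
  proof (rule Rd_eqI)
    fix i assume i: "i < d"
    have "(\<Sum>b\<in>A. (if b = a then 1 else 0) * b i) = (\<Sum>b\<in>A. if b = a then b i else 0)"
      by (intro sum.cong) auto
    then show "a i = (\<lambda>i\<in>{..<d}. \<Sum>b\<in>A. (if b = a then 1 else 0) * b i) i"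
      using i a assms(1) by simp
  qed (use a assms in auto)
  moreover have "(\<Sum>b\<in>A. (if b = a then 1 else 0 :: real)) = 1"
    using a assms(1) by simp
  ultimately show "a \<in> hull_Rd d A"
    unfolding hull_Rd_def by (intro CollectI exI[of _ "\<lambda>b. if b = a then 1 else 0"]) auto
qed

lemma convex_hull_Rd: "convex_Rd d (hull_Rd d A)"
  unfolding convex_Rd_def
proof (intro ballI allI impI)
  fix x y and u v :: real
  assume "x \<in> hull_Rd d A" "y \<in> hull_Rd d A" and uv: "0 \<le> u" "0 \<le> v" "u + v = 1"
  then obtain l m where l: "x = (\<lambda>i\<in>{..<d}. \<Sum>a\<in>A. l a * a i)" "\<forall>a\<in>A. 0 \<le> l a" "sum l A = 1"
    and m: "y = (\<lambda>i\<in>{..<d}. \<Sum>a\<in>A. m a * a i)" "\<forall>a\<in>A. 0 \<le> m a" "sum m A = 1"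
    unfolding hull_Rd_def by blast
  have "(\<lambda>i\<in>{..<d}. u * x i + v * y i) = (\<lambda>i\<in>{..<d}. \<Sum>a\<in>A. (u * l a + v * m a) * a i)"
    by (intro restrict_ext) (simp add: l(1) m(1) sum_distrib_left sum.distrib[symmetric] distrib_right mult.assoc)
  moreover have "(\<Sum>a\<in>A. u * l a + v * m a) = 1"
    using l m uv by (simp add: sum.distrib sum_distrib_left[symmetric])
  ultimately show "(\<lambda>i\<in>{..<d}. u * x i + v * y i) \<in> hull_Rd d A"
    unfolding hull_Rd_def using l m uv by (intro CollectI exI[of _ "\<lambda>a. u * l a + v * m a"]) auto
qed

lemma compactin_hull_Rd:
  assumes A: "finite A"
  shows "compactin (top_Rd d) (hull_Rd d A)"
proof -
  let ?T = "product_topology (\<lambda>_. euclideanreal) A"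
  let ?f = "\<lambda>l. \<lambda>i\<in>{..<d}. \<Sum>a\<in>A. l a * a i"
  let ?C = "PiE A (\<lambda>_. {0..1}) :: ((nat \<Rightarrow> real) \<Rightarrow> real) set"
  let ?D = "{l \<in> topspace ?T. sum l A \<in> {1}}"
  have "closedin ?T ?D"
    using A by (intro closedin_continuous_map_preimage[where Y = euclideanreal] continuous_map_sum
        continuous_map_product_projection) auto
  moreover have "compactin ?T ?C"
    by (simp add: compactin_PiE)
  ultimately have "compactin ?T (?D \<inter> ?C)"
    by (rule closed_Int_compactin)
  moreover have "continuous_map ?T (top_Rd d) ?f"
    unfolding continuous_map_componentwise using A
    by (auto intro!: continuous_map_sum continuous_map_real_mult_right continuous_map_product_projection)
  ultimately have "compactin (top_Rd d) (?f ` (?D \<inter> ?C))"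
    by (rule image_compactin)
  moreover have "?f ` (?D \<inter> ?C) = hull_Rd d A"
  proof (intro set_eqI iffI)
    fix x assume "x \<in> ?f ` (?D \<inter> ?C)"
    then show "x \<in> hull_Rd d A" unfolding hull_Rd_def by (auto simp: PiE_iff)
  next
    fix x assume "x \<in> hull_Rd d A"
    then obtain l where l: "x = ?f l" "\<forall>a\<in>A. 0 \<le> l a" "sum l A = 1" unfolding hull_Rd_def by blast
    have "l a \<le> 1" if "a \<in> A" for a
      using member_le_sum[of a A l] that l A by auto
    then have "restrict l A \<in> ?D \<inter> ?C" using l by (auto simp: PiE_iff)
    moreover have "x = ?f (restrict l A)" unfolding l(1) by (intro restrict_ext sum.cong) auto
    ultimately show "x \<in> ?f ` (?D \<inter> ?C)" by blast
  qed
  ultimately show ?thesis by simp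
qed



lemma hull_Rd_subset:
  assumes "finite A" "A \<subseteq> K" "convex_Rd d K" "K \<subseteq> space (lborel_Rd d)"
  shows "hull_Rd d A \<subseteq> K"
proof -
  have "(\<lambda>i\<in>{..<d}. \<Sum>a\<in>A. l a * a i) \<in> K" if "\<forall>a\<in>A. 0 \<le> l a" "sum l A = 1" for l :: "(nat \<Rightarrow> real) \<Rightarrow> real"
    using assms(1,2) that
  proof (induction A arbitrary: l)
    case empty then show ?case by simp
  next
    case (insert b A)
    have b: "b \<in> K" "l b \<ge> 0" using insert.prems by auto
    have sA: "sum l A = 1 - l b" using insert by simp
    have "sum l A \<ge> 0" using insert.prems by (intro sum_nonneg) auto
    show ?case
    proof (cases "l b = 1")
      case True
      then have "sum l A = 0" using sA by simp
      then have "l a = 0" if "a \<in> A" for a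
        using that insert by (subst (asm) sum_nonneg_eq_0_iff) auto
      then have "(\<lambda>i\<in>{..<d}. \<Sum>a\<in>insert b A. l a * a i) = b"
        using True insert b assms(4) by (intro Rd_eqI) auto
      then show ?thesis using b by simp
    next
      case False
      then have pos: "1 - l b > 0" using \<open>sum l A \<ge> 0\<close> sA by simp
      define m where "m = (\<lambda>a. l a / (1 - l b))"
      have mK: "(\<lambda>i\<in>{..<d}. \<Sum>a\<in>A. m a * a i) \<in> K"
        using insert pos sA by (intro insert.IH) (auto simp: m_def sum_divide_distrib[symmetric])
      have "(\<lambda>i\<in>{..<d}. (1 - l b) * (\<lambda>i\<in>{..<d}. \<Sum>a\<in>A. m a * a i) i + l b * b i) \<in> K"
        by (rule convex_combination_Rd[OF assms(3) mK b]) (use pos in simp)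
      moreover have "(\<lambda>i\<in>{..<d}. (1 - l b) * (\<lambda>i\<in>{..<d}. \<Sum>a\<in>A. m a * a i) i + l b * b i)
          = (\<lambda>i\<in>{..<d}. \<Sum>a\<in>insert b A. l a * a i)"
        using pos insert by (intro restrict_ext) (simp add: m_def sum_distrib_left)
      ultimately show ?thesis by (simp only:)
    qed
  qed
  then show ?thesis unfolding hull_Rd_def by blast
qed

lemma finite_net:
  assumes K: "compactin (top_Rd d) K" and e: "e > 0"
  shows "\<exists>A. finite A \<and> A \<subseteq> K \<and> (\<forall>x\<in>K. \<exists>a\<in>A. dist_Rd d x a < e)"
proof -
  let ?B = "\<lambda>a. {y \<in> topspace (top_Rd d). dist_Rd d a y \<in> {..<e}}"
  have op: "openin (top_Rd d) (?B a)" for a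
    by (intro openin_continuous_map_preimage[OF continuous_map_dist_Rd]) simp
  have sub: "K \<subseteq> topspace (top_Rd d)" using K by (rule compactin_subset_topspace)
  have cov: "K \<subseteq> \<Union>(?B ` K)" using sub e by fastforce
  have "\<forall>U\<in>?B ` K. openin (top_Rd d) U" using op by blast
  with K cov have "\<exists>F. finite F \<and> F \<subseteq> ?B ` K \<and> K \<subseteq> \<Union>F"
    unfolding compactin_def by blast
  then obtain F where F: "finite F" "F \<subseteq> ?B ` K" "K \<subseteq> \<Union>F" by blast
  obtain A where A: "A \<subseteq> K" "finite A" "F = ?B ` A"
    using finite_subset_image[OF F(1,2)] by blast
  have "\<exists>a\<in>A. dist_Rd d x a < e" if x: "x \<in> K" for x
  proof -
    obtain a where "a \<in> A" "x \<in> ?B a" using F(3) x unfolding A(3) by blast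
    then show ?thesis by (intro bexI[of _ a]) (simp_all add: dist_Rd_commute[of d x a])
  qed
  with A show ?thesis by blast
qed

section \<open>Scaling of the cells of a polytope\<close>

definition parallel_vol :: "nat \<Rightarrow> (nat \<Rightarrow> real) set \<Rightarrow> real \<Rightarrow> real" where
  "parallel_vol d K t = measure (lborel_Rd d) {x \<in> space (lborel_Rd d). infdist_Rd d x K \<le> t}"

lemma parallel_sets [measurable]: "{x \<in> space (lborel_Rd d). infdist_Rd d x K \<le> t} \<in> sets (lborel_Rd d)"
  by measurable

lemma parallel_finite:
  assumes y0: "y0 \<in> K" and R: "\<And>y. y \<in> K \<Longrightarrow> dist_Rd d y0 y \<le> R"
  shows "emeasure (lborel_Rd d) {x \<in> space (lborel_Rd d). infdist_Rd d x K \<le> t} < \<infinity>"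
proof -
  let ?B = "PiE {..<d} (\<lambda>i. {y0 i - (R + t + 1)..y0 i + (R + t + 1)})"
  have "{x \<in> space (lborel_Rd d). infdist_Rd d x K \<le> t} \<subseteq> ?B"
  proof
    fix x assume x: "x \<in> {x \<in> space (lborel_Rd d). infdist_Rd d x K \<le> t}"
    then have "infdist_Rd d x K < t + 1" by simp
    then obtain y where y: "y \<in> K" "dist_Rd d x y < t + 1"
      using infdist_Rd_approx[of K d x "t + 1"] y0 by blast
    have "\<bar>x i - y0 i\<bar> \<le> R + t + 1" if "i < d" for i
      using abs_diff_le_dist_Rd[OF that, of x y0] dist_Rd_triangle[of d x y0 y] R[OF y(1)] y(2)
        dist_Rd_commute[of d y y0] by linarith
    then have "x i \<in> {y0 i - (R + t + 1)..y0 i + (R + t + 1)}" if "i < d" for i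
      using that by (auto simp: abs_le_iff algebra_simps)
    then show "x \<in> ?B" using x by (auto simp: space_Rd PiE_iff simp del: atLeastAtMost_iff)
  qed
  then have "emeasure (lborel_Rd d) {x \<in> space (lborel_Rd d). infdist_Rd d x K \<le> t} \<le> emeasure (lborel_Rd d) ?B"
    by (intro emeasure_mono Rd_box_sets) auto
  also have "\<dots> < \<infinity>"
    by (subst emeasure_Rd_box) (auto simp: less_top[symmetric] ennreal_prod_eq_top emeasure_lborel_Icc_eq)
  finally show ?thesis .
qed

text \<open>Sort the points \<open>x\<close> by the set \<open>I\<close> of those generators \<open>a\<close> of the polytope for which \<open>a - p x\<close> is orthogonal to \<open>x - p x\<close>,
  where \<open>p x\<close> is the nearest point. On such a cell \<open>p x\<close> is a convex combination of \<open>I\<close>,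
  so it is the orthogonal projection of \<open>x\<close> to the affine hull of \<open>I\<close>. Hence moving \<open>x\<close> to
  \<open>p x + (x - p x) / t\<close> is the restriction of an affine map, whose volume factor is \<open>t ^ (d - n)\<close> with \<open>n\<close> the dimension of
  the hull. The map preserves the cell and divides the distance to the polytope by \<open>t\<close>.\<close>

lemma polytope_cell_scaling:
  fixes d :: nat and A :: "(nat \<Rightarrow> real) set" and p :: "(nat \<Rightarrow> real) \<Rightarrow> (nat \<Rightarrow> real)"
  defines "P \<equiv> hull_Rd d A"
  defines "act \<equiv> (\<lambda>x. {a \<in> A. ip d (\<lambda>i. x i - p x i) (\<lambda>i. a i - p x i) = 0})"
  assumes A: "finite A" "A \<subseteq> space (lborel_Rd d)"
    and p: "\<And>x. p x \<in> P" "\<And>x. dist_Rd d x (p x) = infdist_Rd d x P"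
  shows "{x \<in> space (lborel_Rd d). act x = I \<and> infdist_Rd d x P \<le> t} \<in> sets (lborel_Rd d)" (is ?th1)
    and "\<exists>n\<le>d. \<forall>t>0. emeasure (lborel_Rd d) {x \<in> space (lborel_Rd d). act x = I \<and> infdist_Rd d x P \<le> t}
          = ennreal (t ^ d / t ^ n) * emeasure (lborel_Rd d) {x \<in> space (lborel_Rd d). act x = I \<and> infdist_Rd d x P \<le> 1}" (is ?th2)
proof -
  let ?M = "lborel_Rd d"
  let ?g = "\<lambda>x y. ip d (\<lambda>i. x i - p x i) (\<lambda>i. y i - p x i)"
  have var: "?g x y \<le> 0" if "y \<in> P" for x y
    using nearest_variational[OF _ p(1) p(2) that] convex_hull_Rd by (simp add: P_def)
  have psp: "p x \<in> space ?M" for x using p(1) hull_Rd_subset_space[of d A] by (auto simp: P_def)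
  have Ane: "A \<noteq> {}"
    using p(1) unfolding P_def hull_Rd_def by auto
  have AP: "A \<subseteq> P" unfolding P_def by (rule hull_Rd_superset[OF A])
  have lip: "dist_Rd d (p x) (p y) \<le> dist_Rd d x y" for x y
    by (rule nearest_lipschitz[OF p(1) var p(1) var])
  have pm: "(\<lambda>x. p x i) \<in> borel_measurable ?M" if i: "i < d" for i
  proof (rule Rd_lipschitz_measurable)
    fix x y
    show "p x i \<le> p y i + dist_Rd d x y"
      using abs_diff_le_dist_Rd[OF i, of "p x" "p y"] lip[of x y] by linarith
  qed
  have gm: "(\<lambda>x. ?g x a) \<in> borel_measurable ?M" for a
    by (intro ip_measurable borel_measurable_diff pm coord_measurable borel_measurable_const)
  have act_sets: "{x \<in> space ?M. act x = I} \<in> sets ?M"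
  proof (cases "I \<subseteq> A")
    case True
    have "{x \<in> space ?M. act x = I} = {x \<in> space ?M. \<forall>a\<in>A. (?g x a = 0) = (a \<in> I)}"
      using True unfolding act_def by blast
    also have "\<dots> \<in> sets ?M"
    proof (rule sets.sets_Collect_finite_All'[OF _ A(1) Ane])
      fix a
      have "{x \<in> space ?M. ?g x a = 0} \<in> sets ?M" using gm[of a] by measurable
      then have "{x \<in> space ?M. ?g x a = 0} \<in> sets ?M" "{x \<in> space ?M. \<not> ?g x a = 0} \<in> sets ?M"
        by (auto intro: sets.sets_Collect_neg)
      then show "{x \<in> space ?M. (?g x a = 0) = (a \<in> I)} \<in> sets ?M" by (cases "a \<in> I") simp_all
    qed
    finally show ?thesis .
  next
    case False
    then have "{x \<in> space ?M. act x = I} = {}" unfolding act_def by blast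
    then show ?thesis by (simp only: sets.empty_sets)
  qed
  have S: "{x \<in> space ?M. act x = I \<and> infdist_Rd d x P \<le> t} \<in> sets ?M" for t
    by (rule sets.sets_Collect_conj[OF parallel_sets act_sets])
  then show ?th1 .
  show ?th2
  proof (cases "\<exists>x\<in>space ?M. act x = I")
    case False
    then have e: "{x \<in> space ?M. act x = I \<and> infdist_Rd d x P \<le> t} = {}" for t by blast
    show ?thesis unfolding e by (intro exI[of _ 0]) simp
  next
    case True
    \<comment> \<open>The weights of \<open>p x\<close> vanish outside \<open>I\<close>, as the weighted sum of the nonpositive products with \<open>x - p x\<close> is zero.\<close>
    have rep: "\<exists>l. (\<forall>i<d. p x i = (\<Sum>a\<in>I. l a * a i)) \<and> sum l I = 1" if x: "act x = I" for x
    proof -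
      have IA: "I \<subseteq> A" using x unfolding act_def by blast
      obtain l where l: "p x = (\<lambda>i\<in>{..<d}. \<Sum>a\<in>A. l a * a i)" "\<forall>a\<in>A. 0 \<le> l a" "sum l A = 1"
        using p(1)[of x] unfolding P_def hull_Rd_def by blast
      have "(\<Sum>a\<in>A. l a * ?g x a) = ip d (\<lambda>i. x i - p x i) (\<lambda>i. \<Sum>a\<in>A. l a * (a i - p x i))"
        by (simp add: ip_sum_right ip_scale_right)
      also have "\<dots> = ip d (\<lambda>i. x i - p x i) (\<lambda>i. 0)"
      proof (rule ip_cong[OF refl])
        fix i assume i: "i < d"
        have "(\<Sum>a\<in>A. l a * (a i - p x i)) = (\<Sum>a\<in>A. l a * a i) - sum l A * p x i"
          by (simp add: right_diff_distrib sum_subtractf sum_distrib_right)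
        also have "(\<Sum>a\<in>A. l a * a i) = p x i" using i unfolding l(1) by simp
        finally show "(\<Sum>a\<in>A. l a * (a i - p x i)) = 0" by (simp add: l(3))
      qed
      finally have "(\<Sum>a\<in>A. - (l a * ?g x a)) = 0" by (simp add: ip_def sum_negf)
      moreover have "0 \<le> - (l a * ?g x a)" if "a \<in> A" for a
        using l(2) that var[of a x] AP by (simp add: mult_nonneg_nonpos subset_iff)
      ultimately have z: "- (l a * ?g x a) = 0" if "a \<in> A" for a
        using that sum_nonneg_eq_0_iff[OF A(1), of "\<lambda>a. - (l a * ?g x a)"] by blast
      have l0: "l a = 0" if "a \<in> A - I" for a
        using z[of a] that x unfolding act_def by auto
      have "(\<Sum>a\<in>I. l a * a i) = p x i" if "i < d" for i
      proof -
        have "(\<Sum>a\<in>A. l a * a i) = (\<Sum>a\<in>I. l a * a i)"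
          by (rule sum.mono_neutral_right[OF A(1) IA]) (simp add: l0)
        then show ?thesis using that unfolding l(1) by simp
      qed
      moreover have "sum l A = sum l I"
        by (rule sum.mono_neutral_right[OF A(1) IA]) (simp add: l0)
      ultimately show ?thesis using l(3) by metis
    qed
    obtain x0 where x0: "act x0 = I" using True by blast
    have "I \<noteq> {}" using rep[OF x0] by auto
    then obtain a0 where a0: "a0 \<in> I" by blast
    have finI: "finite I" using x0 A(1) unfolding act_def by auto
    have finS: "finite ((\<lambda>a i. a i - a0 i) ` I)" using finI by simp
    obtain n w where on: "orthonormal d n w"
      and ex': "\<forall>s\<in>(\<lambda>a i. a i - a0 i) ` I. \<forall>i<d. s i = (\<Sum>j<n. ip d s (w j) * w j i)"
      and pp': "\<forall>y. (\<forall>s\<in>(\<lambda>a i. a i - a0 i) ` I. ip d y s = 0) \<longrightarrow> (\<forall>j<n. ip d y (w j) = 0)"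
      using gram_schmidt[OF finS, of d] by iprover
    have ex0: "s i = (\<Sum>j<n. ip d s (w j) * w j i)" if "s \<in> (\<lambda>a i. a i - a0 i) ` I" "i < d" for s i
      by (rule mp[OF spec[OF bspec[OF ex' that(1)]] that(2)])
    have pp: "ip d y (w j) = 0" if "\<forall>s\<in>(\<lambda>a i. a i - a0 i) ` I. ip d y s = 0" "j < n" for y j
      by (rule mp[OF spec[OF mp[OF spec[OF pp'] that(1)]] that(2)])
    have ex: "a i - a0 i = (\<Sum>j<n. ip d (\<lambda>i. a i - a0 i) (w j) * w j i)" if "a \<in> I" "i < d" for a i
      using ex0[OF imageI[OF that(1)] that(2)] .
    have perp: "ip d (\<lambda>i. x i - p x i) (w j) = 0" if x: "act x = I" and j: "j < n" for x j
    proof (rule pp[OF _ j], intro ballI)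
      fix s assume "s \<in> (\<lambda>a i. a i - a0 i) ` I"
      then obtain a where a: "a \<in> I" "s = (\<lambda>i. a i - a0 i)" by blast
      have "ip d (\<lambda>i. x i - p x i) s = ip d (\<lambda>i. x i - p x i) (\<lambda>i. (a i - p x i) - (a0 i - p x i))"
        by (simp add: a(2))
      also have "\<dots> = ?g x a - ?g x a0" by (simp only: ip_diff_right[of d _ "\<lambda>i. a i - p x i" "\<lambda>i. a0 i - p x i"])
      also have "\<dots> = 0" using a(1) a0 x unfolding act_def by auto
      finally show "ip d (\<lambda>i. x i - p x i) s = 0" .
    qed
    have span: "p x i - a0 i = (\<Sum>j<n. ip d (\<lambda>i. p x i - a0 i) (w j) * w j i)" if x: "act x = I" and i: "i < d" for x i
    proof -
      obtain l where l: "\<And>i. i < d \<Longrightarrow> p x i = (\<Sum>a\<in>I. l a * a i)" "sum l I = 1"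
        using rep[OF x] by blast
      have pl: "p x i - a0 i = (\<Sum>a\<in>I. l a * (a i - a0 i))" if "i < d" for i
      proof -
        have "(\<Sum>a\<in>I. l a * (a i - a0 i)) = (\<Sum>a\<in>I. l a * a i) - sum l I * a0 i"
          by (simp add: right_diff_distrib sum_subtractf sum_distrib_right)
        then show ?thesis using l(1)[OF that] l(2) by simp
      qed
      have "ip d (\<lambda>i. p x i - a0 i) (w j) = (\<Sum>a\<in>I. l a * ip d (\<lambda>i. a i - a0 i) (w j))" for j
      proof -
        have "ip d (\<lambda>i. p x i - a0 i) (w j) = ip d (\<lambda>i. \<Sum>a\<in>I. l a * (a i - a0 i)) (w j)"
          by (rule ip_cong[OF pl refl])
        then show ?thesis by (simp only: ip_sum_left ip_scale_left)
      qed
      then have "(\<Sum>j<n. ip d (\<lambda>i. p x i - a0 i) (w j) * w j i)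
          = (\<Sum>j<n. \<Sum>a\<in>I. l a * (ip d (\<lambda>i. a i - a0 i) (w j) * w j i))"
        by (simp add: sum_distrib_right mult.assoc)
      also have "\<dots> = (\<Sum>a\<in>I. \<Sum>j<n. l a * (ip d (\<lambda>i. a i - a0 i) (w j) * w j i))"
        by (rule sum.swap)
      also have "\<dots> = (\<Sum>a\<in>I. l a * (a i - a0 i))"
        by (intro sum.cong refl) (simp only: sum_distrib_left[symmetric] ex[OF _ i, symmetric])
      finally show ?thesis using pl[OF i] by simp
    qed
    \<comment> \<open>\<open>\<Lambda> t\<close> fixes the direction space of the hull and divides by \<open>t\<close> across it; \<open>\<Phi> t\<close> is the same map with the origin at \<open>a0\<close>.\<close>
    define \<Lambda> where "\<Lambda> t y = (\<lambda>i\<in>{..<d}. y i / t + (1 - 1 / t) * (\<Sum>j<n. ip d y (w j) * w j i))" for t y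
    define \<Phi> where "\<Phi> t x = (\<lambda>i\<in>{..<d}. \<Lambda> t (\<lambda>i\<in>{..<d}. x i + - a0 i) i + a0 i)" for t x
    have \<Phi>sp: "\<Phi> t x \<in> space ?M" for t x unfolding \<Phi>_def by (rule Rd_restrict)
    have vf: "vol_factor d (\<Phi> t) (t ^ d / t ^ n)" if t: "t > 0" for t
    proof -
      have "vol_factor d (\<Lambda> t) (t ^ d / t ^ n)"
        unfolding \<Lambda>_def by (rule vol_factor_orthonormal_scaling[OF on t])
      from vol_factor_compose[OF vol_factor_translation[of d a0] vol_factor_compose[OF this vol_factor_translation[of d "\<lambda>i. - a0 i"]]]
      have "vol_factor d (\<lambda>x. \<Phi> t x) (1 * (t ^ d / t ^ n * 1))"
        unfolding \<Phi>_def .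
      then show ?thesis by simp
    qed
    have \<Lambda>w: "ip d (\<Lambda> t y) (w k) = ip d y (w k)" if k: "k < n" and t: "t > 0" for t y k
    proof -
      have "ip d (\<Lambda> t y) (w k) = ip d (\<lambda>i. (1 / t) * y i + (1 - 1 / t) * (\<Sum>j<n. ip d y (w j) * w j i)) (w k)"
        by (rule ip_cong) (simp_all add: \<Lambda>_def)
      also have "\<dots> = (1 / t) * ip d y (w k) + (1 - 1 / t) * (\<Sum>j<n. ip d y (w j) * ip d (w j) (w k))"
        by (simp only: ip_add_left ip_scale_left ip_sum_left)
      also have "\<dots> = ip d y (w k)"
        unfolding orthonormal_sum[OF on k] using t by (simp add: field_simps)
      finally show ?thesis .
    qed
    have \<Lambda>\<Lambda>: "\<Lambda> (1 / t) (\<Lambda> t y) i = y i" if t: "t > 0" and i: "i < d" for t y i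
    proof -
      have "(\<Sum>j<n. ip d (\<Lambda> t y) (w j) * w j i) = (\<Sum>j<n. ip d y (w j) * w j i)"
        by (intro sum.cong) (simp_all add: \<Lambda>w[OF _ t])
      then have "\<Lambda> (1 / t) (\<Lambda> t y) i = \<Lambda> t y i * t + (1 - t) * (\<Sum>j<n. ip d y (w j) * w j i)"
        using i by (simp add: \<Lambda>_def[of "1 / t"])
      also have "\<dots> = y i"
        using i t by (simp add: \<Lambda>_def field_simps)
      finally show ?thesis .
    qed
    have \<Phi>\<Phi>: "\<Phi> (1 / t) (\<Phi> t x) = x" if t: "t > 0" and x: "x \<in> space ?M" for t x
    proof (rule Rd_eqI[OF \<Phi>sp x])
      fix i assume i: "i < d"
      let ?y = "\<lambda>i\<in>{..<d}. x i + - a0 i"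
      have "(\<lambda>i\<in>{..<d}. \<Phi> t x i + - a0 i) = \<Lambda> t ?y"
        unfolding \<Phi>_def by (rule Rd_eqI[where d=d]) (simp_all add: \<Lambda>_def)
      then have "\<Phi> (1 / t) (\<Phi> t x) i = \<Lambda> (1 / t) (\<Lambda> t ?y) i + a0 i"
        using i by (simp add: \<Phi>_def[of "1 / t"])
      then show "\<Phi> (1 / t) (\<Phi> t x) i = x i"
        using \<Lambda>\<Lambda>[OF t i, of ?y] i by simp
    qed
    have \<Phi>cell: "\<Phi> t x i = p x i + (x i - p x i) / t" if x: "act x = I" and t: "t > 0" and i: "i < d" for x t i
    proof -
      let ?y = "\<lambda>i\<in>{..<d}. x i + - a0 i"
      have "ip d ?y (w j) = ip d (\<lambda>i. p x i - a0 i) (w j)" if "j < n" for j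
      proof -
        have "ip d ?y (w j) = ip d (\<lambda>i. (x i - p x i) + (p x i - a0 i)) (w j)"
          by (rule ip_cong) simp_all
        also have "\<dots> = ip d (\<lambda>i. x i - p x i) (w j) + ip d (\<lambda>i. p x i - a0 i) (w j)"
          by (rule ip_add_left)
        finally show ?thesis using perp[OF x that] by simp
      qed
      then have "(\<Sum>j<n. ip d ?y (w j) * w j i) = p x i - a0 i"
        unfolding span[OF x i] by (intro sum.cong) simp_all
      then have "\<Lambda> t ?y i = (x i - a0 i) / t + (1 - 1 / t) * (p x i - a0 i)"
        using i by (simp add: \<Lambda>_def)
      then have "\<Phi> t x i = (x i - a0 i) / t + (1 - 1 / t) * (p x i - a0 i) + a0 i"
        using i unfolding \<Phi>_def by simp
      also have "\<dots> = p x i + (x i - p x i) / t"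
        by (simp add: diff_divide_distrib algebra_simps)
      finally show ?thesis .
    qed
    have cell: "act (\<Phi> t x) = I \<and> infdist_Rd d (\<Phi> t x) P = infdist_Rd d x P / t"
      if x: "act x = I" and t: "t > 0" for x t
    proof -
      have g: "ip d (\<lambda>i. \<Phi> t x i - p x i) z = ip d (\<lambda>i. x i - p x i) z / t" for z
      proof -
        have "ip d (\<lambda>i. \<Phi> t x i - p x i) z = ip d (\<lambda>i. (1 / t) * (x i - p x i)) z"
          by (rule ip_cong) (simp_all add: \<Phi>cell[OF x t])
        then show ?thesis by (simp only: ip_scale_left) simp
      qed
      have v: "ip d (\<lambda>i. \<Phi> t x i - p x i) (\<lambda>i. y i - p x i) \<le> 0" if "y \<in> P" for y
        unfolding g using var[OF that, of x] t by (simp add: divide_nonpos_pos)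
      have eq: "p (\<Phi> t x) = p x"
        by (rule Rd_eqI[OF psp psp]) (rule nearest_characterization(2)[OF p(1) v p(1) p(2)])
      have "act (\<Phi> t x) = act x"
        unfolding act_def eq g using t by simp
      moreover have "infdist_Rd d (\<Phi> t x) P = dist_Rd d (\<Phi> t x) (p x)"
        using nearest_characterization(1)[OF p(1) v] by simp
      moreover have "dist_Rd d (\<Phi> t x) (p x) = dist_Rd d x (p x) / t"
      proof -
        have "dist_Rd d (\<Phi> t x) (p x) = L2_set (\<lambda>i. (1 / t) * (x i - p x i)) {..<d}"
          unfolding dist_Rd_def by (rule L2_set_cong) (simp_all add: \<Phi>cell[OF x t])
        also have "\<dots> = (1 / t) * L2_set (\<lambda>i. x i - p x i) {..<d}"
          using t by (simp only: L2_set_right_distrib[symmetric] zero_le_divide_1_iff less_imp_le)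
        finally show ?thesis by (simp add: dist_Rd_def)
      qed
      ultimately show ?thesis using x p(2) by simp
    qed
    have eq: "{x \<in> space ?M. act x = I \<and> infdist_Rd d x P \<le> t}
        = {x \<in> space ?M. \<Phi> t x \<in> {x \<in> space ?M. act x = I \<and> infdist_Rd d x P \<le> 1}}" if t: "t > 0" for t
    proof (intro set_eqI iffI)
      fix x assume "x \<in> {x \<in> space ?M. act x = I \<and> infdist_Rd d x P \<le> t}"
      then show "x \<in> {x \<in> space ?M. \<Phi> t x \<in> {x \<in> space ?M. act x = I \<and> infdist_Rd d x P \<le> 1}}"
        using cell[of x t] t \<Phi>sp by simp
    next
      fix x assume "x \<in> {x \<in> space ?M. \<Phi> t x \<in> {x \<in> space ?M. act x = I \<and> infdist_Rd d x P \<le> 1}}"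
      then have x: "x \<in> space ?M" "act (\<Phi> t x) = I" "infdist_Rd d (\<Phi> t x) P \<le> 1" by blast+
      then have "act x = I \<and> infdist_Rd d x P = infdist_Rd d (\<Phi> t x) P / (1 / t)"
        using cell[OF x(2), of "1 / t"] t by (simp only: \<Phi>\<Phi>[OF t x(1)]) simp
      then show "x \<in> {x \<in> space ?M. act x = I \<and> infdist_Rd d x P \<le> t}"
        using x t by (simp add: mult_left_le_one_le)
    qed
    have "emeasure ?M {x \<in> space ?M. act x = I \<and> infdist_Rd d x P \<le> t}
        = ennreal (t ^ d / t ^ n) * emeasure ?M {x \<in> space ?M. act x = I \<and> infdist_Rd d x P \<le> 1}" if t: "t > 0" for t
      using vf[OF t] S[of 1] unfolding eq[OF t] vol_factor_def by blast
    then show ?thesis using orthonormal_card_le[OF on] by blast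
  qed
qed

section \<open>Steiner's formula\<close>

lemma compactin_Rd_bounded:
  assumes "compactin (top_Rd d) K"
  shows "\<exists>R. \<forall>y\<in>K. dist_Rd d y0 y \<le> R"
proof -
  have "compact ((\<lambda>y. dist_Rd d y0 y) ` K)"
    using image_compactin[OF assms continuous_map_dist_Rd[of d y0]] by (simp add: compactin_euclidean_iff)
  then have "bdd_above ((\<lambda>y. dist_Rd d y0 y) ` K)"
    by (intro bounded_imp_bdd_above compact_imp_bounded)
  then show ?thesis unfolding bdd_above_def by blast
qed

lemma parallel_fmeasurable:
  assumes "compactin (top_Rd d) K" "K \<noteq> {}"
  shows "{x \<in> space (lborel_Rd d). infdist_Rd d x K \<le> t} \<in> fmeasurable (lborel_Rd d)"
proof -
  obtain y0 where y0: "y0 \<in> K" using assms by blast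
  obtain R where R: "\<forall>y\<in>K. dist_Rd d y0 y \<le> R" using compactin_Rd_bounded[OF assms(1)] by blast
  show ?thesis
    by (intro fmeasurableI parallel_sets parallel_finite[OF y0, of d R]) (use R in blast)
qed

lemma parallel_vol_mono:
  assumes "compactin (top_Rd d) L" "L \<noteq> {}"
    and "\<And>x. x \<in> space (lborel_Rd d) \<Longrightarrow> infdist_Rd d x K \<le> s \<Longrightarrow> infdist_Rd d x L \<le> t"
  shows "parallel_vol d K s \<le> parallel_vol d L t"
  unfolding parallel_vol_def
  by (rule measure_mono_fmeasurable[OF _ parallel_sets parallel_fmeasurable[OF assms(1,2)]])
    (use assms(3) in blast)

text \<open>The parallel body is the disjoint union of finitely many cells, each of which contributes a monomial.\<close>

lemma polytope_parallel_vol: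
  assumes A: "finite A" "A \<subseteq> space (lborel_Rd d)" "A \<noteq> {}"
  shows "\<exists>c. (\<forall>k. 0 \<le> c k) \<and> (\<forall>t>0. parallel_vol d (hull_Rd d A) t = (\<Sum>k\<le>d. c k * t ^ k))"
proof -
  let ?M = "lborel_Rd d" and ?P = "hull_Rd d A"
  have cP: "compactin (top_Rd d) ?P" by (rule compactin_hull_Rd[OF A(1)])
  have neP: "?P \<noteq> {}" using hull_Rd_superset[OF A(1,2)] A(3) by blast
  have "\<forall>x. \<exists>q. q \<in> ?P \<and> dist_Rd d x q = infdist_Rd d x ?P"
    using nearest_exists[OF cP neP] by blast
  then obtain p where p0: "\<forall>x. p x \<in> ?P \<and> dist_Rd d x (p x) = infdist_Rd d x ?P"
    using choice[of "\<lambda>x q. q \<in> ?P \<and> dist_Rd d x q = infdist_Rd d x ?P"] by blast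
  have p: "p x \<in> ?P" "dist_Rd d x (p x) = infdist_Rd d x ?P" for x using p0 by auto
  define act where "act x = {a \<in> A. ip d (\<lambda>i. x i - p x i) (\<lambda>i. a i - p x i) = 0}" for x
  have actA: "act x \<in> Pow A" for x unfolding act_def by blast
  define C where "C I t = {x \<in> space ?M. act x = I \<and> infdist_Rd d x ?P \<le> t}" for I t
  have C_sets: "C I t \<in> sets ?M" for I t
    unfolding C_def act_def by (rule polytope_cell_scaling(1)[OF A(1,2) p])
  have "\<exists>n\<le>d. \<forall>t>0. emeasure ?M (C I t) = ennreal (t ^ d / t ^ n) * emeasure ?M (C I 1)" for I
    unfolding C_def act_def by (rule polytope_cell_scaling(2)[OF A(1,2) p])
  then have ex: "\<exists>n. n \<le> d \<and> (\<forall>t>0. emeasure ?M (C I t) = ennreal (t ^ d / t ^ n) * emeasure ?M (C I 1))" for I .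
  define n where "n I = (SOME n. n \<le> d \<and> (\<forall>t>0. emeasure ?M (C I t) = ennreal (t ^ d / t ^ n) * emeasure ?M (C I 1)))" for I
  have n0: "n I \<le> d \<and> (\<forall>t>0. emeasure ?M (C I t) = ennreal (t ^ d / t ^ n I) * emeasure ?M (C I 1))" for I
    unfolding n_def by (rule someI_ex[OF ex])
  have n1: "n I \<le> d" for I
    by (rule conjunct1[OF n0])
  have n2: "emeasure ?M (C I t) = ennreal (t ^ d / t ^ n I) * emeasure ?M (C I 1)" if "t > 0" for I t
    by (rule mp[OF spec[OF conjunct2[OF n0]] that])
  define m where "m I = measure ?M (C I 1)" for I
  have m0: "m I \<ge> 0" for I by (simp add: m_def)
  have "emeasure ?M (C I 1) = ennreal (m I)" for I
  proof -
    have "C I 1 \<in> fmeasurable ?M"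
      by (rule fmeasurableI2[OF parallel_fmeasurable[OF cP neP, of 1] _ C_sets]) (auto simp: C_def)
    then show ?thesis unfolding m_def by (intro emeasure_eq_measure2) (auto dest: fmeasurableD2 simp: top.not_eq_extremum)
  qed
  then have mC: "emeasure ?M (C I t) = ennreal (m I * t ^ (d - n I))" if "t > 0" for I t
  proof -
    have "t ^ d / t ^ n I = t ^ (d - n I)" using that n1[of I] by (simp add: power_diff)
    then show ?thesis using n2[OF that, of I] that \<open>emeasure ?M (C I 1) = ennreal (m I)\<close>
      by (simp add: ennreal_mult m0 mult.commute)
  qed
  define c where "c k = (\<Sum>I\<in>{I \<in> Pow A. d - n I = k}. m I)" for k
  have c0: "c k \<ge> 0" for k unfolding c_def by (intro sum_nonneg m0)
  have "parallel_vol d ?P t = (\<Sum>k\<le>d. c k * t ^ k)" if t: "t > 0" for t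
  proof -
    have U: "{x \<in> space ?M. infdist_Rd d x ?P \<le> t} = (\<Union>I\<in>Pow A. C I t)"
      unfolding C_def using actA by blast
    have "emeasure ?M {x \<in> space ?M. infdist_Rd d x ?P \<le> t} = (\<Sum>I\<in>Pow A. emeasure ?M (C I t))"
      unfolding U
    proof (rule sum_emeasure[symmetric])
      show "(\<lambda>I. C I t) ` Pow A \<subseteq> sets ?M" using C_sets by blast
      show "disjoint_family_on (\<lambda>I. C I t) (Pow A)" unfolding disjoint_family_on_def C_def by blast
      show "finite (Pow A)" using A(1) by simp
    qed
    also have "\<dots> = (\<Sum>I\<in>Pow A. ennreal (m I * t ^ (d - n I)))"
      by (simp only: mC[OF t])
    also have "\<dots> = ennreal (\<Sum>I\<in>Pow A. m I * t ^ (d - n I))"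
      using m0 t by (intro sum_ennreal) simp
    finally have "parallel_vol d ?P t = (\<Sum>I\<in>Pow A. m I * t ^ (d - n I))"
      unfolding parallel_vol_def measure_def using m0 t by (simp add: sum_nonneg)
    also have "\<dots> = (\<Sum>k\<le>d. \<Sum>I\<in>{I \<in> Pow A. d - n I = k}. m I * t ^ (d - n I))"
      by (rule sum.group[symmetric]) (use A(1) in auto)
    also have "\<dots> = (\<Sum>k\<le>d. c k * t ^ k)"
      unfolding c_def sum_distrib_right by (intro sum.cong) auto
    finally show ?thesis .
  qed
  then show ?thesis using c0 by blast
qed

lemma bounded_coefficients_subsequence:
  fixes c :: "nat \<Rightarrow> nat \<Rightarrow> real"
  assumes "\<And>n k. k < m \<Longrightarrow> c n k \<in> {0..B}"
  shows "\<exists>r l. strict_mono (r :: nat \<Rightarrow> nat) \<and> (\<forall>k<m. (\<lambda>n. c (r n) k) \<longlonglongrightarrow> l k)"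
  using assms
proof (induction m)
  case 0
  show ?case by (rule exI[of _ id]) (simp add: strict_mono_id)
next
  case (Suc m)
  have "\<And>n k. k < m \<Longrightarrow> c n k \<in> {0..B}" using Suc.prems by simp
  from Suc.IH[OF this] obtain r l where r: "strict_mono r" "\<And>k. k < m \<Longrightarrow> (\<lambda>n. c (r n) k) \<longlonglongrightarrow> l k" by blast
  have "seq_compact {0..B}" by (simp add: compact_imp_seq_compact)
  then obtain x s where s: "strict_mono s" "((\<lambda>n. c (r n) m) \<circ> s) \<longlonglongrightarrow> x"
    using Suc.prems unfolding seq_compact_def by (metis lessI)
  have "(\<lambda>n. c ((r \<circ> s) n) k) \<longlonglongrightarrow> (l(m := x)) k" if "k < Suc m" for k
  proof (cases "k = m")
    case True then show ?thesis using s by (simp add: o_def)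
  next
    case False
    then have "k < m" using that by simp
    from LIMSEQ_subseq_LIMSEQ[OF r(2)[OF this] s(1)] show ?thesis using False by (simp add: o_def)
  qed
  then show ?case using strict_mono_o[OF r(1) s(1)] by blast
qed

text \<open>Steiner's formula passes from polytopes to compact convex sets. The hull \<open>P n\<close> of a finite \<open>1 / (n + 1)\<close>-net of \<open>K\<close> satisfies
  \<open>P n \<subseteq> K\<close>, and every point is at most \<open>1 / (n + 1)\<close> farther from \<open>P n\<close> than from \<open>K\<close>. The coefficients are nonnegative and their sum
  is a parallel volume at \<open>t = 1\<close>, so they are bounded and a subsequence converges. At \<open>t = 0\<close> both sides are limits from the right.\<close>

theorem steiner_polynomial:
  assumes K: "compactin (top_Rd d) K" "convex_Rd d K" "K \<noteq> {}"
  shows "\<exists>c. (\<forall>k. 0 \<le> c k) \<and> (\<forall>t\<ge>0. parallel_vol d K t = (\<Sum>k\<le>d. c k * t ^ k))"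
proof -
  let ?e = "\<lambda>n::nat. 1 / real (Suc n)"
  have Ksp: "K \<subseteq> space (lborel_Rd d)"
    using compactin_subset_topspace[OF K(1)] unfolding topspace_top_Rd .
  have "\<forall>n. \<exists>A. finite A \<and> A \<subseteq> K \<and> (\<forall>x\<in>K. \<exists>a\<in>A. dist_Rd d x a < ?e n)"
    using finite_net[OF K(1)] by simp
  then obtain A where A0: "\<forall>n. finite (A n) \<and> A n \<subseteq> K \<and> (\<forall>x\<in>K. \<exists>a\<in>A n. dist_Rd d x a < ?e n)"
    by (rule choice[THEN exE])
  have A: "finite (A n)" "A n \<subseteq> K" "\<And>x. x \<in> K \<Longrightarrow> \<exists>a\<in>A n. dist_Rd d x a < ?e n" for n
    using A0 by auto
  have Ane: "A n \<noteq> {}" for n using A(3)[of _ n] K(3) by blast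
  have Asp: "A n \<subseteq> space (lborel_Rd d)" for n using A(2)[of n] Ksp by (rule subset_trans)
  define P where "P n = hull_Rd d (A n)" for n
  have AP: "A n \<subseteq> P n" for n unfolding P_def by (rule hull_Rd_superset[OF A(1) Asp])
  have PK: "P n \<subseteq> K" for n unfolding P_def by (rule hull_Rd_subset[OF A(1,2) K(2) Ksp])
  have Pne: "P n \<noteq> {}" for n using AP Ane by blast
  have cP: "compactin (top_Rd d) (P n)" for n unfolding P_def by (rule compactin_hull_Rd[OF A(1)])
  have KP: "infdist_Rd d x (P n) \<le> infdist_Rd d x K + ?e n" for x n
  proof -
    have "infdist_Rd d x (P n) - ?e n \<le> infdist_Rd d x K"
    proof (rule infdist_Rd_greatest[OF K(3)])
      fix y assume "y \<in> K"
      from A(3)[OF this, of n] obtain a where a: "a \<in> A n" "dist_Rd d y a < ?e n" by blast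
      then have "infdist_Rd d x (P n) \<le> dist_Rd d x a" using AP by (intro infdist_Rd_le) blast
      also have "\<dots> \<le> dist_Rd d x y + dist_Rd d y a" by (rule dist_Rd_triangle)
      finally show "infdist_Rd d x (P n) - ?e n \<le> dist_Rd d x y" using a(2) by linarith
    qed
    then show ?thesis by simp
  qed
  have PK_vol: "parallel_vol d (P n) t \<le> parallel_vol d K t" for n t
    by (rule parallel_vol_mono[OF K(1,3)], rule order_trans[OF infdist_Rd_antimono[OF PK Pne]])
  have KP_vol: "parallel_vol d K t \<le> parallel_vol d (P n) (t + ?e n)" for n t
  proof (rule parallel_vol_mono[OF cP Pne])
    fix x assume "infdist_Rd d x K \<le> t"
    then show "infdist_Rd d x (P n) \<le> t + ?e n" using KP[of x n] by linarith
  qed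
  have "\<forall>n. \<exists>c. (\<forall>k. 0 \<le> c k) \<and> (\<forall>t>0. parallel_vol d (P n) t = (\<Sum>k\<le>d. c k * t ^ k))"
    unfolding P_def using polytope_parallel_vol[OF A(1) Asp Ane] by blast
  then obtain c where c0: "\<forall>n. (\<forall>k. 0 \<le> c n k) \<and> (\<forall>t>0. parallel_vol d (P n) t = (\<Sum>k\<le>d. c n k * t ^ k))"
    by (rule choice[THEN exE])
  have c: "0 \<le> c n k" "\<And>t. t > 0 \<Longrightarrow> parallel_vol d (P n) t = (\<Sum>k\<le>d. c n k * t ^ k)" for n k
    using c0 by auto
  have cB: "c n k \<in> {0..parallel_vol d K 1}" if "k < Suc d" for n k
  proof -
    have "c n k \<le> (\<Sum>k\<le>d. c n k)" using that c(1) by (intro member_le_sum) auto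
    also have "\<dots> = parallel_vol d (P n) 1" using c(2)[of 1 n] by simp
    also have "\<dots> \<le> parallel_vol d K 1" by (rule PK_vol)
    finally show ?thesis using c(1)[of n k] by simp
  qed
  obtain r l where r: "strict_mono r" "\<And>k. k < Suc d \<Longrightarrow> (\<lambda>n. c (r n) k) \<longlonglongrightarrow> l k"
    using bounded_coefficients_subsequence[of "Suc d" c, OF cB] by blast
  define l' where "l' k = (if k \<le> d then l k else 0)" for k
  have l: "(\<lambda>n. c (r n) k) \<longlonglongrightarrow> l' k" if "k \<le> d" for k using r(2)[of k] that by (simp add: l'_def)
  have l0: "0 \<le> l' k" for k
  proof (cases "k \<le> d")
    case True
    then show ?thesis using LIMSEQ_le_const[OF l[OF True]] c(1) by blast
  qed (simp add: l'_def)
  have pos: "parallel_vol d K t = (\<Sum>k\<le>d. l' k * t ^ k)" if t: "t > 0" for t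
  proof (rule antisym)
    have e0: "(\<lambda>n. ?e (r n)) \<longlonglongrightarrow> 0"
      using LIMSEQ_subseq_LIMSEQ[OF LIMSEQ_Suc[OF lim_1_over_n] r(1)] by (simp add: o_def)
    have lim: "(\<lambda>n. \<Sum>k\<le>d. c (r n) k * t ^ k) \<longlonglongrightarrow> (\<Sum>k\<le>d. l' k * t ^ k)"
      by (intro tendsto_sum tendsto_mult l tendsto_const) simp
    have "(\<Sum>k\<le>d. c (r n) k * t ^ k) \<le> parallel_vol d K t" for n
      using PK_vol[of "r n" t] c(2)[OF t, of "r n"] by simp
    then show "(\<Sum>k\<le>d. l' k * t ^ k) \<le> parallel_vol d K t"
      by (intro LIMSEQ_le_const2[OF lim]) blast
    have lim2: "(\<lambda>n. \<Sum>k\<le>d. c (r n) k * (t + ?e (r n)) ^ k) \<longlonglongrightarrow> (\<Sum>k\<le>d. l' k * (t + 0) ^ k)"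
      by (intro tendsto_sum tendsto_mult l tendsto_power tendsto_add e0 tendsto_const) simp
    have "parallel_vol d K t \<le> (\<Sum>k\<le>d. c (r n) k * (t + ?e (r n)) ^ k)" for n
    proof -
      have "t + ?e (r n) > 0" using t by (intro add_pos_pos) simp_all
      then show ?thesis using KP_vol[of t "r n"] c(2)[of "t + ?e (r n)" "r n"] by simp
    qed
    then have "parallel_vol d K t \<le> (\<Sum>k\<le>d. l' k * (t + 0) ^ k)"
      by (intro LIMSEQ_le_const[OF lim2]) blast
    then show "parallel_vol d K t \<le> (\<Sum>k\<le>d. l' k * t ^ k)" by simp
  qed
  have zero: "parallel_vol d K 0 = (\<Sum>k\<le>d. l' k * 0 ^ k)"
  proof -
    let ?D = "\<lambda>n. {x \<in> space (lborel_Rd d). infdist_Rd d x K \<le> ?e n}"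
    have int: "(\<Inter>n. ?D n) = {x \<in> space (lborel_Rd d). infdist_Rd d x K \<le> 0}"
    proof (intro set_eqI iffI)
      fix x assume x: "x \<in> (\<Inter>n. ?D n)"
      then have "infdist_Rd d x K \<le> ?e n" for n by blast
      then have "infdist_Rd d x K \<le> 0"
        by (intro LIMSEQ_le_const[OF LIMSEQ_Suc[OF lim_1_over_n]]) blast
      then show "x \<in> {x \<in> space (lborel_Rd d). infdist_Rd d x K \<le> 0}" using x by blast
    next
      fix x assume "x \<in> {x \<in> space (lborel_Rd d). infdist_Rd d x K \<le> 0}"
      then have "x \<in> space (lborel_Rd d)" "infdist_Rd d x K \<le> ?e n" for n
        by (auto intro: order_trans[of _ 0])
      then show "x \<in> (\<Inter>n. ?D n)" by blast
    qed
    have "(\<lambda>n. measure (lborel_Rd d) (?D n)) \<longlonglongrightarrow> measure (lborel_Rd d) (\<Inter>n. ?D n)"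
    proof (rule Lim_measure_decseq)
      show "range ?D \<subseteq> sets (lborel_Rd d)" using parallel_sets by blast
      show "decseq ?D"
      proof (rule decseq_SucI, rule subsetI)
        fix n x assume x: "x \<in> ?D (Suc n)"
        have "?e (Suc n) \<le> ?e n" by (intro divide_left_mono) auto
        with x show "x \<in> ?D n" by (blast intro: order_trans)
      qed
      show "emeasure (lborel_Rd d) (?D n) \<noteq> \<infinity>" for n
        using fmeasurableD2[OF parallel_fmeasurable[OF K(1,3)]] by simp
    qed
    then have "(\<lambda>n. parallel_vol d K (?e n)) \<longlonglongrightarrow> parallel_vol d K 0"
      unfolding int parallel_vol_def .
    moreover have "(\<lambda>n. \<Sum>k\<le>d. l' k * ?e n ^ k) \<longlonglongrightarrow> (\<Sum>k\<le>d. l' k * 0 ^ k)"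
      by (intro tendsto_sum tendsto_mult tendsto_power LIMSEQ_Suc[OF lim_1_over_n] tendsto_const)
    moreover have "parallel_vol d K (?e n) = (\<Sum>k\<le>d. l' k * ?e n ^ k)" for n by (rule pos) simp
    ultimately show ?thesis by (simp only: LIMSEQ_unique)
  qed
  have "parallel_vol d K t = (\<Sum>k\<le>d. l' k * t ^ k)" if "t \<ge> 0" for t
    using pos[of t] zero that by (cases "t = 0") auto
  then show ?thesis using l0 by blast
qed

section \<open>Consequences of log-concavity for the Steiner coefficients\<close>

lemma parallel_vol_eq:
  assumes "compactin (top_Rd d) K" "K \<noteq> {}"
  shows "emeasure (lborel_Rd d) {x \<in> space (lborel_Rd d). infdist_Rd d x K \<le> t} = ennreal (parallel_vol d K t)"
  using fmeasurableD2[OF parallel_fmeasurable[OF assms, of t]]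
  unfolding parallel_vol_def by (intro emeasure_eq_measure2[OF parallel_fmeasurable[OF assms, of t]])

lemma parallel_vol_pos:
  assumes K: "compactin (top_Rd d) K" "K \<noteq> {}" and t: "t > 0"
  shows "parallel_vol d K t > 0"
proof -
  obtain y where y: "y \<in> K" using K by blast
  define e where "e = t / (d + 1)"
  have e: "e > 0" using t by (simp add: e_def)
  let ?B = "PiE {..<d} (\<lambda>i. {y i - e..y i + e})"
  have "?B \<subseteq> {x \<in> space (lborel_Rd d). infdist_Rd d x K \<le> t}"
  proof
    fix x assume x: "x \<in> ?B"
    have "infdist_Rd d x K \<le> dist_Rd d x y" by (rule infdist_Rd_le[OF y])
    also have "\<dots> \<le> (\<Sum>i<d. \<bar>x i - y i\<bar>)" by (rule dist_Rd_le_sum)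
    also have "\<dots> \<le> (\<Sum>i<d. e)"
    proof (rule sum_mono)
      fix i assume "i \<in> {..<d}"
      then have "x i \<in> {y i - e..y i + e}" using x by (rule PiE_mem[rotated])
      then show "\<bar>x i - y i\<bar> \<le> e" by (simp add: abs_le_iff)
    qed
    also have "\<dots> \<le> t" using t by (simp add: e_def field_simps)
    finally have "infdist_Rd d x K \<le> t" .
    moreover have "x \<in> space (lborel_Rd d)" using x unfolding space_Rd by (auto simp: PiE_iff)
    ultimately show "x \<in> {x \<in> space (lborel_Rd d). infdist_Rd d x K \<le> t}" by blast
  qed
  then have "emeasure (lborel_Rd d) ?B \<le> ennreal (parallel_vol d K t)"
    unfolding parallel_vol_eq[OF K, symmetric] by (rule emeasure_mono[OF _ parallel_sets])
  also have "emeasure (lborel_Rd d) ?B = (\<Prod>i<d. ennreal (2 * e))"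
    using e by (subst emeasure_Rd_box) (auto intro!: prod.cong simp: emeasure_lborel_Icc_eq)
  also have "\<dots> = ennreal ((2 * e) ^ d)" using e by (simp add: ennreal_power)
  finally have "ennreal ((2 * e) ^ d) \<le> ennreal (parallel_vol d K t)" .
  then have "(2 * e) ^ d \<le> parallel_vol d K t"
    by (subst (asm) ennreal_le_iff) (simp_all add: parallel_vol_def)
  moreover have "0 < (2 * e) ^ d" using e by simp
  ultimately show ?thesis by linarith
qed

text \<open>The set is \<open>a K + a s B\<close>, up to a translation, where \<open>B\<close> is the unit ball. The translation \<open>z\<close> is needed for homotheties with
  a centre in \<open>K\<close>.\<close>

lemma emeasure_scaled_parallel:
  assumes K: "compactin (top_Rd d) K" "K \<noteq> {}" and a: "a > 0"
  shows "emeasure (lborel_Rd d) {x \<in> space (lborel_Rd d). infdist_Rd d (\<lambda>i. x i / a + z i) K \<le> s}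
       = ennreal (a ^ d * parallel_vol d K s)"
proof -
  have D: "vol_factor d (\<lambda>x. \<lambda>i\<in>{..<d}. (1 / a) * x i) (\<Prod>i<d. 1 / (1 / a))"
    using a by (intro vol_factor_diag) simp
  have "vol_factor d (\<lambda>x. \<lambda>i\<in>{..<d}. (\<lambda>i\<in>{..<d}. (1 / a) * x i) i + z i) (1 * (\<Prod>i<d. 1 / (1 / a)))"
    by (rule vol_factor_compose[OF vol_factor_translation D])
  then have vf: "vol_factor d (\<lambda>x. \<lambda>i\<in>{..<d}. (\<lambda>i\<in>{..<d}. (1 / a) * x i) i + z i) (a ^ d)"
    by (simp only: mult_1_left) simp
  let ?S = "{x \<in> space (lborel_Rd d). infdist_Rd d x K \<le> s}"
  have "{x \<in> space (lborel_Rd d). infdist_Rd d (\<lambda>i. x i / a + z i) K \<le> s}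
      = {x \<in> space (lborel_Rd d). (\<lambda>i\<in>{..<d}. (\<lambda>i\<in>{..<d}. (1 / a) * x i) i + z i) \<in> ?S}"
  proof (intro Collect_cong conj_cong refl)
    fix x :: "nat \<Rightarrow> real"
    have "infdist_Rd d (\<lambda>i\<in>{..<d}. (\<lambda>i\<in>{..<d}. (1 / a) * x i) i + z i) K = infdist_Rd d (\<lambda>i. x i / a + z i) K"
      by (rule infdist_Rd_cong) simp
    then show "(infdist_Rd d (\<lambda>i. x i / a + z i) K \<le> s)
        = ((\<lambda>i\<in>{..<d}. (\<lambda>i\<in>{..<d}. (1 / a) * x i) i + z i) \<in> ?S)" by simp
  qed
  also have "emeasure (lborel_Rd d) \<dots> = ennreal (a ^ d) * emeasure (lborel_Rd d) ?S"
    using vf parallel_sets unfolding vol_factor_def by blast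
  also have "\<dots> = ennreal (a ^ d * parallel_vol d K s)"
    unfolding parallel_vol_eq[OF K] using a by (simp add: ennreal_mult parallel_vol_def)
  finally show ?thesis .
qed

text \<open>The product \<open>a ^ d * parallel_vol d K (t / a)\<close> is the volume of \<open>a K + t B\<close>, and the midpoint of
  \<open>a K + t B\<close> and \<open>b K + t B\<close> lies in \<open>(a + b) / 2 K + t B\<close> by convexity. The
  Prekopa-Leindler inequality for the three indicators gives log-concavity in \<open>a\<close>.\<close>

lemma parallel_vol_log_concave:
  assumes K: "compactin (top_Rd d) K" "convex_Rd d K" "K \<noteq> {}" and a: "a > 0" "b > 0" and t: "t \<ge> 0"
  shows "(a ^ d * parallel_vol d K (t / a)) * (b ^ d * parallel_vol d K (t / b))
     \<le> (((a + b) / 2) ^ d * parallel_vol d K (t / ((a + b) / 2)))\<^sup>2"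
proof -
  let ?M = "lborel_Rd d"
  define S where "S r = {x \<in> space ?M. infdist_Rd d (\<lambda>i. x i / r + 0) K \<le> t / r}" for r
  have S: "emeasure ?M (S r) = ennreal (r ^ d * parallel_vol d K (t / r))" if "r > 0" for r
    unfolding S_def by (rule emeasure_scaled_parallel[OF K(1,3) that])
  have m: "S r \<in> sets ?M" if "r > 0" for r
  proof -
    have "(\<lambda>x. infdist_Rd d (\<lambda>i. x i / r + 0) K) \<in> borel_measurable ?M"
    proof -
      have "(\<lambda>x. \<lambda>i\<in>{..<d}. x i / r + 0) \<in> measurable ?M ?M"
        by (intro Rd_measurableI borel_measurable_add borel_measurable_divide coord_measurable) auto
      from measurable_compose[OF this infdist_Rd_measurable[of d K]] show ?thesis by simp
    qed
    then show ?thesis unfolding S_def by measurable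
  qed
  define c where "c = (a + b) / 2"
  have c: "c > 0" using a by (simp add: c_def)
  have mid: "(\<lambda>i\<in>{..<d}. (x i + y i) / 2) \<in> S c" if xy: "x \<in> S a" "y \<in> S b" for x y
  proof -
    let ?u = "a / (a + b)" and ?v = "b / (a + b)"
    have uv: "?u \<ge> 0" "?v \<ge> 0" "?u + ?v = 1" using a by (auto simp: add_divide_distrib[symmetric])
    have "infdist_Rd d (\<lambda>i. (\<lambda>i\<in>{..<d}. (x i + y i) / 2) i / c + 0) K
        = infdist_Rd d (\<lambda>i. ?u * (x i / a + 0) + ?v * (y i / b + 0)) K"
      using a by (intro infdist_Rd_cong) (simp add: c_def add_divide_distrib)
    also have "\<dots> \<le> ?u * infdist_Rd d (\<lambda>i. x i / a + 0) K + ?v * infdist_Rd d (\<lambda>i. y i / b + 0) K"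
      by (rule infdist_Rd_convex[OF K(2,3) uv])
    also have "\<dots> \<le> ?u * (t / a) + ?v * (t / b)"
      using xy uv unfolding S_def by (intro add_mono mult_left_mono) blast+
    also have "\<dots> = t / c" using a by (simp add: c_def add_divide_distrib[symmetric])
    finally show ?thesis unfolding S_def by simp
  qed
  have "(\<integral>\<^sup>+x. indicator (S a) x \<partial>?M) * (\<integral>\<^sup>+x. indicator (S b) x \<partial>?M) \<le> (\<integral>\<^sup>+x. indicator (S c) x \<partial>?M)\<^sup>2"
  proof (rule prekopa_leindler_Rd)
    fix x y
    show "indicator (S a) x * indicator (S b) y \<le> (indicator (S c) (\<lambda>i\<in>{..<d}. (x i + y i) / 2) :: ennreal)\<^sup>2"
      using mid[of x y] by (simp add: indicator_def)
  qed (use m a c in \<open>auto intro: borel_measurable_indicator\<close>)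
  then have "emeasure ?M (S a) * emeasure ?M (S b) \<le> (emeasure ?M (S c))\<^sup>2"
    using m a c by (simp add: nn_integral_indicator)
  then have "ennreal ((a ^ d * parallel_vol d K (t / a)) * (b ^ d * parallel_vol d K (t / b)))
      \<le> ennreal ((c ^ d * parallel_vol d K (t / c))\<^sup>2)"
    unfolding S[OF a(1)] S[OF a(2)] S[OF c] using a c
    by (simp add: ennreal_mult[symmetric] ennreal_power parallel_vol_def)
  then show ?thesis unfolding c_def
    by (subst (asm) ennreal_le_iff) simp_all
qed

lemma second_derivative_nonpos_at_max:
  fixes f :: "real \<Rightarrow> real"
  assumes f: "\<And>x. DERIV f x :> f' x" and f': "f' 0 = 0" "DERIV f' 0 :> L"
    and max: "\<And>h. 0 < h \<Longrightarrow> h < 1 \<Longrightarrow> f h \<le> f 0"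
  shows "L \<le> 0"
proof (rule ccontr)
  assume "\<not> L \<le> 0"
  then obtain e where e: "e > 0" "\<And>h. 0 < h \<Longrightarrow> h < e \<Longrightarrow> f' 0 < f' (0 + h)"
    using DERIV_pos_inc_right[OF f'(2)] by auto
  define h where "h = min (e / 2) (1 / 2)"
  have h: "0 < h" "h < 1" "h < e" using e(1) by (auto simp: h_def min_def)
  obtain z where z: "0 < z" "z < h" "f h - f 0 = (h - 0) * f' z"
    using MVT2[OF h(1), of f f'] f by blast
  have "f' z > 0" using e(2)[of z] z h f'(1) by simp
  then have "h * f' z > 0" using h by simp
  then have "f h > f 0" using z by simp
  then show False using max[OF h(1,2)] by simp
qed

text \<open>By Steiner's formula the parallel volumes are given by coefficients \<open>c\<close>. For fixed \<open>t\<close>, normalising the terms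
  \<open>c k * t ^ k\<close> gives a probability distribution of the index \<open>k\<close>, for which the next two lemmas are moment bounds.\<close>

locale steiner_body =
  fixes d :: nat and K :: "(nat \<Rightarrow> real) set" and c :: "nat \<Rightarrow> real"
  assumes K: "compactin (top_Rd d) K" "convex_Rd d K" "K \<noteq> {}"
    and V: "\<And>t. t \<ge> 0 \<Longrightarrow> parallel_vol d K t = (\<Sum>k\<le>d. c k * t ^ k)"
begin

text \<open>With \<open>j = d - k\<close> as random index, this says \<open>E[j (j - 1)] \<le> (E j)\<^sup>2\<close>, or \<open>Var j \<le> E j\<close>. The function
  \<open>\<psi> a = (\<Sum>k\<le>d. c k * t ^ k * a ^ (d - k))\<close> is the volume of \<open>a K + t B\<close>, and the inequality is \<open>\<psi>'' \<psi> \<le> \<psi>'\<^sup>2\<close>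
  at \<open>a = 1\<close>, which follows from midpoint log-concavity.\<close>

lemma steiner_variance_le:
  assumes t: "t > 0"
  shows "(\<Sum>k\<le>d. real (d - k) * real (d - k - 1) * (c k * t ^ k)) * (\<Sum>k\<le>d. c k * t ^ k)
     \<le> (\<Sum>k\<le>d. real (d - k) * (c k * t ^ k))\<^sup>2"
proof -
  define g where "g k = c k * t ^ k" for k
  define \<psi> where "\<psi> a = (\<Sum>k\<le>d. g k * a ^ (d - k))" for a :: real
  define \<psi>1 where "\<psi>1 a = (\<Sum>k\<le>d. g k * (real (d - k) * a ^ (d - k - 1)))" for a :: real
  define \<psi>2 where "\<psi>2 a = (\<Sum>k\<le>d. g k * (real (d - k) * (real (d - k - 1) * a ^ (d - k - 1 - 1))))" for a :: real
  have d1: "DERIV \<psi> a :> \<psi>1 a" for a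
    unfolding \<psi>_def \<psi>1_def by (auto intro!: derivative_eq_intros sum.cong)
  have d2: "DERIV \<psi>1 a :> \<psi>2 a" for a
    unfolding \<psi>1_def \<psi>2_def by (auto intro!: derivative_eq_intros sum.cong)
  have vol: "a ^ d * parallel_vol d K (t / a) = \<psi> a" if a: "a > 0" for a
  proof -
    have "a ^ d * (c k * (t / a) ^ k) = g k * a ^ (d - k)" if "k \<le> d" for k
      using that a by (simp add: g_def power_divide power_diff)
    then show ?thesis
      using V[of "t / a"] t a by (simp add: \<psi>_def sum_distrib_left)
  qed
  define f where "f h = \<psi> (1 + h) * \<psi> (1 - h)" for h
  define f1 where "f1 h = \<psi>1 (1 + h) * \<psi> (1 - h) - \<psi> (1 + h) * \<psi>1 (1 - h)" for h
  have df: "DERIV f h :> f1 h" for h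
  proof -
    have "DERIV (\<lambda>h. \<psi> (1 + h)) h :> \<psi>1 (1 + h) * 1"
      by (rule DERIV_chain2[OF d1]) (auto intro!: derivative_eq_intros)
    moreover have "DERIV (\<lambda>h. \<psi> (1 - h)) h :> \<psi>1 (1 - h) * (-1)"
      by (rule DERIV_chain2[OF d1]) (auto intro!: derivative_eq_intros)
    ultimately have "DERIV (\<lambda>h. \<psi> (1 + h) * \<psi> (1 - h)) h :> \<psi>1 (1 + h) * 1 * \<psi> (1 - h) + \<psi>1 (1 - h) * (-1) * \<psi> (1 + h)"
      by (rule DERIV_mult)
    then show ?thesis unfolding f_def f1_def by (simp add: mult.commute)
  qed
  have df1: "DERIV f1 0 :> 2 * (\<psi>2 1 * \<psi> 1 - (\<psi>1 1)\<^sup>2)"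
  proof -
    have a: "DERIV (\<lambda>h. \<psi> (1 + h)) 0 :> \<psi>1 (1 + 0) * 1" "DERIV (\<lambda>h. \<psi> (1 - h)) 0 :> \<psi>1 (1 - 0) * (-1)"
      by (rule DERIV_chain2[OF d1]; auto intro!: derivative_eq_intros)+
    have b: "DERIV (\<lambda>h. \<psi>1 (1 + h)) 0 :> \<psi>2 (1 + 0) * 1" "DERIV (\<lambda>h. \<psi>1 (1 - h)) 0 :> \<psi>2 (1 - 0) * (-1)"
      by (rule DERIV_chain2[OF d2]; auto intro!: derivative_eq_intros)+
    have "DERIV f1 0 :> (\<psi>2 (1 + 0) * 1 * \<psi> (1 - 0) + \<psi>1 (1 - 0) * (-1) * \<psi>1 (1 + 0))
       - (\<psi>1 (1 + 0) * 1 * \<psi>1 (1 - 0) + \<psi>2 (1 - 0) * (-1) * \<psi> (1 + 0))"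
      unfolding f1_def by (intro DERIV_diff DERIV_mult a b)
    then show ?thesis by (simp add: power2_eq_square algebra_simps)
  qed
  have "2 * (\<psi>2 1 * \<psi> 1 - (\<psi>1 1)\<^sup>2) \<le> 0"
  proof (rule second_derivative_nonpos_at_max[OF df _ df1])
    show "f1 0 = 0" by (simp add: f1_def)
    fix h :: real assume h: "0 < h" "h < 1"
    have "f h \<le> (\<psi> ((1 + h + (1 - h)) / 2))\<^sup>2"
    proof -
      have *: "1 + h > 0" "1 - h > 0" "(1 + h + (1 - h)) / 2 > 0" using h by simp_all
      show ?thesis
        unfolding f_def vol[OF *(1), symmetric] vol[OF *(2), symmetric] vol[OF *(3), symmetric]
        by (rule parallel_vol_log_concave[OF K *(1,2)]) (use t in simp)
    qed
    then show "f h \<le> f 0" by (simp add: f_def power2_eq_square)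
  qed
  then show ?thesis
    by (simp add: \<psi>_def \<psi>1_def \<psi>2_def g_def power2_eq_square mult_ac)
qed

text \<open>This bounds the mean of \<open>k\<close> below by \<open>d * t / (R + t)\<close>. The homothety with factor \<open>1 + e\<close> and centre \<open>y0 \<in> K\<close> moves
  each point of the parallel body \<open>K + t B\<close> by at most \<open>e * (R + t)\<close>, so
  \<open>(1 + e) ^ d\<close> times the volume of \<open>K + t B\<close> is at most that of \<open>K + (t + e * (R + t)) B\<close>. Differentiate at \<open>e = 0\<close>.\<close>

lemma steiner_degree_ge:
  assumes t: "t > 0" and R: "\<And>x y. x \<in> K \<Longrightarrow> y \<in> K \<Longrightarrow> dist_Rd d x y \<le> R"
  shows "real d * t * (\<Sum>k\<le>d. c k * t ^ k) \<le> (R + t) * (\<Sum>k\<le>d. real k * (c k * t ^ k))"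
proof -
  obtain y0 where y0: "y0 \<in> K" using K by blast
  have R0: "R \<ge> 0" using R[OF y0 y0] by simp
  define P where "P s = (\<Sum>k\<le>d. c k * s ^ k)" for s
  define P1 where "P1 s = (\<Sum>k\<le>d. c k * (real k * s ^ (k - 1)))" for s
  have dP: "DERIV P s :> P1 s" for s
    unfolding P_def P1_def by (auto intro!: derivative_eq_intros sum.cong)
  have incl: "(1 + e) ^ d * P t \<le> P (t + e * (R + t))" if e: "e > 0" for e
  proof -
    define z where "z = (\<lambda>i. e / (1 + e) * y0 i)"
    have "{x \<in> space (lborel_Rd d). infdist_Rd d (\<lambda>i. x i / (1 + e) + z i) K \<le> t}
        \<subseteq> {x \<in> space (lborel_Rd d). infdist_Rd d x K \<le> t + e * (R + t)}"
    proof
      fix x assume x: "x \<in> {x \<in> space (lborel_Rd d). infdist_Rd d (\<lambda>i. x i / (1 + e) + z i) K \<le> t}"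
      define x' where "x' = (\<lambda>i. x i / (1 + e) + z i)"
      have x't: "infdist_Rd d x' K \<le> t" using x by (simp add: x'_def)
      have "dist_Rd d x' y0 - R \<le> infdist_Rd d x' K"
      proof (rule infdist_Rd_greatest[OF K(3)])
        fix y assume "y \<in> K"
        then show "dist_Rd d x' y0 - R \<le> dist_Rd d x' y"
          using dist_Rd_triangle[of d x' y0 y] R[OF _ y0, of y] by linarith
      qed
      then have "dist_Rd d x' y0 \<le> R + t" using x't by linarith
      moreover have "dist_Rd d x x' = e * dist_Rd d x' y0"
      proof -
        have "x i - x' i = e * (x' i - y0 i)" for i
        proof -
          have "(1 + e) * x' i = x i + e * y0 i"
            using e by (simp add: x'_def z_def distrib_left)
          then show ?thesis by (simp add: algebra_simps)
        qed
        then have "dist_Rd d x x' = L2_set (\<lambda>i. e * (x' i - y0 i)) {..<d}" by (simp add: dist_Rd_def)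
        also have "\<dots> = e * L2_set (\<lambda>i. x' i - y0 i) {..<d}"
          using e by (simp only: L2_set_right_distrib[symmetric] less_imp_le)
        finally show ?thesis by (simp add: dist_Rd_def)
      qed
      ultimately have "dist_Rd d x x' \<le> e * (R + t)" using e by simp
      then have "infdist_Rd d x K \<le> t + e * (R + t)"
        using infdist_Rd_lipschitz[of d x K x'] x't by linarith
      then show "x \<in> {x \<in> space (lborel_Rd d). infdist_Rd d x K \<le> t + e * (R + t)}" using x by blast
    qed
    then have "emeasure (lborel_Rd d) {x \<in> space (lborel_Rd d). infdist_Rd d (\<lambda>i. x i / (1 + e) + z i) K \<le> t}
        \<le> emeasure (lborel_Rd d) {x \<in> space (lborel_Rd d). infdist_Rd d x K \<le> t + e * (R + t)}"
      by (rule emeasure_mono[OF _ parallel_sets])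
    moreover have "1 + e > 0" using e by simp
    ultimately have "ennreal ((1 + e) ^ d * parallel_vol d K t) \<le> ennreal (parallel_vol d K (t + e * (R + t)))"
      by (simp only: emeasure_scaled_parallel[OF K(1,3)] parallel_vol_eq[OF K(1,3)])
    then have "(1 + e) ^ d * parallel_vol d K t \<le> parallel_vol d K (t + e * (R + t))"
      by (subst (asm) ennreal_le_iff) (simp_all add: parallel_vol_def)
    moreover have "t + e * (R + t) \<ge> 0" using t e R0 by simp
    ultimately show ?thesis using t by (simp add: V P_def)
  qed
  define G where "G e = P (t + e * (R + t)) - (1 + e) ^ d * P t" for e
  have dG: "DERIV G 0 :> P1 t * (R + t) - real d * P t"
  proof -
    have "DERIV (\<lambda>e. P (t + e * (R + t))) 0 :> P1 (t + 0 * (R + t)) * (R + t)"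
      by (rule DERIV_chain2[OF dP]) (auto intro!: derivative_eq_intros)
    moreover have "DERIV (\<lambda>e. (1 + e) ^ d * P t) 0 :> real d * (1 + 0) ^ (d - 1) * P t"
      by (auto intro!: derivative_eq_intros)
    ultimately have "DERIV G 0 :> P1 (t + 0 * (R + t)) * (R + t) - real d * (1 + 0) ^ (d - 1) * P t"
      unfolding G_def by (rule DERIV_diff)
    then show ?thesis by simp
  qed
  have "real d * P t \<le> (R + t) * P1 t"
  proof (rule ccontr)
    assume "\<not> real d * P t \<le> (R + t) * P1 t"
    then have "P1 t * (R + t) - real d * P t < 0" by (simp add: mult.commute)
    then obtain e where e: "e > 0" "\<And>h. 0 < h \<Longrightarrow> h < e \<Longrightarrow> G (0 + h) < G 0"
      using DERIV_neg_dec_right[OF dG] by auto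
    have "G (e / 2) < G 0" using e(2)[of "e / 2"] e(1) by simp
    moreover have "G 0 = 0" by (simp add: G_def)
    moreover have "G (e / 2) \<ge> 0" using incl[of "e / 2"] e(1) by (simp add: G_def)
    ultimately show False by simp
  qed
  then have "real d * P t * t \<le> (R + t) * P1 t * t" using t by (intro mult_right_mono) auto
  moreover have "P1 t * t = (\<Sum>k\<le>d. real k * (c k * t ^ k))"
  proof -
    have "c k * (real k * t ^ (k - 1)) * t = real k * (c k * t ^ k)" for k
      by (cases k) auto
    then show ?thesis unfolding P1_def sum_distrib_right by (intro sum.cong refl)
  qed
  ultimately have "real d * P t * t \<le> (R + t) * (\<Sum>k\<le>d. real k * (c k * t ^ k))"
    by (simp only: mult.assoc)
  then show ?thesis unfolding P_def[symmetric] by (simp only: mult.commute[of t] mult.assoc mult.left_commute[of t])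
qed

end

section \<open>Calculus of the volume profile\<close>

text \<open>From here on only the coefficients matter. For the body, \<open>b k = c k / pi ^ (k / 2)\<close> and \<open>\<rho> = R * sqrt pi\<close> with \<open>R\<close> the diameter,
  so that \<open>v u\<close> is the volume of the set where \<open>pi\<close> times the squared distance is at most \<open>u\<close>.\<close>

locale steiner_profile =
  fixes d :: nat and b :: "nat \<Rightarrow> real" and \<rho> :: real
  assumes b0: "\<And>k. b k \<ge> 0" and bpos: "(\<Sum>k\<le>d. b k) > 0" and \<rho>0: "\<rho> \<ge> 0"
    and var_le: "\<And>s. s > 0 \<Longrightarrow> (\<Sum>k\<le>d. real (d - k) * real (d - k - 1) * (b k * s ^ k)) * (\<Sum>k\<le>d. b k * s ^ k)
           \<le> (\<Sum>k\<le>d. real (d - k) * (b k * s ^ k))\<^sup>2"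
    and deg_ge: "\<And>s. s > 0 \<Longrightarrow> real d * s * (\<Sum>k\<le>d. b k * s ^ k) \<le> (\<rho> + s) * (\<Sum>k\<le>d. real k * (b k * s ^ k))"
begin

text \<open>With \<open>\<theta> = u d/du\<close>, the functions \<open>v1\<close> and \<open>v2\<close> are \<open>\<theta> v\<close> and \<open>\<theta> (\<theta> v)\<close>, and \<open>M\<close> is the logarithmic derivative
  \<open>\<theta> v / v\<close>, the mean of \<open>k / 2\<close> for weights \<open>b k * sqrt u ^ k\<close>. The constant \<open>W\<close> is the integral of \<open>v u * exp (- u)\<close> over \<open>u > 0\<close>.\<close>

definition v :: "real \<Rightarrow> real" where "v u = (\<Sum>k\<le>d. b k * sqrt u ^ k)"
definition v1 :: "real \<Rightarrow> real" where "v1 u = (\<Sum>k\<le>d. real k / 2 * (b k * sqrt u ^ k))"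
definition v2 :: "real \<Rightarrow> real" where "v2 u = (\<Sum>k\<le>d. (real k / 2)\<^sup>2 * (b k * sqrt u ^ k))"
definition M :: "real \<Rightarrow> real" where "M u = v1 u / v u"
definition W :: real where "W = (\<Sum>k\<le>d. b k * Gamma (real k / 2 + 1))"
abbreviation (input) D :: real where "D \<equiv> real d"



lemma v_pos: "u > 0 \<Longrightarrow> v u > 0"
proof -
  assume u: "u > 0"
  have "\<exists>k\<le>d. b k \<noteq> 0"
  proof (rule ccontr)
    assume "\<not> ?thesis"
    then have "(\<Sum>k\<le>d. b k) = 0" by (intro sum.neutral) auto
    with bpos show False by simp
  qed
  then obtain k where k: "k \<le> d" "b k > 0" using b0 by (auto simp: less_le)
  have "0 < b k * sqrt u ^ k" using k u by simp
  also have "\<dots> \<le> v u" unfolding v_def using k b0 u by (intro member_le_sum) auto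
  finally show ?thesis .
qed

lemma v_nonneg: "u \<ge> 0 \<Longrightarrow> v u \<ge> 0"
  unfolding v_def using b0 by (intro sum_nonneg) auto

lemma v_mono: "0 \<le> x \<Longrightarrow> x \<le> y \<Longrightarrow> v x \<le> v y"
  unfolding v_def using b0 by (intro sum_mono mult_left_mono power_mono) auto

lemma v1_nonneg: "u \<ge> 0 \<Longrightarrow> v1 u \<ge> 0"
  unfolding v1_def using b0 by (intro sum_nonneg) auto

lemma v1_le: "u \<ge> 0 \<Longrightarrow> v1 u \<le> D / 2 * v u"
  unfolding v1_def v_def sum_distrib_left using b0 by (intro sum_mono mult_right_mono) auto

lemma M_nonneg: "u \<ge> 0 \<Longrightarrow> M u \<ge> 0"
  unfolding M_def using v_nonneg v1_nonneg by simp

lemma M_le: "u \<ge> 0 \<Longrightarrow> M u \<le> D / 2"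
  unfolding M_def using v1_le[of u] v_nonneg[of u]
  by (cases "v u = 0") (auto simp: divide_le_eq less_le)

lemma DERIV_sqrt_power:
  assumes u: "u > 0"
  shows "((\<lambda>u. sqrt u ^ k) has_real_derivative (real k / 2 * sqrt u ^ k) / u) (at u)"
proof -
  have "((\<lambda>u. sqrt u ^ k) has_real_derivative real k * sqrt u ^ (k - 1) * (inverse (sqrt u) / 2)) (at u)"
    using DERIV_power[OF DERIV_real_sqrt[OF u], of k] by (simp add: mult_ac)
  moreover have "real k * sqrt u ^ (k - 1) * (inverse (sqrt u) / 2) = (real k / 2 * sqrt u ^ k) / u"
  proof (cases k)
    case (Suc n)
    have "sqrt u * sqrt u = u" using u by simp
    then have "sqrt u / u = inverse (sqrt u)" using u by (simp add: field_simps)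
    then have "real k / 2 * sqrt u ^ n * (sqrt u / u) = real k / 2 * sqrt u ^ n * inverse (sqrt u)" by (simp only:)
    then show ?thesis unfolding Suc by (simp add: mult_ac)
  qed simp
  ultimately show ?thesis by (rule DERIV_cong)
qed

lemma DERIV_v: "u > 0 \<Longrightarrow> (v has_real_derivative v1 u / u) (at u)"
  unfolding v_def v1_def sum_divide_distrib
  by (intro DERIV_sum) (auto intro!: derivative_eq_intros DERIV_cmult[OF DERIV_sqrt_power, THEN DERIV_cong])

lemma DERIV_v1: "u > 0 \<Longrightarrow> (v1 has_real_derivative v2 u / u) (at u)"
  unfolding v1_def v2_def sum_divide_distrib
proof (rule DERIV_sum)
  fix k assume u: "u > 0"
  show "((\<lambda>u. real k / 2 * (b k * sqrt u ^ k)) has_real_derivative (real k / 2)\<^sup>2 * (b k * sqrt u ^ k) / u) (at u)"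
    using DERIV_cmult[OF DERIV_cmult[OF DERIV_sqrt_power[OF u, of k], of "b k"], of "real k / 2"]
    by (rule DERIV_cong) (simp add: power2_eq_square)
qed

lemma DERIV_M: "u > 0 \<Longrightarrow> (M has_real_derivative (v2 u * v u - (v1 u)\<^sup>2) / (u * (v u)\<^sup>2)) (at u)"
proof -
  assume u: "u > 0"
  have "(M has_real_derivative (v2 u / u * v u - v1 u * (v1 u / u)) / (v u * v u)) (at u)"
    unfolding M_def using v_pos[OF u] by (intro DERIV_divide DERIV_v DERIV_v1 u) simp
  moreover have "(v2 u / u * v u - v1 u * (v1 u / u)) / (v u * v u) = (v2 u * v u - (v1 u)\<^sup>2) / (u * (v u)\<^sup>2)"
    using u v_pos[OF u] by (simp add: field_simps power2_eq_square)
  ultimately show ?thesis by simp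
qed

lemma v1_sq_le: "u \<ge> 0 \<Longrightarrow> (v1 u)\<^sup>2 \<le> v2 u * v u"
proof -
  assume u: "u \<ge> 0"
  let ?g = "\<lambda>k. b k * sqrt u ^ k"
  have g: "?g k \<ge> 0" for k using b0 u by simp
  have "(\<Sum>k\<le>d. (real k / 2 * sqrt (?g k)) * sqrt (?g k))\<^sup>2
     \<le> (\<Sum>k\<le>d. (real k / 2 * sqrt (?g k))\<^sup>2) * (\<Sum>k\<le>d. (sqrt (?g k))\<^sup>2)"
    by (rule Cauchy_Schwarz_ineq_sum)
  moreover have "(\<Sum>k\<le>d. (real k / 2 * sqrt (?g k)) * sqrt (?g k)) = v1 u"
    unfolding v1_def using g by (intro sum.cong refl) (simp only: mult.assoc real_sqrt_mult_self abs_of_nonneg)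
  moreover have "(\<Sum>k\<le>d. (real k / 2 * sqrt (?g k))\<^sup>2) = v2 u"
    unfolding v2_def using g by (intro sum.cong refl) (simp only: power_mult_distrib real_sqrt_pow2)
  moreover have "(\<Sum>k\<le>d. (sqrt (?g k))\<^sup>2) = v u"
    unfolding v_def using g by (intro sum.cong refl) (simp only: real_sqrt_pow2)
  ultimately show ?thesis by (simp only:)
qed

text \<open>The variance bound \<open>var_le\<close>, rewritten for \<open>k / 2 = d / 2 - j / 2\<close>.\<close>

lemma v2_le: "u > 0 \<Longrightarrow> v2 u * v u - (v1 u)\<^sup>2 \<le> v u * (D / 2 * v u - v1 u) / 2"
proof -
  assume u: "u > 0"
  let ?g = "\<lambda>k. b k * sqrt u ^ k"
  define J1 where "J1 = (\<Sum>k\<le>d. real (d - k) * ?g k)"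
  define J2 where "J2 = (\<Sum>k\<le>d. (real (d - k))\<^sup>2 * ?g k)"
  have 1: "v1 u = D / 2 * v u - J1 / 2"
    unfolding v1_def v_def J1_def sum_distrib_left sum_divide_distrib sum_subtractf[symmetric]
    by (intro sum.cong refl) (simp add: of_nat_diff algebra_simps add_divide_distrib diff_divide_distrib)
  have 2: "v2 u = (D / 2)\<^sup>2 * v u - D / 2 * J1 + J2 / 4"
    unfolding v2_def v_def J1_def J2_def sum_distrib_left sum_divide_distrib sum_subtractf[symmetric] sum.distrib[symmetric]
    by (intro sum.cong refl) (simp add: of_nat_diff power2_eq_square algebra_simps add_divide_distrib diff_divide_distrib)
  have "(\<Sum>k\<le>d. real (d - k) * real (d - k - 1) * ?g k) = J2 - J1"
    unfolding J1_def J2_def sum_subtractf[symmetric]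
  proof (intro sum.cong refl)
    fix k
    show "real (d - k) * real (d - k - 1) * ?g k = (real (d - k))\<^sup>2 * ?g k - real (d - k) * ?g k"
      by (cases "d - k") (simp_all add: power2_eq_square algebra_simps)
  qed
  then have "(J2 - J1) * v u \<le> J1\<^sup>2"
    using var_le[of "sqrt u"] u unfolding v_def J1_def by simp
  then show ?thesis
    unfolding 1 2 by (simp add: power2_eq_square algebra_simps)
qed

lemma M_mono: "0 < x \<Longrightarrow> x \<le> y \<Longrightarrow> M x \<le> M y"
proof (rule DERIV_nonneg_imp_nondecreasing[of x y M])
  fix z assume "0 < x" "x \<le> z"
  then have z: "z > 0" by simp
  have "(v2 z * v z - (v1 z)\<^sup>2) / (z * (v z)\<^sup>2) \<ge> 0"
    using v1_sq_le[of z] z by simp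
  with DERIV_M[OF z] show "\<exists>y. (M has_real_derivative y) (at z) \<and> 0 \<le> y" by blast
qed simp_all

text \<open>The derivative of \<open>M\<close> at \<open>z\<close> is a variance divided by \<open>z\<close>, hence at most \<open>(D / 2 - M z) / (2 * z)\<close>, which decreases in \<open>z\<close>.\<close>

lemma M_lipschitz:
  assumes a: "0 < a" and x: "a \<le> x" "x \<le> y"
  shows "M y - M x \<le> (D / 2 - M a) / (2 * a) * (y - x)"
proof (cases "x = y")
  case False
  then have xy: "x < y" using x by simp
  have "\<exists>z>x. z < y \<and> M y - M x = (y - x) * ((v2 z * v z - (v1 z)\<^sup>2) / (z * (v z)\<^sup>2))"
    by (rule MVT2[OF xy]) (use a x in \<open>auto intro!: DERIV_M\<close>)
  then obtain z where z: "x < z" "z < y" "M y - M x = (y - x) * ((v2 z * v z - (v1 z)\<^sup>2) / (z * (v z)\<^sup>2))"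
    by blast
  have z0: "z > 0" using z a x by simp
  have vz: "v z > 0" by (rule v_pos[OF z0])
  have "(v2 z * v z - (v1 z)\<^sup>2) / (z * (v z)\<^sup>2) \<le> (v z * (D / 2 * v z - v1 z) / 2) / (z * (v z)\<^sup>2)"
    using v2_le[OF z0] z0 vz by (intro divide_right_mono) auto
  also have "\<dots> = (D / 2 - M z) / (2 * z)"
    using z0 vz by (simp add: M_def field_simps power2_eq_square)
  also have "\<dots> \<le> (D / 2 - M a) / (2 * a)"
    using M_mono[of a z] M_le[of z] M_le[of a] a x z z0 by (intro frac_le) auto
  finally show ?thesis unfolding z(3) mult.commute[of "(D / 2 - M a) / (2 * a)"]
    by (rule mult_left_mono) (use xy in simp)
qed simp

lemma M_ge: "u > 0 \<Longrightarrow> D / 2 - M u \<le> D / 2 * (\<rho> / sqrt u)"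
proof -
  assume u: "u > 0"
  have s: "sqrt u > 0" using u by simp
  have "(\<Sum>k\<le>d. real k * (b k * sqrt u ^ k)) = 2 * v1 u"
    unfolding v1_def sum_distrib_left by (intro sum.cong) auto
  then have "D * sqrt u * v u \<le> (\<rho> + sqrt u) * (2 * v1 u)"
    using deg_ge[OF s] by (simp add: v_def)
  then have "D * sqrt u \<le> (\<rho> + sqrt u) * (2 * M u)"
    using v_pos[OF u] by (simp add: M_def field_simps)
  then have "sqrt u * (D / 2 - M u) \<le> \<rho> * M u" by (simp add: algebra_simps)
  also have "\<dots> \<le> \<rho> * (D / 2)" using M_le[of u] u \<rho>0 by (intro mult_left_mono) auto
  finally show ?thesis using s by (simp add: field_simps)
qed

text \<open>While \<open>M \<ge> D / 4\<close>, the function \<open>v u / u powr (D / 4)\<close> is nondecreasing, and \<open>4 powr (D / 4)\<close> is at least \<open>exp (D / 3)\<close>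
  since \<open>ln 2 \<ge> 2 / 3\<close>.\<close>

lemma v_growth:
  assumes a: "0 < a" and M: "M a \<ge> D / 4" and w: "4 * a \<le> w"
  shows "v w \<ge> v a * exp (D / 3)"
proof -
  let ?f = "\<lambda>u. ln (v u) - D / 4 * ln u"
  have "?f a \<le> ?f w"
  proof (rule DERIV_nonneg_imp_nondecreasing[of a w ?f])
    show "a \<le> w" using a w by simp
    fix z assume z: "a \<le> z" and "z \<le> w"
    then have z0: "z > 0" using a by simp
    have "(?f has_real_derivative 1 / v z * (v1 z / z) - D / 4 * (1 / z)) (at z)"
      using z0 v_pos[OF z0] by (auto intro!: derivative_eq_intros DERIV_v)
    moreover have "1 / v z * (v1 z / z) - D / 4 * (1 / z) = (M z - D / 4) / z"
      using z0 v_pos[OF z0] by (simp add: M_def field_simps)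
    moreover have "(M z - D / 4) / z \<ge> 0" using M_mono[OF a z] M z0 by simp
    ultimately show "\<exists>y. (?f has_real_derivative y) (at z) \<and> 0 \<le> y" by metis
  qed
  then have "ln (v a) + D / 4 * (ln w - ln a) \<le> ln (v w)" unfolding right_diff_distrib by linarith
  moreover have "ln w - ln a \<ge> 4 / 3"
  proof -
    have "ln (4 * a) \<le> ln w" using a w by simp
    moreover have "ln (4 * a) = 2 * ln 2 + ln a"
      using a ln_realpow[of 2 2] by (simp add: ln_mult)
    ultimately show ?thesis using ln2_ge_two_thirds by linarith
  qed
  then have "D / 4 * (4 / 3) \<le> D / 4 * (ln w - ln a)" by (intro mult_left_mono) auto
  ultimately have "ln (v a) + D / 3 \<le> ln (v w)" by linarith
  then have "exp (ln (v a) + D / 3) \<le> exp (ln (v w))" by simp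
  moreover have "v w > 0" using a w by (intro v_pos) simp
  ultimately show ?thesis using v_pos[OF a] by (simp add: exp_add)
qed

end

section \<open>Moments of the profile density\<close>

lemma has_bochner_integral_monomial:
  "has_bochner_integral lborel (\<lambda>u. indicator {0<..} u * (sqrt u ^ k * u ^ n * exp (- u))) (Gamma (real k / 2 + real n + 1))"
proof (rule has_bochner_integral_nn_integral)
  show "(\<lambda>u. indicator {0<..} u * (sqrt u ^ k * u ^ n * exp (- u))) \<in> borel_measurable lborel" by measurable
  show "AE u in lborel. 0 \<le> indicator {0<..} u * (sqrt u ^ k * u ^ n * exp (- u))"
    by (auto simp: indicator_def)
  show "0 \<le> Gamma (real k / 2 + real n + 1)" by (intro less_imp_le Gamma_real_pos) simp
  let ?s = "real k / 2 + real n + 1"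
  have "ennreal (Gamma ?s) = (\<integral>\<^sup>+t. ennreal (indicator {0..} t * t powr (?s - 1) / exp t) \<partial>lborel)"
    by (rule Gamma_conv_nn_integral_real) (simp add: add_nonneg_pos)
  also have "\<dots> = (\<integral>\<^sup>+u. ennreal (indicator {0<..} u * (sqrt u ^ k * u ^ n * exp (- u))) \<partial>lborel)"
  proof (rule nn_integral_cong_AE)
    have "AE t in lborel. t \<noteq> (0::real)" by (rule AE_lborel_singleton)
    then show "AE t in lborel. ennreal (indicator {0..} t * t powr (?s - 1) / exp t)
        = ennreal (indicator {0<..} t * (sqrt t ^ k * t ^ n * exp (- t)))"
    proof eventually_elim
      case (elim t)
      show ?case
      proof (cases "t > 0")
        case True
        have "t powr (?s - 1) = t powr (real k / 2) * t powr real n" by (simp add: powr_add)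
        also have "t powr (real k / 2) = sqrt t ^ k"
          using True by (simp add: powr_half_sqrt[symmetric] powr_powr powr_realpow[symmetric])
        also have "t powr real n = t ^ n" using True by (simp add: powr_realpow)
        finally show ?thesis using True by (simp add: exp_minus field_simps)
      next
        case False
        then show ?thesis using elim by (simp add: indicator_def)
      qed
    qed
  qed
  finally show "(\<integral>\<^sup>+u. ennreal (indicator {0<..} u * (sqrt u ^ k * u ^ n * exp (- u))) \<partial>lborel) = ennreal (Gamma ?s)" ..
qed

context steiner_profile
begin

lemma W_pos: "W > 0"
proof -
  have "\<exists>k\<le>d. b k \<noteq> 0"
  proof (rule ccontr)
    assume "\<not> ?thesis"
    then have "(\<Sum>k\<le>d. b k) = 0" by (intro sum.neutral) auto
    with bpos show False by simp
  qed
  then obtain k where k: "k \<le> d" "b k > 0" using b0 by (auto simp: less_le)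
  have g: "Gamma (real k / 2 + 1) > 0" for k by (intro Gamma_real_pos) simp
  have "0 < b k * Gamma (real k / 2 + 1)" using k g[of k] by simp
  also have "\<dots> \<le> W" unfolding W_def using k b0 g by (intro member_le_sum) (auto intro: less_imp_le)
  finally show ?thesis .
qed

text \<open>The probability density \<open>qd\<close> is the law of \<open>Y + E\<close>, where \<open>Y\<close> is \<open>pi\<close> times the squared distance and \<open>E\<close> is an independent standard exponential variable.
  In contrast to the law of \<open>Y\<close>, which has an atom at 0, it is a mixture of Gamma densities.\<close>

definition qd :: "real \<Rightarrow> real" where "qd u = indicator {0<..} u * (v u * exp (- u)) / W"

lemma measurable_v [measurable]: "v \<in> borel_measurable borel"
  unfolding v_def by measurable
lemma measurable_v1 [measurable]: "v1 \<in> borel_measurable borel"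
  unfolding v1_def by measurable
lemma measurable_M [measurable]: "M \<in> borel_measurable borel"
  unfolding M_def by measurable
lemma measurable_qd [measurable]: "qd \<in> borel_measurable borel"
  unfolding qd_def by measurable

lemma qd_nonneg: "qd u \<ge> 0"
  using v_nonneg[of u] W_pos by (auto simp: qd_def indicator_def)

lemma moment:
  "has_bochner_integral lborel (\<lambda>u. qd u * u ^ n) ((\<Sum>k\<le>d. b k * Gamma (real k / 2 + real n + 1)) / W)"
proof -
  have "has_bochner_integral lborel
      (\<lambda>u. (\<Sum>k\<le>d. b k * (indicator {0<..} u * (sqrt u ^ k * u ^ n * exp (- u)))) / W)
      ((\<Sum>k\<le>d. b k * Gamma (real k / 2 + real n + 1)) / W)"
    by (intro has_bochner_integral_divide_zero has_bochner_integral_sum has_bochner_integral_mult_right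
        has_bochner_integral_monomial)
  also have "(\<lambda>u. (\<Sum>k\<le>d. b k * (indicator {0<..} u * (sqrt u ^ k * u ^ n * exp (- u)))) / W) = (\<lambda>u. qd u * u ^ n)"
    by (auto simp: fun_eq_iff qd_def v_def sum_distrib_left sum_distrib_right mult_ac)
  finally show ?thesis .
qed

lemma moment_M:
  "has_bochner_integral lborel (\<lambda>u. qd u * (M u * u ^ n)) ((\<Sum>k\<le>d. real k / 2 * (b k * Gamma (real k / 2 + real n + 1))) / W)"
proof -
  have "has_bochner_integral lborel
      (\<lambda>u. (\<Sum>k\<le>d. real k / 2 * (b k * (indicator {0<..} u * (sqrt u ^ k * u ^ n * exp (- u))))) / W)
      ((\<Sum>k\<le>d. real k / 2 * (b k * Gamma (real k / 2 + real n + 1))) / W)"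
    by (intro has_bochner_integral_divide_zero has_bochner_integral_sum has_bochner_integral_mult_right
        has_bochner_integral_monomial)
  also have "(\<lambda>u. (\<Sum>k\<le>d. real k / 2 * (b k * (indicator {0<..} u * (sqrt u ^ k * u ^ n * exp (- u))))) / W) = (\<lambda>u. qd u * (M u * u ^ n))"
  proof
    fix u
    have "indicator {0<..} u * v1 u = indicator {0<..} u * (v u * M u)"
      using v_pos[of u] by (auto simp: indicator_def M_def)
    then have "qd u * (M u * u ^ n) = indicator {0<..} u * v1 u * exp (- u) * u ^ n / W"
      by (auto simp: qd_def mult_ac)
    also have "\<dots> = (\<Sum>k\<le>d. real k / 2 * (b k * (indicator {0<..} u * (sqrt u ^ k * u ^ n * exp (- u))))) / W"
      by (simp add: v1_def sum_distrib_left sum_distrib_right mult_ac)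
    finally show "(\<Sum>k\<le>d. real k / 2 * (b k * (indicator {0<..} u * (sqrt u ^ k * u ^ n * exp (- u))))) / W = qd u * (M u * u ^ n)" by simp
  qed
  finally show ?thesis .
qed

text \<open>The same density as a differentiable function on \<open>u > 0\<close>, without the cut-off at 0.\<close>

definition qq :: "real \<Rightarrow> real" where "qq u = v u * exp (- u) / W"

lemma measurable_qq [measurable]: "qq \<in> borel_measurable borel"
  unfolding qq_def by measurable

lemma qd_qq: "qd u = indicator {0<..} u * qq u"
  by (simp add: qd_def qq_def)

lemma qq_nonneg: "u \<ge> 0 \<Longrightarrow> qq u \<ge> 0"
  using v_nonneg[of u] W_pos by (simp add: qq_def)

lemma DERIV_qq:
  assumes u: "u > 0"
  shows "(qq has_real_derivative qq u * (M u / u - 1)) (at u)"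
proof -
  have "((\<lambda>u. v u * exp (- u) / W) has_real_derivative (v1 u / u * exp (- u) + - exp (- u) * v u) / W) (at u)"
    using u W_pos by (auto intro!: derivative_eq_intros DERIV_v)
  moreover have "(v1 u / u * exp (- u) + - exp (- u) * v u) / W = qq u * (M u / u - 1)"
  proof -
    have vM: "v1 u = v u * M u" using v_pos[OF u] by (simp add: M_def)
    show ?thesis unfolding vM qq_def by (simp add: algebra_simps diff_divide_distrib)
  qed
  ultimately have "((\<lambda>u. v u * exp (- u) / W) has_real_derivative qq u * (M u / u - 1)) (at u)"
    by (rule DERIV_cong)
  then show ?thesis unfolding qq_def[abs_def] .
qed

text \<open>Under \<open>qd\<close> the Gamma law with shape \<open>k / 2 + 1\<close> has weight \<open>wt k\<close>; correspondingly \<open>Y\<close> is a mixture, with the same weights, of Gamma laws with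
  shape \<open>k / 2\<close> (the atom for \<open>k = 0\<close>). So \<open>mu\<close> and \<open>kap\<close>, the first two moments of \<open>k / 2\<close>, give the mean \<open>mu\<close> and the
  variance \<open>(kap - mu\<^sup>2) + mu\<close> of \<open>Y\<close>.\<close>

definition wt :: "nat \<Rightarrow> real" where "wt k = b k * Gamma (real k / 2 + 1) / W"
definition mu :: real where "mu = (\<Sum>k\<le>d. real k / 2 * wt k)"
definition kap :: real where "kap = (\<Sum>k\<le>d. (real k / 2)\<^sup>2 * wt k)"
definition var :: real where "var = kap + mu - mu\<^sup>2"

lemma wt_sum: "(\<Sum>k\<le>d. wt k) = 1"
  using W_pos by (simp add: wt_def sum_divide_distrib[symmetric] W_def)

lemma Gamma_shift1: "Gamma (real k / 2 + 1 + 1) = (real k / 2 + 1) * Gamma (real k / 2 + 1)"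
  by (rule Gamma_plus1) (auto elim!: nonpos_Ints_cases)

lemma Gamma_shift2: "Gamma (real k / 2 + 2 + 1) = (real k / 2 + 2) * ((real k / 2 + 1) * Gamma (real k / 2 + 1))"
proof -
  have "Gamma (real k / 2 + 2 + 1) = (real k / 2 + 2) * Gamma (real k / 2 + 2)"
    by (rule Gamma_plus1) (auto elim!: nonpos_Ints_cases)
  also have "real k / 2 + 2 = real k / 2 + 1 + 1" by simp
  finally show ?thesis unfolding Gamma_shift1 by simp
qed

lemma Gamma_shift1': "Gamma (real k / 2 + real 1 + 1) = (real k / 2 + 1) * Gamma (real k / 2 + 1)"
  by (simp only: of_nat_1 Gamma_shift1)

lemma Gamma_shift2': "Gamma (real k / 2 + real 2 + 1) = (real k / 2 + 2) * ((real k / 2 + 1) * Gamma (real k / 2 + 1))"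
  by (simp only: of_nat_numeral Gamma_shift2)

lemma moments:
  "has_bochner_integral lborel (\<lambda>u. qd u * 1) 1"
  "has_bochner_integral lborel (\<lambda>u. qd u * u) (mu + 1)"
  "has_bochner_integral lborel (\<lambda>u. qd u * u\<^sup>2) (kap + 3 * mu + 2)"
  "has_bochner_integral lborel (\<lambda>u. qd u * M u) mu"
  "has_bochner_integral lborel (\<lambda>u. qd u * (M u * u)) (kap + mu)"
proof -
  have e0: "(\<Sum>k\<le>d. b k * Gamma (real k / 2 + real 0 + 1)) / W = 1"
    using wt_sum by (simp add: wt_def sum_divide_distrib)
  show "has_bochner_integral lborel (\<lambda>u. qd u * 1) 1"
    using moment[of 0] unfolding e0 by simp
  have "(\<Sum>k\<le>d. b k * Gamma (real k / 2 + real 1 + 1)) / W = (\<Sum>k\<le>d. (real k / 2 + 1) * wt k)"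
    unfolding sum_divide_distrib by (intro sum.cong refl, subst Gamma_shift1', simp add: wt_def)
  also have "\<dots> = mu + 1" using wt_sum by (simp add: distrib_right sum.distrib mu_def)
  finally show "has_bochner_integral lborel (\<lambda>u. qd u * u) (mu + 1)" using moment[of 1] by simp
  have "(\<Sum>k\<le>d. b k * Gamma (real k / 2 + real 2 + 1)) / W = (\<Sum>k\<le>d. (real k / 2 + 2) * ((real k / 2 + 1) * wt k))"
    unfolding sum_divide_distrib by (intro sum.cong refl, subst Gamma_shift2', simp add: wt_def)
  also have "\<dots> = (\<Sum>k\<le>d. (real k / 2)\<^sup>2 * wt k + 3 * (real k / 2 * wt k) + 2 * wt k)"
    by (intro sum.cong refl) (simp add: power2_eq_square field_simps)
  also have "\<dots> = kap + 3 * mu + 2"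
    using wt_sum by (simp only: sum.distrib sum_distrib_left[symmetric] kap_def mu_def)
  finally show "has_bochner_integral lborel (\<lambda>u. qd u * u\<^sup>2) (kap + 3 * mu + 2)" using moment[of 2] by simp
  have "(\<Sum>k\<le>d. real k / 2 * (b k * Gamma (real k / 2 + real 0 + 1))) / W = mu"
    unfolding sum_divide_distrib mu_def by (intro sum.cong refl) (simp add: wt_def)
  then show "has_bochner_integral lborel (\<lambda>u. qd u * M u) mu" using moment_M[of 0] by simp
  have "(\<Sum>k\<le>d. real k / 2 * (b k * Gamma (real k / 2 + real 1 + 1))) / W = (\<Sum>k\<le>d. real k / 2 * ((real k / 2 + 1) * wt k))"
    unfolding sum_divide_distrib by (intro sum.cong refl, subst Gamma_shift1', simp add: wt_def)
  also have "\<dots> = (\<Sum>k\<le>d. (real k / 2)\<^sup>2 * wt k + real k / 2 * wt k)"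
    by (intro sum.cong refl) (simp add: power2_eq_square algebra_simps)
  also have "\<dots> = kap + mu" by (simp only: sum.distrib kap_def mu_def)
  finally show "has_bochner_integral lborel (\<lambda>u. qd u * (M u * u)) (kap + mu)" using moment_M[of 1] by simp
qed

definition Q :: "real measure" where "Q = density lborel (\<lambda>u. ennreal (qd u))"

lemma Q_has_bochner:
  assumes [measurable]: "f \<in> borel_measurable borel" and "has_bochner_integral lborel (\<lambda>u. qd u * f u) x"
  shows "integrable Q f" "integral\<^sup>L Q f = x"
  using assms(2) qd_nonneg unfolding Q_def
  by (auto simp: integrable_real_density integral_real_density has_bochner_integral_iff)

lemma Q_space [simp]: "space Q = UNIV" "sets Q = sets borel"
  by (simp_all add: Q_def)

lemma Q_measurable [measurable_cong]: "sets Q = sets borel" by simp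

lemma Q_AE_pos: "AE u in Q. u > 0"
  unfolding Q_def by (subst AE_density) (auto simp: qd_def indicator_def)

lemma prob_space_Q: "prob_space Q"
proof
  have "(\<integral>\<^sup>+u. ennreal (qd u) \<partial>lborel) = ennreal 1"
    using moments(1) qd_nonneg by (subst nn_integral_eq_integral) (auto simp: has_bochner_integral_iff)
  then show "emeasure Q (space Q) = 1"
    unfolding Q_def by (simp add: emeasure_density)
qed

end

section \<open>Bounds in the bulk\<close>

text \<open>The case in which there is something to prove: the dimension is large, and the mean of \<open>k / 2\<close> is already close to
  \<open>d / 2\<close> at \<open>u = d / 32\<close>. The threshold is far below the mean of \<open>Y\<close>, which is at least \<open>d / 4\<close>, so that the mass below it is
  negligible; above it \<open>M\<close> is nearly constant.\<close>

locale steiner_bulk = steiner_profile +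
  assumes big: "real d \<ge> 1000" and small: "real d / 2 - M (real d / 32) \<le> real d / 64"
begin

text \<open>The defect \<open>del\<close> measures the deviation of \<open>M\<close> from a constant above \<open>thr\<close>, and \<open>eta\<close> bounds both the mass of \<open>qd\<close> below \<open>thr\<close> and its
  value at \<open>thr\<close>.\<close>

definition thr :: real where "thr = D / 32"
definition del :: real where "del = D / 2 - M thr"
definition eta :: real where "eta = v thr / W"
definition low :: "real \<Rightarrow> real" where "low u = indicator {..<thr} u"

sublocale Q: prob_space Q by (rule prob_space_Q)

lemma measurable_low [measurable]: "low \<in> borel_measurable borel"
  unfolding low_def by measurable

lemma thr_pos: "thr > 0" using big by (simp add: thr_def)
lemma del_nonneg: "del \<ge> 0" using M_le[of thr] thr_pos by (simp add: del_def)
lemma del_le: "del \<le> D / 64" using small by (simp add: del_def thr_def)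
lemma eta_pos: "eta > 0" using v_pos[OF thr_pos] W_pos by (simp add: eta_def)
lemma low_cases: "low u = (if u < thr then 1 else 0)" by (simp add: low_def)

lemma integrable_low: "integrable Q low"
  by (rule Q.integrable_const_bound[where B = 1]) (auto simp: low_cases)

lemma integrable_Q:
  "integrable Q (\<lambda>u. u)" "integrable Q (\<lambda>u. u\<^sup>2)" "integrable Q M" "integrable Q (\<lambda>u. M u * u)"
  "integrable Q low"
  by (rule Q_has_bochner(1)[OF _ moments(2)] Q_has_bochner(1)[OF _ moments(3)]
    Q_has_bochner(1)[OF _ moments(4)] Q_has_bochner(1)[OF _ moments(5)] integrable_low, measurable?)+

lemma expectation_Q:
  "Q.expectation (\<lambda>u. u) = mu + 1" "Q.expectation (\<lambda>u. u\<^sup>2) = kap + 3 * mu + 2"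
  "Q.expectation M = mu" "Q.expectation (\<lambda>u. M u * u) = kap + mu"
  by (rule Q_has_bochner(2)[OF _ moments(2)] Q_has_bochner(2)[OF _ moments(3)]
    Q_has_bochner(2)[OF _ moments(4)] Q_has_bochner(2)[OF _ moments(5)], measurable)+

lemma Q_prob_UNIV [simp]: "Q.prob UNIV = 1"
  using Q.prob_space by simp

lemma Q_mono:
  fixes f g :: "real \<Rightarrow> real"
  assumes "integrable Q f" "integrable Q g" "\<And>u. u > 0 \<Longrightarrow> f u \<le> g u"
  shows "Q.expectation f \<le> Q.expectation g"
  by (rule integral_mono_AE[OF assms(1,2)]) (use Q_AE_pos assms(3) in \<open>auto elim: eventually_mono\<close>)

lemma Q_integrable_bound:
  fixes f g :: "real \<Rightarrow> real"
  assumes "integrable Q g" "f \<in> borel_measurable borel" "\<And>u. u > 0 \<Longrightarrow> \<bar>f u\<bar> \<le> g u"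
  shows "integrable Q f"
proof (rule Bochner_Integration.integrable_bound[OF assms(1)])
  show "f \<in> borel_measurable Q" using assms(2) by simp
  show "AE u in Q. norm (f u) \<le> norm (g u)"
    using Q_AE_pos by eventually_elim (use assms(3) in \<open>force intro: order_trans\<close>)
qed

lemma Q_second_moment:
  "integrable Q (\<lambda>u. (u - c)\<^sup>2)" "Q.expectation (\<lambda>u. (u - c)\<^sup>2) = var + 1 + (mu + 1 - c)\<^sup>2"
proof -
  have eq: "(u - c)\<^sup>2 = u\<^sup>2 - 2 * c * u + c\<^sup>2" for u by (simp add: power2_eq_square algebra_simps)
  show "integrable Q (\<lambda>u. (u - c)\<^sup>2)"
    unfolding eq using integrable_Q by simp
  have "Q.expectation (\<lambda>u. (u - c)\<^sup>2) = (kap + 3 * mu + 2) - 2 * c * (mu + 1) + c\<^sup>2"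
    unfolding eq using integrable_Q expectation_Q by (simp add: Q.prob_space)
  then show "Q.expectation (\<lambda>u. (u - c)\<^sup>2) = var + 1 + (mu + 1 - c)\<^sup>2"
    by (simp add: var_def power2_eq_square algebra_simps)
qed

text \<open>By \<open>2 * x * r \<le> x\<^sup>2 + r\<^sup>2\<close>; the choice \<open>r = sqrt D\<close> is the optimal order.\<close>

lemma Q_abs_moment:
  assumes "r > 0"
  shows "integrable Q (\<lambda>u. \<bar>u - c\<bar>)"
    "Q.expectation (\<lambda>u. \<bar>u - c\<bar>) \<le> ((var + 1 + (mu + 1 - c)\<^sup>2) / r + r) / 2"
proof -
  show i: "integrable Q (\<lambda>u. \<bar>u - c\<bar>)" using integrable_Q by simp
  have "Q.expectation (\<lambda>u. \<bar>u - c\<bar>) \<le> Q.expectation (\<lambda>u. ((u - c)\<^sup>2 / r + r) / 2)"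
  proof (rule Q_mono[OF i])
    show "integrable Q (\<lambda>u. ((u - c)\<^sup>2 / r + r) / 2)" using Q_second_moment(1)[of c] by simp
    fix u :: real
    have "0 \<le> (\<bar>u - c\<bar> - r)\<^sup>2" by simp
    then have "2 * \<bar>u - c\<bar> * r \<le> (u - c)\<^sup>2 + r * r" by (simp add: power2_eq_square algebra_simps)
    then show "\<bar>u - c\<bar> \<le> ((u - c)\<^sup>2 / r + r) / 2" using assms by (simp add: field_simps)
  qed
  also have "\<dots> = ((var + 1 + (mu + 1 - c)\<^sup>2) / r + r) / 2"
    using Q_second_moment[of c] by (simp add: Q.prob_space)
  finally show "Q.expectation (\<lambda>u. \<bar>u - c\<bar>) \<le> ((var + 1 + (mu + 1 - c)\<^sup>2) / r + r) / 2" .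
qed

lemma M_thr: "M thr \<ge> D / 4"
  using del_le big by (simp add: del_def)

lemma qd_low: "0 < u \<Longrightarrow> u \<le> thr \<Longrightarrow> qd u \<le> eta * exp (- u)"
  using v_mono[of u thr] W_pos by (simp add: qd_def eta_def divide_right_mono)

text \<open>On the interval from \<open>4 * thr = D / 8\<close> to \<open>D / 4\<close> the profile \<open>v\<close> exceeds \<open>v thr\<close> by \<open>exp (D / 3)\<close>, while \<open>exp (- u)\<close> costs at most
  \<open>exp (- D / 4)\<close>. As the total mass is 1, \<open>eta\<close> is exponentially small, of order \<open>exp (- D / 12) / D\<close>.\<close>

lemma eta_le: "eta \<le> 1 / D\<^sup>2"
proof -
  have "eta * exp (D / 12) * (D / 8) = (\<integral>u. eta * exp (D / 12) * indicator {D / 8..D / 4} u \<partial>lborel)"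
    using big by simp
  also have "\<dots> \<le> (\<integral>u. qd u * 1 \<partial>lborel)"
  proof (rule integral_mono)
    show "integrable lborel (\<lambda>u. eta * exp (D / 12) * indicator {D / 8..D / 4} u)" by simp
    show "integrable lborel (\<lambda>u. qd u * 1)" using moments(1) by (simp add: has_bochner_integral_iff)
    fix u :: real
    show "eta * exp (D / 12) * indicator {D / 8..D / 4} u \<le> qd u * 1"
    proof (cases "u \<in> {D / 8..D / 4}")
      case True
      then have u: "D / 8 \<le> u" "u \<le> D / 4" by auto
      have "v u \<ge> v thr * exp (D / 3)"
        by (rule v_growth[OF thr_pos M_thr]) (use u in \<open>simp add: thr_def\<close>)
      moreover have "exp (- u) \<ge> exp (- (D / 4))" using u by simp
      ultimately have "v thr * exp (D / 3) * exp (- (D / 4)) \<le> v u * exp (- u)"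
        using v_pos[OF thr_pos] v_nonneg[of u] u big by (intro mult_mono) auto
      also have "v thr * exp (D / 3) * exp (- (D / 4)) = v thr * exp (D / 12)"
        by (simp add: mult.assoc exp_add[symmetric])
      finally show ?thesis
        using True u big W_pos by (simp add: eta_def qd_def divide_right_mono)
    next
      case False
      then show ?thesis using qd_nonneg by simp
    qed
  qed
  also have "\<dots> = 1" using moments(1) by (simp add: has_bochner_integral_iff)
  finally have 1: "eta * (exp (D / 12) * (D / 8)) \<le> 1" by (simp add: mult.assoc)
  have "D / 36 \<le> exp (D / 36)" using exp_ge_add_one_self[of "D / 36"] by linarith
  then have "(D / 36) ^ 3 \<le> exp (D / 36) ^ 3" using big by (intro power_mono) auto
  also have "exp (D / 36) ^ 3 = exp (D / 12)" by (simp add: exp_of_nat_mult[symmetric])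
  finally have "(D / 36) ^ 3 * (D / 8) \<le> exp (D / 12) * (D / 8)" using big by (intro mult_right_mono) auto
  moreover have "D\<^sup>2 \<le> (D / 36) ^ 3 * (D / 8)"
  proof -
    have "373248 * D\<^sup>2 \<le> D\<^sup>2 * D\<^sup>2"
    proof (subst mult.commute, rule mult_left_mono)
      have "1000 * 1000 \<le> D * D" using big by (intro mult_mono) auto
      then show "373248 \<le> D\<^sup>2" by (simp add: power2_eq_square)
    qed simp
    then show ?thesis by (simp add: power2_eq_square power3_eq_cube)
  qed
  ultimately have "D\<^sup>2 \<le> exp (D / 12) * (D / 8)" by linarith
  then have "eta * D\<^sup>2 \<le> eta * (exp (D / 12) * (D / 8))" using eta_pos by (intro mult_left_mono) auto
  with 1 have "eta * D\<^sup>2 \<le> 1" by linarith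
  then show ?thesis using big by (simp add: field_simps)
qed

lemma expectation_low: "Q.expectation low \<le> eta"
proof -
  have e: "has_bochner_integral lborel (\<lambda>u. indicator {0<..} u * (sqrt u ^ 0 * u ^ 0 * exp (- u))) (Gamma (real 0 / 2 + real 0 + 1))"
    by (rule has_bochner_integral_monomial)
  have "Q.expectation low = (\<integral>u. qd u * low u \<partial>lborel)"
    unfolding Q_def using qd_nonneg by (subst integral_real_density) auto
  also have "\<dots> \<le> (\<integral>u. eta * (indicator {0<..} u * (sqrt u ^ 0 * u ^ 0 * exp (- u))) \<partial>lborel)"
  proof (rule integral_mono)
    show "integrable lborel (\<lambda>u. qd u * low u)"
      using integrable_Q(5) qd_nonneg unfolding Q_def by (subst (asm) integrable_real_density) auto
    show "integrable lborel (\<lambda>u. eta * (indicator {0<..} u * (sqrt u ^ 0 * u ^ 0 * exp (- u))))"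
      by (intro integrable_mult_right integrable.intros[OF e])
    fix u :: real
    show "qd u * low u \<le> eta * (indicator {0<..} u * (sqrt u ^ 0 * u ^ 0 * exp (- u)))"
      using qd_low[of u] eta_pos by (cases "0 < u"; cases "u < thr") (auto simp: low_cases qd_def)
  qed
  also have "\<dots> = eta" using has_bochner_integral_integral_eq[OF e] by simp
  finally show ?thesis .
qed

lemma expectation_low_nonneg: "Q.expectation low \<ge> 0"
  by (rule integral_nonneg_AE) (simp add: low_cases)

lemma mu_bounds: "mu \<le> D / 2" "mu \<ge> D / 4"
proof -
  have "Q.expectation M \<le> Q.expectation (\<lambda>u. D / 2)"
    by (rule Q_mono) (use integrable_Q M_le in auto)
  then show "mu \<le> D / 2" using expectation_Q by (simp add: Q.prob_space)
  have "Q.expectation (\<lambda>u. (D / 2 - del) - (D / 2) * low u) \<le> Q.expectation M"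
  proof (rule Q_mono)
    fix u :: real assume u: "u > 0"
    show "(D / 2 - del) - (D / 2) * low u \<le> M u"
      using M_mono[OF thr_pos, of u] M_nonneg[of u] u del_nonneg by (auto simp: low_cases del_def not_less)
  qed (use integrable_Q in auto)
  then have "(D / 2 - del) - (D / 2) * Q.expectation low \<le> mu"
    using integrable_Q expectation_Q by (simp add: Q.prob_space)
  moreover have "(D / 2) * Q.expectation low \<le> (D / 2) * eta" using expectation_low by (intro mult_left_mono) auto
  moreover have "(D / 2) * eta \<le> (D / 2) * (1 / D\<^sup>2)" using eta_le by (intro mult_left_mono) auto
  moreover have "(D / 2) * (1 / D\<^sup>2) = 1 / (2 * D)" using big by (simp add: power2_eq_square)
  moreover have "1 / (2 * D) \<le> 1" using big by simp
  ultimately show "mu \<ge> D / 4" using del_le big by linarith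
qed

lemma thr_le: "thr \<le> mu + 1" using mu_bounds big by (simp add: thr_def)

text \<open>Above the threshold the slope of \<open>M\<close> is at most \<open>del / (2 * thr) = 16 * del / D\<close>; below it only \<open>0 \<le> M \<le> D / 2\<close> is used.\<close>

lemma M_deviation:
  assumes u: "u > 0"
  shows "\<bar>M u - M (mu + 1)\<bar> \<le> 16 * del / D * \<bar>u - (mu + 1)\<bar> + D / 2 * low u"
proof (cases "u < thr")
  case True
  have "\<bar>M u - M (mu + 1)\<bar> \<le> D / 2"
    using M_nonneg[of u] M_le[of u] M_nonneg[of "mu + 1"] M_le[of "mu + 1"] u thr_le thr_pos by linarith
  moreover have "16 * del / D * \<bar>u - (mu + 1)\<bar> \<ge> 0" using del_nonneg by simp
  ultimately show ?thesis using True by (simp add: low_cases)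
next
  case False
  then have a: "thr \<le> u" by simp
  have c: "(D / 2 - M thr) / (2 * thr) = 16 * del / D" by (simp add: del_def thr_def)
  have "\<bar>M u - M (mu + 1)\<bar> \<le> 16 * del / D * \<bar>u - (mu + 1)\<bar>"
  proof (cases "u \<le> mu + 1")
    case True
    then show ?thesis
      using M_lipschitz[OF thr_pos a True] M_mono[OF u True] unfolding c by simp
  next
    case False
    then have 1: "mu + 1 \<le> u" by simp
    have "0 < mu + 1" using thr_le thr_pos by linarith
    then show ?thesis
      using M_lipschitz[OF thr_pos thr_le 1] M_mono[OF _ 1] 1 unfolding c by simp
  qed
  then show ?thesis using False by (simp add: low_cases)
qed

text \<open>The variance of \<open>Y\<close> exceeds its mean by the variance of \<open>k / 2\<close>, which is the covariance of \<open>M u\<close> and \<open>u\<close> under \<open>Q\<close>. As \<open>M\<close> is nearly constant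
  and increasing, this is small and nonnegative.\<close>

lemma var_excess: "var - mu = Q.expectation (\<lambda>u. (M u - M (mu + 1)) * (u - (mu + 1)))"
proof -
  have eq: "(M u - M (mu + 1)) * (u - (mu + 1)) = M u * u - (mu + 1) * M u - M (mu + 1) * u + M (mu + 1) * (mu + 1)" for u
    by (simp add: algebra_simps)
  have "Q.expectation (\<lambda>u. (M u - M (mu + 1)) * (u - (mu + 1)))
      = (kap + mu) - (mu + 1) * mu - M (mu + 1) * (mu + 1) + M (mu + 1) * (mu + 1)"
    unfolding eq using integrable_Q expectation_Q by (simp add: Q.prob_space)
  then show ?thesis by (simp add: var_def power2_eq_square algebra_simps)
qed

lemma integrable_cov: "integrable Q (\<lambda>u. (M u - M (mu + 1)) * (u - (mu + 1)))"
proof -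
  have eq: "(M u - M (mu + 1)) * (u - (mu + 1)) = M u * u - (mu + 1) * M u - M (mu + 1) * u + M (mu + 1) * (mu + 1)" for u
    by (simp add: algebra_simps)
  show ?thesis unfolding eq using integrable_Q by simp
qed

lemma mu_pos: "mu > 0" using mu_bounds big by linarith

lemma var_ge_mu: "var \<ge> mu"
proof -
  have "0 \<le> Q.expectation (\<lambda>u. (M u - M (mu + 1)) * (u - (mu + 1)))"
  proof (rule integral_nonneg_AE)
    show "AE u in Q. 0 \<le> (M u - M (mu + 1)) * (u - (mu + 1))"
      using Q_AE_pos
    proof eventually_elim
      case (elim u)
      show ?case
      proof (cases "u \<le> mu + 1")
        case True
        then show ?thesis using M_mono[OF elim True] by (simp add: mult_nonpos_nonpos)
      next
        case False
        then show ?thesis using M_mono[of "mu + 1" u] mu_pos by (intro mult_nonneg_nonneg) auto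
      qed
    qed
  qed
  then show ?thesis using var_excess by linarith
qed

lemma var_pos: "var > 0" using var_ge_mu mu_pos by linarith
lemma var_lower: "var \<ge> D / 4" using var_ge_mu mu_bounds by linarith

lemma var_excess_le: "var - mu \<le> 16 * del / D * (var + 1) + 1 / 2"
proof -
  have "Q.expectation (\<lambda>u. (M u - M (mu + 1)) * (u - (mu + 1)))
     \<le> Q.expectation (\<lambda>u. 16 * del / D * (u - (mu + 1))\<^sup>2 + D / 2 * D * low u)"
  proof (rule Q_mono[OF integrable_cov])
    show "integrable Q (\<lambda>u. 16 * del / D * (u - (mu + 1))\<^sup>2 + D / 2 * D * low u)"
      using Q_second_moment(1)[of "mu + 1"] integrable_Q by simp
    fix u :: real assume u: "u > 0"
    have "(M u - M (mu + 1)) * (u - (mu + 1)) \<le> \<bar>M u - M (mu + 1)\<bar> * \<bar>u - (mu + 1)\<bar>"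
      by (simp add: abs_mult[symmetric])
    also have "\<dots> \<le> (16 * del / D * \<bar>u - (mu + 1)\<bar> + D / 2 * low u) * \<bar>u - (mu + 1)\<bar>"
      by (intro mult_right_mono M_deviation u) simp
    also have "\<dots> = 16 * del / D * (u - (mu + 1))\<^sup>2 + D / 2 * (low u * \<bar>u - (mu + 1)\<bar>)"
      by (simp add: distrib_right power2_eq_square mult.assoc)
    also have "\<dots> \<le> 16 * del / D * (u - (mu + 1))\<^sup>2 + D / 2 * (D * low u)"
    proof (intro add_left_mono mult_left_mono)
      show "low u * \<bar>u - (mu + 1)\<bar> \<le> D * low u"
        using u thr_le mu_bounds big by (auto simp: low_cases)
    qed simp
    finally show "(M u - M (mu + 1)) * (u - (mu + 1)) \<le> 16 * del / D * (u - (mu + 1))\<^sup>2 + D / 2 * D * low u" by simp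
  qed
  also have "\<dots> = 16 * del / D * (var + 1) + D / 2 * D * Q.expectation low"
    using Q_second_moment[of "mu + 1"] integrable_Q by simp
  also have "D / 2 * D * Q.expectation low \<le> D / 2 * D * (1 / D\<^sup>2)"
    using expectation_low eta_le by (intro mult_left_mono) auto
  also have "D / 2 * D * (1 / D\<^sup>2) = 1 / 2" using big by (simp add: power2_eq_square)
  finally show ?thesis using var_excess by simp
qed

lemma var_le_D: "var \<le> D"
proof -
  have "16 * del / D \<le> 1 / 4" using del_le big by (simp add: field_simps)
  then have "16 * del / D * (var + 1) \<le> 1 / 4 * (var + 1)" using var_pos by (intro mult_right_mono) auto
  then have "var - mu \<le> 1 / 4 * (var + 1) + 1 / 2"
    using order_trans[OF var_excess_le add_right_mono] by blast
  then have "3 / 4 * var \<le> mu + 3 / 4" by (simp add: field_simps)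
  also have "\<dots> \<le> D / 2 + 3 / 4" using mu_bounds(1) by simp
  also have "\<dots> \<le> 3 / 4 * D" using big by (simp add: field_simps)
  finally show ?thesis by simp
qed

lemma var_excess_le': "var - mu \<le> 17 * del + 1 / 2"
proof -
  have "16 * del / D * (var + 1) \<le> 16 * del / D * (D + 1)"
    using var_le_D del_nonneg by (intro mult_left_mono) auto
  also have "\<dots> = 16 * del + 16 * del / D" using big by (simp add: field_simps)
  also have "16 * del / D \<le> del"
  proof -
    have "del * (16 / D) \<le> del * 1" using del_nonneg big by (intro mult_left_mono) auto
    then show ?thesis by (simp add: mult.commute)
  qed
  finally show ?thesis using var_excess_le by linarith
qed

definition rt :: real where "rt = sqrt D"

lemma rt: "rt > 0" "rt * rt = D" "rt \<ge> 31"
proof -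
  show "rt > 0" "rt * rt = D" using big by (auto simp: rt_def)
  have "sqrt (31 * 31) \<le> sqrt D" using big by (intro real_sqrt_le_mono) simp
  then show "rt \<ge> 31" by (simp only: rt_def real_sqrt_mult_self) simp
qed

lemma abs_dev: "Q.expectation (\<lambda>u. \<bar>u - (mu + 1)\<bar>) \<le> 3 / 2 * rt" "Q.expectation (\<lambda>u. \<bar>u - mu\<bar>) \<le> 3 / 2 * rt"
proof -
  have "(var + 1 + 1) / rt \<le> (2 * (rt * rt)) / rt"
    using var_le_D big rt by (intro divide_right_mono) auto
  moreover have "(2 * (rt * rt)) / rt = 2 * rt" using rt(1) by simp
  ultimately have *: "(var + 1 + 1) / rt \<le> 2 * rt" by linarith
  moreover have "(var + 1 + 0) / rt \<le> (var + 1 + 1) / rt" using rt by (intro divide_right_mono) auto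
  ultimately show "Q.expectation (\<lambda>u. \<bar>u - (mu + 1)\<bar>) \<le> 3 / 2 * rt" "Q.expectation (\<lambda>u. \<bar>u - mu\<bar>) \<le> 3 / 2 * rt"
    using Q_abs_moment(2)[OF rt(1), of "mu + 1"] Q_abs_moment(2)[OF rt(1), of mu] by auto
qed

lemma M_abs_dev: "Q.expectation (\<lambda>u. \<bar>M u - mu\<bar>) \<le> 48 * del / rt + 1 / D"
proof -
  let ?A = "Q.expectation (\<lambda>u. \<bar>M u - M (mu + 1)\<bar>)"
  have iA: "integrable Q (\<lambda>u. \<bar>M u - M (mu + 1)\<bar>)" using integrable_Q by simp
  have "?A \<le> Q.expectation (\<lambda>u. 16 * del / D * \<bar>u - (mu + 1)\<bar> + D / 2 * low u)"
    by (rule Q_mono[OF iA]) (use M_deviation Q_abs_moment(1)[of 1 "mu + 1"] integrable_Q in auto)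
  also have "\<dots> = 16 * del / D * Q.expectation (\<lambda>u. \<bar>u - (mu + 1)\<bar>) + D / 2 * Q.expectation low"
    using Q_abs_moment(1)[of 1 "mu + 1"] integrable_Q by simp
  also have "\<dots> \<le> 16 * del / D * (3 / 2 * rt) + D / 2 * (1 / D\<^sup>2)"
    using abs_dev expectation_low eta_le del_nonneg by (intro add_mono mult_left_mono) auto
  also have "\<dots> = 24 * del / rt + 1 / (2 * D)"
    using rt big by (simp add: field_simps power2_eq_square rt(2)[symmetric])
  finally have A: "?A \<le> 24 * del / rt + 1 / (2 * D)" .
  have "M (mu + 1) - mu = Q.expectation (\<lambda>u. M (mu + 1) - M u)"
    using integrable_Q expectation_Q by (simp add: Q.prob_space)
  also have "\<bar>\<dots>\<bar> \<le> Q.expectation (\<lambda>u. \<bar>M (mu + 1) - M u\<bar>)" by (rule integral_abs_bound)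
  also have "\<dots> = ?A" by (simp only: abs_minus_commute)
  finally have B: "\<bar>M (mu + 1) - mu\<bar> \<le> ?A" .
  have "Q.expectation (\<lambda>u. \<bar>M u - mu\<bar>) \<le> Q.expectation (\<lambda>u. \<bar>M u - M (mu + 1)\<bar> + \<bar>M (mu + 1) - mu\<bar>)"
    by (rule Q_mono) (use integrable_Q in auto)
  also have "\<dots> = ?A + \<bar>M (mu + 1) - mu\<bar>" using iA by (simp add: Q.prob_space)
  finally have "Q.expectation (\<lambda>u. \<bar>M u - mu\<bar>) \<le> ?A + \<bar>M (mu + 1) - mu\<bar>" .
  moreover have "2 * (24 * del / rt + 1 / (2 * D)) = 48 * del / rt + 1 / D" by simp
  ultimately show ?thesis using A B by linarith
qed

text \<open>The logarithmic derivative of \<open>qq\<close> is \<open>M u / u - 1\<close> and that of the normal density with mean \<open>mu\<close> and variance \<open>var\<close> is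
  \<open>- (u - mu) / var\<close>; the score is the difference.\<close>

definition score :: "real \<Rightarrow> real" where "score u = M u / u - 1 + (u - mu) / var"

lemma measurable_score [measurable]: "score \<in> borel_measurable borel"
  unfolding score_def by measurable

text \<open>Replacing \<open>M u\<close> and \<open>var\<close> by \<open>mu\<close> turns the score into \<open>(u - mu)\<^sup>2 / (u * mu)\<close>, which is of order \<open>1 / D\<close> on average; the
  remaining terms are the errors of the two replacements.\<close>

lemma score_bound:
  assumes u: "thr \<le> u"
  shows "\<bar>score u\<bar> \<le> 32 / D * (\<bar>M u - mu\<bar> + 4 / D * ((u - mu)\<^sup>2 + (17 * del + 1 / 2) * \<bar>u - mu\<bar>))"
proof -
  have u0: "u > 0" using u thr_pos by linarith
  have iu: "1 / u \<le> 32 / D" using u u0 thr_pos by (simp add: thr_def field_simps)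
  have iv: "1 / var \<le> 4 / D" using var_lower var_pos big by (simp add: field_simps)
  have "score u = 1 / u * ((M u - mu) + 1 / var * ((u - mu) * (u - var)))"
    using u0 var_pos by (simp add: score_def field_simps)
  then have "\<bar>score u\<bar> = 1 / u * \<bar>(M u - mu) + 1 / var * ((u - mu) * (u - var))\<bar>"
    using u0 by (simp add: abs_mult)
  also have "\<dots> \<le> 32 / D * \<bar>(M u - mu) + 1 / var * ((u - mu) * (u - var))\<bar>"
    by (rule mult_right_mono[OF iu]) simp
  also have "\<dots> \<le> 32 / D * (\<bar>M u - mu\<bar> + 1 / var * (\<bar>u - mu\<bar> * \<bar>u - var\<bar>))"
    using abs_triangle_ineq[of "M u - mu" "1 / var * ((u - mu) * (u - var))"] var_pos big
    by (intro mult_left_mono) (auto simp: abs_mult)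
  also have "\<dots> \<le> 32 / D * (\<bar>M u - mu\<bar> + 4 / D * ((u - mu)\<^sup>2 + (17 * del + 1 / 2) * \<bar>u - mu\<bar>))"
  proof (intro mult_left_mono add_left_mono)
    have "\<bar>u - var\<bar> \<le> \<bar>u - mu\<bar> + (17 * del + 1 / 2)" using var_excess_le' var_ge_mu by linarith
    then have "\<bar>u - mu\<bar> * \<bar>u - var\<bar> \<le> \<bar>u - mu\<bar> * (\<bar>u - mu\<bar> + (17 * del + 1 / 2))"
      by (intro mult_left_mono) auto
    also have "\<dots> = (u - mu)\<^sup>2 + (17 * del + 1 / 2) * \<bar>u - mu\<bar>"
      by (simp add: distrib_left power2_eq_square mult.commute)
    finally show "1 / var * (\<bar>u - mu\<bar> * \<bar>u - var\<bar>) \<le> 4 / D * ((u - mu)\<^sup>2 + (17 * del + 1 / 2) * \<bar>u - mu\<bar>)"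
      using iv by (intro mult_mono) auto
  qed simp
  finally show ?thesis .
qed

lemma score_expectation:
  "integrable Q (\<lambda>u. indicator {thr..} u * \<bar>score u\<bar>)"
  "Q.expectation (\<lambda>u. indicator {thr..} u * \<bar>score u\<bar>) \<le> 32 / D * (150 * del / rt + 9)"
proof -
  let ?g = "\<lambda>u. 32 / D * (\<bar>M u - mu\<bar> + 4 / D * ((u - mu)\<^sup>2 + (17 * del + 1 / 2) * \<bar>u - mu\<bar>))"
  have g: "integrable Q ?g"
    using integrable_Q Q_second_moment(1)[of mu] by simp
  have le: "indicator {thr..} u * \<bar>score u\<bar> \<le> ?g u" for u
  proof (cases "thr \<le> u")
    case True
    then show ?thesis using score_bound[OF True] by simp
  next
    case False
    have "0 \<le> ?g u" using del_nonneg by simp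
    then show ?thesis using False by simp
  qed
  show i: "integrable Q (\<lambda>u. indicator {thr..} u * \<bar>score u\<bar>)"
    by (rule Q_integrable_bound[OF g]) (use le in \<open>auto simp: abs_mult\<close>)
  have "Q.expectation (\<lambda>u. indicator {thr..} u * \<bar>score u\<bar>) \<le> Q.expectation ?g"
    by (rule Q_mono[OF i g le])
  also have "\<dots> = 32 / D * (Q.expectation (\<lambda>u. \<bar>M u - mu\<bar>)
      + 4 / D * ((var + 2) + (17 * del + 1 / 2) * Q.expectation (\<lambda>u. \<bar>u - mu\<bar>)))"
    using integrable_Q Q_second_moment[of mu] by simp
  also have "\<dots> \<le> 32 / D * ((48 * del / rt + 1 / D) + 4 / D * (2 * D + (17 * del + 1 / 2) * (3 / 2 * rt)))"
    using M_abs_dev abs_dev(2) var_le_D big del_nonneg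
    by (intro mult_left_mono add_mono) auto
  also have "(48 * del / rt + 1 / D) + 4 / D * (2 * D + (17 * del + 1 / 2) * (3 / 2 * rt)) = 150 * del / rt + 8 + 3 / rt + 1 / D"
    using rt big by (simp add: field_simps rt(2)[symmetric])
  also have "32 / D * (150 * del / rt + 8 + 3 / rt + 1 / D) \<le> 32 / D * (150 * del / rt + 9)"
  proof (rule mult_left_mono)
    have "3 / rt \<le> 1 / 2" "1 / D \<le> 1 / 2" using rt big by (auto simp: field_simps)
    then show "150 * del / rt + 8 + 3 / rt + 1 / D \<le> 150 * del / rt + 9" by linarith
  qed simp
  finally show "Q.expectation (\<lambda>u. indicator {thr..} u * \<bar>score u\<bar>) \<le> 32 / D * (150 * del / rt + 9)" .
qed

end

section \<open>Comparison with a normal density\<close>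

lemma integrable_indicator_times:
  fixes f :: "'a \<Rightarrow> real"
  shows "A \<in> sets M \<Longrightarrow> integrable M f \<Longrightarrow> integrable M (\<lambda>u. indicator A u * f u)"
  by (rule integrable_mult_indicator[where 'b = real, simplified real_scaleR_def])

lemma sqrt_2pi_le: "sqrt (2 * pi * \<sigma>\<^sup>2) \<le> 3 * \<sigma>" if "\<sigma> > 0" for \<sigma> :: real
proof -
  have "sqrt (2 * pi * \<sigma>\<^sup>2) \<le> sqrt (3\<^sup>2 * \<sigma>\<^sup>2)"
    using pi_less_4 by (intro real_sqrt_le_mono mult_right_mono) auto
  also have "\<dots> = 3 * \<sigma>" using that by (simp add: real_sqrt_mult)
  finally show ?thesis .
qed

text \<open>If \<open>x\<close> lies between the mean and \<open>u\<close>, then \<open>(u - m)\<^sup>2 \<ge> (x - m)\<^sup>2 + (u - x)\<^sup>2\<close>. So a normal tail beyond \<open>x\<close> is at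
  most a multiple of the density at \<open>x\<close> times a full normal integral centred at \<open>x\<close>.\<close>

lemma normal_density_tail_pointwise:
  fixes m :: real
  assumes \<sigma>: "\<sigma> > 0" and xu: "m \<le> x \<and> x \<le> u \<or> u \<le> x \<and> x \<le> m"
  shows "normal_density m \<sigma> u \<le> sqrt (2 * pi * \<sigma>\<^sup>2) * normal_density m \<sigma> x * normal_density x \<sigma> u"
proof -
  have "(x - m) * (u - x) \<ge> 0" using xu by (auto simp: zero_le_mult_iff)
  then have "(x - m)\<^sup>2 + (u - x)\<^sup>2 \<le> (u - m)\<^sup>2" by (simp add: power2_eq_square algebra_simps)
  then have "((x - m)\<^sup>2 + (u - x)\<^sup>2) / (2 * \<sigma>\<^sup>2) \<le> (u - m)\<^sup>2 / (2 * \<sigma>\<^sup>2)"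
    by (rule divide_right_mono) simp
  then have "- (u - m)\<^sup>2 / (2 * \<sigma>\<^sup>2) \<le> - (x - m)\<^sup>2 / (2 * \<sigma>\<^sup>2) + - (u - x)\<^sup>2 / (2 * \<sigma>\<^sup>2)"
    by (simp add: add_divide_distrib)
  then have "exp (- (u - m)\<^sup>2 / (2 * \<sigma>\<^sup>2)) \<le> exp (- (x - m)\<^sup>2 / (2 * \<sigma>\<^sup>2)) * exp (- (u - x)\<^sup>2 / (2 * \<sigma>\<^sup>2))"
    unfolding exp_add[symmetric] exp_le_cancel_iff .
  moreover have "sqrt (2 * pi * \<sigma>\<^sup>2) > 0" using \<sigma> by simp
  ultimately show ?thesis
    unfolding normal_density_def by (simp add: field_simps)
qed

lemma normal_density_tail:
  fixes m :: real
  assumes \<sigma>: "\<sigma> > 0" and [measurable]: "T \<in> sets borel" and T: "\<And>u. u \<in> T \<Longrightarrow> m \<le> x \<and> x \<le> u \<or> u \<le> x \<and> x \<le> m"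
  shows "(\<integral>u. indicator T u * normal_density m \<sigma> u \<partial>lborel) \<le> 3 * \<sigma> * normal_density m \<sigma> x"
proof -
  have "(\<integral>u. indicator T u * normal_density m \<sigma> u \<partial>lborel)
      \<le> (\<integral>u. sqrt (2 * pi * \<sigma>\<^sup>2) * normal_density m \<sigma> x * normal_density x \<sigma> u \<partial>lborel)"
  proof (rule integral_mono)
    show "integrable lborel (\<lambda>u. indicator T u * normal_density m \<sigma> u)"
      using \<sigma> by (intro integrable_indicator_times integrable_normal_density) auto
    show "integrable lborel (\<lambda>u. sqrt (2 * pi * \<sigma>\<^sup>2) * normal_density m \<sigma> x * normal_density x \<sigma> u)"
      using \<sigma> by (intro integrable_mult_right integrable_normal_density)
    fix u
    show "indicator T u * normal_density m \<sigma> u \<le> sqrt (2 * pi * \<sigma>\<^sup>2) * normal_density m \<sigma> x * normal_density x \<sigma> u"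
      using normal_density_tail_pointwise[OF \<sigma> T, of u] \<sigma> by (cases "u \<in> T") auto
  qed
  also have "\<dots> = sqrt (2 * pi * \<sigma>\<^sup>2) * normal_density m \<sigma> x"
    using \<sigma> by simp
  also have "\<dots> \<le> 3 * \<sigma> * normal_density m \<sigma> x"
    using sqrt_2pi_le[OF \<sigma>] by (intro mult_right_mono) auto
  finally show ?thesis .
qed

lemma DERIV_normal_density:
  assumes "\<sigma> > 0"
  shows "(normal_density m \<sigma> has_real_derivative - ((u - m) / \<sigma>\<^sup>2) * normal_density m \<sigma> u) (at u)"
proof -
  have "((\<lambda>u. - (u - m)\<^sup>2 / (2 * \<sigma>\<^sup>2)) has_real_derivative - ((u - m) / \<sigma>\<^sup>2)) (at u)"
    using assms by (auto intro!: derivative_eq_intros simp: field_simps power2_eq_square)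
  from DERIV_cmult[OF DERIV_chain2[OF DERIV_exp this], of "1 / sqrt (2 * pi * \<sigma>\<^sup>2)"]
  show ?thesis unfolding normal_density_def by (rule DERIV_cong) (simp add: mult_ac)
qed

text \<open>Divided by the density at \<open>x\<close>, the integral is, up to a constant factor, the solution at \<open>x\<close> of Stein's equation for the set \<open>A\<close>. Since the centred indicator
  has total integral 0, the integral over the upper tail may be replaced by the one over the lower tail when \<open>x < m\<close>.\<close>

lemma stein_tail_bound:
  fixes m :: real
  assumes \<sigma>: "\<sigma> > 0" and [measurable]: "A \<in> sets borel"
  defines "p \<equiv> (\<integral>u. indicator A u * normal_density m \<sigma> u \<partial>lborel)"
  shows "\<bar>\<integral>u. indicator {x..} u * ((indicator A u - p) * normal_density m \<sigma> u) \<partial>lborel\<bar> \<le> 3 * \<sigma> * normal_density m \<sigma> x"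
proof -
  let ?\<gamma> = "normal_density m \<sigma>"
  have i\<gamma>: "integrable lborel ?\<gamma>" using \<sigma> by (rule integrable_normal_density)
  have iT: "integrable lborel (\<lambda>u. indicator T u * ?\<gamma> u)" if "T \<in> sets borel" for T
    using that i\<gamma> by (intro integrable_indicator_times) auto
  have p01: "0 \<le> p" "p \<le> 1"
  proof -
    show "0 \<le> p" unfolding p_def by (rule integral_nonneg_AE) simp
    have "p \<le> (\<integral>u. ?\<gamma> u \<partial>lborel)" unfolding p_def
      using iT[of A] i\<gamma> by (intro integral_mono) (auto simp: indicator_def)
    then show "p \<le> 1" using \<sigma> by simp
  qed
  define h where "h u = (indicator A u - p) * ?\<gamma> u" for u
  have hm [measurable]: "h \<in> borel_measurable borel" unfolding h_def by measurable
  have habs: "\<bar>h u\<bar> \<le> ?\<gamma> u" for u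
  proof -
    have "\<bar>indicator A u - p\<bar> \<le> 1" using p01 by (auto simp: indicator_def)
    then have "\<bar>indicator A u - p\<bar> * ?\<gamma> u \<le> 1 * ?\<gamma> u" by (rule mult_right_mono) simp
    then show ?thesis by (simp add: h_def abs_mult)
  qed
  have ih: "integrable lborel h"
    by (rule Bochner_Integration.integrable_bound[OF i\<gamma>]) (use habs in auto)
  have iTh: "integrable lborel (\<lambda>u. indicator T u * h u)" if "T \<in> sets borel" for T
    using that ih by (intro integrable_indicator_times) auto
  have bound: "\<bar>\<integral>u. indicator T u * h u \<partial>lborel\<bar> \<le> 3 * \<sigma> * ?\<gamma> x"
    if T: "T \<in> sets borel" "\<And>u. u \<in> T \<Longrightarrow> m \<le> x \<and> x \<le> u \<or> u \<le> x \<and> x \<le> m" for T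
  proof -
    have "\<bar>\<integral>u. indicator T u * h u \<partial>lborel\<bar> \<le> (\<integral>u. \<bar>indicator T u * h u\<bar> \<partial>lborel)"
      by (rule integral_abs_bound)
    also have "\<dots> \<le> (\<integral>u. indicator T u * ?\<gamma> u \<partial>lborel)"
      using iTh[OF T(1)] iT[OF T(1)] habs by (intro integral_mono) (auto simp: indicator_def)
    also have "\<dots> \<le> 3 * \<sigma> * ?\<gamma> x" by (rule normal_density_tail[OF \<sigma> T])
    finally show ?thesis .
  qed
  have tot: "(\<integral>u. h u \<partial>lborel) = 0"
  proof -
    have "h u = indicator A u * ?\<gamma> u - p * ?\<gamma> u" for u by (simp add: h_def left_diff_distrib)
    then have "(\<integral>u. h u \<partial>lborel) = p - p * 1"
      using iT[of A] i\<gamma> \<sigma> by (simp add: p_def)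
    then show ?thesis by simp
  qed
  have "\<bar>\<integral>u. indicator {x..} u * h u \<partial>lborel\<bar> \<le> 3 * \<sigma> * ?\<gamma> x"
  proof (cases "m \<le> x")
    case True
    then show ?thesis by (intro bound) auto
  next
    case False
    have "(\<integral>u. indicator {x..} u * h u \<partial>lborel) + (\<integral>u. indicator {..<x} u * h u \<partial>lborel) = (\<integral>u. h u \<partial>lborel)"
    proof (subst Bochner_Integration.integral_add[symmetric])
      show "(\<integral>u. indicator {x..} u * h u + indicator {..<x} u * h u \<partial>lborel) = (\<integral>u. h u \<partial>lborel)"
        by (intro Bochner_Integration.integral_cong) (auto simp: indicator_def)
    qed (auto intro: iTh)
    then have "\<bar>\<integral>u. indicator {x..} u * h u \<partial>lborel\<bar> = \<bar>\<integral>u. indicator {..<x} u * h u \<partial>lborel\<bar>"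
      using tot by linarith
    also have "\<dots> \<le> 3 * \<sigma> * ?\<gamma> x" using False by (intro bound) auto
    finally show ?thesis .
  qed
  then show ?thesis unfolding h_def .
qed

text \<open>Stein's method for a density \<open>f\<close> on \<open>[a, \<infinity>)\<close> whose logarithmic derivative differs by \<open>sc\<close> from that of the normal density \<open>\<gamma>\<close>.
  The ratio \<open>r = f / \<gamma>\<close> satisfies \<open>r' = r * sc\<close>, so \<open>f u = \<gamma> u * (r a + integral of r * sc over [a, u])\<close>. Multiply by
  \<open>1\<^sub>A - p\<close>, integrate and exchange the integrals: the inner integral becomes a tail of the centred indicator, at most \<open>3 * \<sigma> * \<gamma> x\<close>, and
  \<open>r * \<gamma> = f\<close>.\<close>

theorem gaussian_comparison:
  fixes f sc :: "real \<Rightarrow> real" and m :: real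
  assumes \<sigma>: "\<sigma> > 0" and A [measurable]: "A \<in> sets borel"
    and [measurable]: "f \<in> borel_measurable borel" "sc \<in> borel_measurable borel"
    and f0: "\<And>u. u \<ge> a \<Longrightarrow> f u \<ge> 0"
    and df: "\<And>u. u \<ge> a \<Longrightarrow> (f has_real_derivative f u * (sc u - (u - m) / \<sigma>\<^sup>2)) (at u)"
    and csc: "continuous_on {a..} sc"
    and isc: "integrable lborel (\<lambda>u. indicator {a..} u * (f u * \<bar>sc u\<bar>))"
  defines "p \<equiv> (\<integral>u. indicator A u * normal_density m \<sigma> u \<partial>lborel)"
  assumes iff: "integrable lborel (\<lambda>u. indicator {a..} u * f u)"
  shows "\<bar>\<integral>u. indicator {a..} u * ((indicator A u - p) * f u) \<partial>lborel\<bar>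
     \<le> 3 * \<sigma> * (f a + (\<integral>u. indicator {a..} u * (f u * \<bar>sc u\<bar>) \<partial>lborel))"
proof -
  let ?\<gamma> = "normal_density m \<sigma>"
  have \<gamma>0: "?\<gamma> u > 0" for u using \<sigma> by (rule normal_density_pos)
  define h where "h u = (indicator A u - p) * ?\<gamma> u" for u
  define H where "H x = (\<integral>u. indicator {x..} u * h u \<partial>lborel)" for x
  have H: "\<bar>H x\<bar> \<le> 3 * \<sigma> * ?\<gamma> x" for x
    unfolding H_def h_def p_def by (rule stein_tail_bound[OF \<sigma> A])
  have i\<gamma>: "integrable lborel ?\<gamma>" using \<sigma> by (rule integrable_normal_density)
  have p01: "0 \<le> p" "p \<le> 1"
  proof -
    show "0 \<le> p" unfolding p_def by (rule integral_nonneg_AE) simp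
    have "integrable lborel (\<lambda>u. indicator A u * ?\<gamma> u)"
      using i\<gamma> by (intro integrable_indicator_times) auto
    then have "p \<le> (\<integral>u. ?\<gamma> u \<partial>lborel)" unfolding p_def
      using i\<gamma> by (intro integral_mono) (auto simp: indicator_def)
    then show "p \<le> 1" using \<sigma> by simp
  qed
  have hm [measurable]: "h \<in> borel_measurable borel" unfolding h_def by measurable
  have habs: "\<bar>h u\<bar> \<le> ?\<gamma> u" for u
  proof -
    have "\<bar>indicator A u - p\<bar> \<le> 1" using p01 by (auto simp: indicator_def)
    then have "\<bar>indicator A u - p\<bar> * ?\<gamma> u \<le> 1 * ?\<gamma> u" by (rule mult_right_mono) simp
    then show ?thesis by (simp add: h_def abs_mult)
  qed
  define r where "r u = f u / ?\<gamma> u" for u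
  define g where "g x = indicator {a..} x * (r x * sc x)" for x
  have gm [measurable]: "g \<in> borel_measurable borel" unfolding g_def r_def by measurable
  have dr: "(r has_real_derivative r u * sc u) (at u)" if u: "u \<ge> a" for u
  proof -
    have "(r has_real_derivative (f u * (sc u - (u - m) / \<sigma>\<^sup>2) * ?\<gamma> u - f u * (- ((u - m) / \<sigma>\<^sup>2) * ?\<gamma> u)) / (?\<gamma> u * ?\<gamma> u)) (at u)"
      unfolding r_def using \<gamma>0[of u] by (intro DERIV_divide df u DERIV_normal_density \<sigma>) simp
    moreover have "(f u * (sc u - (u - m) / \<sigma>\<^sup>2) * ?\<gamma> u - f u * (- ((u - m) / \<sigma>\<^sup>2) * ?\<gamma> u)) / (?\<gamma> u * ?\<gamma> u) = r u * sc u"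
    proof -
      have "f u * (sc u - (u - m) / \<sigma>\<^sup>2) * ?\<gamma> u - f u * (- ((u - m) / \<sigma>\<^sup>2) * ?\<gamma> u) = f u * sc u * ?\<gamma> u"
        by (simp add: algebra_simps)
      then show ?thesis using \<gamma>0[of u] by (simp add: r_def)
    qed
    ultimately show ?thesis by simp
  qed
  have cr: "continuous_on {a..} r"
    by (intro continuous_at_imp_continuous_on ballI DERIV_isCont[OF dr]) simp
  have ftc: "(\<integral>x. indicator {..u} x * g x \<partial>lborel) = r u - r a" if u: "u \<ge> a" for u
  proof -
    have "(\<integral>x. indicator {a..u} x *\<^sub>R (r x * sc x) \<partial>lborel) = r u - r a"
    proof (rule integral_FTC_Icc[OF u])
      show "(r has_vector_derivative r x * sc x) (at x within {a..u})" if "a \<le> x" "x \<le> u" for x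
        using dr[OF that(1)] by (auto simp: has_real_derivative_iff_has_vector_derivative intro: has_vector_derivative_at_within)
      show "continuous_on {a..u} (\<lambda>x. r x * sc x)"
        by (intro continuous_on_mult continuous_on_subset[OF cr] continuous_on_subset[OF csc]) auto
    qed
    moreover have "indicator {a..u} x *\<^sub>R (r x * sc x) = indicator {..u} x * g x" for x
      by (auto simp: g_def indicator_def)
    ultimately show ?thesis by simp
  qed
  have fr: "f u = r u * ?\<gamma> u" for u using \<gamma>0[of u] by (simp add: r_def)
  have g\<gamma>: "\<bar>g x\<bar> * ?\<gamma> x = indicator {a..} x * (f x * \<bar>sc x\<bar>)" for x
    using \<gamma>0[of x] f0[of x] by (auto simp: g_def r_def indicator_def abs_mult)
  \<comment> \<open>A crude constant: this tail bound for \<open>x \<ge> a\<close> only serves to justify the exchange of the integrals.\<close>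
  define C where "C = max (3 * \<sigma>) (1 / ?\<gamma> a)"
  have tail: "(\<integral>u. indicator {x..} u * ?\<gamma> u \<partial>lborel) \<le> C * ?\<gamma> x" if x: "x \<ge> a" for x
  proof (cases "m \<le> x")
    case True
    have "(\<integral>u. indicator {x..} u * ?\<gamma> u \<partial>lborel) \<le> 3 * \<sigma> * ?\<gamma> x"
      using True by (intro normal_density_tail[OF \<sigma>]) auto
    also have "\<dots> \<le> C * ?\<gamma> x" unfolding C_def by (intro mult_right_mono) auto
    finally show ?thesis .
  next
    case False
    have "(\<integral>u. indicator {x..} u * ?\<gamma> u \<partial>lborel) \<le> (\<integral>u. ?\<gamma> u \<partial>lborel)"
      using i\<gamma> by (intro integral_mono integrable_indicator_times) (auto simp: indicator_def)
    also have "\<dots> = 1" using \<sigma> by simp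
    also have "1 \<le> 1 / ?\<gamma> a * ?\<gamma> x"
    proof -
      have "(m - x)\<^sup>2 \<le> (m - a)\<^sup>2" using x False by (intro power_mono) auto
      then have "(x - m)\<^sup>2 \<le> (a - m)\<^sup>2" by (simp only: power2_commute)
      then have "?\<gamma> a \<le> ?\<gamma> x" using \<sigma> unfolding normal_density_def
        by (intro mult_left_mono) (auto simp: divide_right_mono)
      then show ?thesis using \<gamma>0[of a] by simp
    qed
    also have "\<dots> \<le> C * ?\<gamma> x" unfolding C_def by (intro mult_right_mono) auto
    finally show ?thesis .
  qed
  have ik: "integrable (lborel \<Otimes>\<^sub>M lborel) (\<lambda>(x, u). g x * (indicator {x..} u * h u))"
  proof (rule lborel_pair.Fubini_integrable)
    have "(\<lambda>p. g (fst p) * ((if fst p \<le> snd p then 1 else 0) * h (snd p))) \<in> borel_measurable (lborel \<Otimes>\<^sub>M lborel)"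
      by measurable
    then show "(\<lambda>(x, u). g x * (indicator {x..} u * h u)) \<in> borel_measurable (lborel \<Otimes>\<^sub>M lborel)"
      by (simp add: case_prod_beta' indicator_def)
    have inner: "integrable lborel (\<lambda>u. g x * (indicator {x..} u * h u))" for x
      by (rule Bochner_Integration.integrable_bound[OF integrable_mult_right[OF i\<gamma>, of "g x"]])
        (use habs in \<open>auto simp: abs_mult indicator_def intro!: mult_left_mono\<close>)
    then show "AE x in lborel. integrable lborel (\<lambda>u. case (x, u) of (x, u) \<Rightarrow> g x * (indicator {x..} u * h u))" by simp
    show "integrable lborel (\<lambda>x. \<integral>u. norm (case (x, u) of (x, u) \<Rightarrow> g x * (indicator {x..} u * h u)) \<partial>lborel)"
    proof (rule Bochner_Integration.integrable_bound[OF integrable_mult_right[OF isc, of C]])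
      have "(\<lambda>p. g (fst p) * ((if fst p \<le> snd p then 1 else 0) * h (snd p))) \<in> borel_measurable (lborel \<Otimes>\<^sub>M lborel)"
        by measurable
      then have "(\<lambda>p. norm (g (fst p) * ((if fst p \<le> snd p then 1 else 0) * h (snd p)))) \<in> borel_measurable (lborel \<Otimes>\<^sub>M lborel)"
        by measurable
      then have "(\<lambda>x. \<integral>u. norm (g x * ((if x \<le> u then 1 else 0) * h u)) \<partial>lborel) \<in> borel_measurable lborel"
        by (intro lborel.borel_measurable_lebesgue_integral) (simp add: case_prod_beta')
      then show "(\<lambda>x. \<integral>u. norm (case (x, u) of (x, u) \<Rightarrow> g x * (indicator {x..} u * h u)) \<partial>lborel) \<in> borel_measurable lborel"
        by (simp add: indicator_def)
      have "norm (\<integral>u. norm (g x * (indicator {x..} u * h u)) \<partial>lborel) \<le> norm (C * (indicator {a..} x * (f x * \<bar>sc x\<bar>)))" for x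
      proof (cases "x \<ge> a")
        case True
        have "(\<integral>u. norm (g x * (indicator {x..} u * h u)) \<partial>lborel) \<le> (\<integral>u. \<bar>g x\<bar> * (indicator {x..} u * ?\<gamma> u) \<partial>lborel)"
        proof (rule integral_mono)
          show "integrable lborel (\<lambda>u. norm (g x * (indicator {x..} u * h u)))" using inner by (rule integrable_norm)
          show "integrable lborel (\<lambda>u. \<bar>g x\<bar> * (indicator {x..} u * ?\<gamma> u))"
            using i\<gamma> by (intro integrable_mult_right integrable_indicator_times) auto
          show "norm (g x * (indicator {x..} u * h u)) \<le> \<bar>g x\<bar> * (indicator {x..} u * ?\<gamma> u)" for u
            using habs[of u] by (auto simp: abs_mult indicator_def intro!: mult_left_mono)
        qed
        also have "\<dots> = \<bar>g x\<bar> * (\<integral>u. indicator {x..} u * ?\<gamma> u \<partial>lborel)" by simp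
        also have "\<dots> \<le> \<bar>g x\<bar> * (C * ?\<gamma> x)" by (rule mult_left_mono[OF tail[OF True]]) simp
        also have "\<dots> = C * (indicator {a..} x * (f x * \<bar>sc x\<bar>))" using g\<gamma>[of x] by (simp add: mult_ac)
        finally show ?thesis by (simp add: integral_nonneg_AE)
      next
        case False
        then show ?thesis by (simp add: g_def)
      qed
      then show "AE x in lborel. norm (\<integral>u. norm (case (x, u) of (x, u) \<Rightarrow> g x * (indicator {x..} u * h u)) \<partial>lborel)
          \<le> norm (C * (indicator {a..} x * (f x * \<bar>sc x\<bar>)))" by simp
    qed
  qed
  have "(\<integral>u. (\<integral>x. g x * (indicator {x..} u * h u) \<partial>lborel) \<partial>lborel) = (\<integral>x. (\<integral>u. g x * (indicator {x..} u * h u) \<partial>lborel) \<partial>lborel)"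
    by (rule lborel_pair.Fubini_integral[OF ik])
  moreover have "(\<integral>x. g x * (indicator {x..} u * h u) \<partial>lborel) = indicator {a..} u * (h u * (r u - r a))" for u
  proof -
    have "(\<integral>x. g x * (indicator {x..} u * h u) \<partial>lborel) = (\<integral>x. (indicator {..u} x * g x) * h u \<partial>lborel)"
      by (intro Bochner_Integration.integral_cong) (auto simp: indicator_def)
    also have "\<dots> = (\<integral>x. indicator {..u} x * g x \<partial>lborel) * h u" by simp
    also have "\<dots> = indicator {a..} u * (h u * (r u - r a))"
    proof (cases "u \<ge> a")
      case True then show ?thesis using ftc[OF True] by simp
    next
      case False
      then have z: "indicator {..u} x * g x = 0" for x by (auto simp: g_def indicator_def)
      show ?thesis using False by (simp only: z) simp
    qed
    finally show ?thesis .
  qed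
  ultimately have swap: "(\<integral>u. indicator {a..} u * (h u * (r u - r a)) \<partial>lborel) = (\<integral>x. g x * H x \<partial>lborel)"
    by (simp add: H_def)
  have ihr: "integrable lborel (\<lambda>u. indicator {a..} u * (h u * r u))"
  proof (rule Bochner_Integration.integrable_bound[OF iff])
    show "(\<lambda>u. indicator {a..} u * (h u * r u)) \<in> borel_measurable lborel" unfolding r_def by measurable
    have "\<bar>h u * r u\<bar> \<le> f u" if "u \<ge> a" for u
    proof -
      have "r u \<ge> 0" using f0[OF that] \<gamma>0[of u] by (simp add: r_def)
      then have "\<bar>h u\<bar> * r u \<le> ?\<gamma> u * r u" by (intro mult_right_mono habs)
      then show ?thesis using \<open>r u \<ge> 0\<close> by (simp add: abs_mult fr mult.commute)
    qed
    then show "AE u in lborel. norm (indicator {a..} u * (h u * r u)) \<le> norm (indicator {a..} u * f u)"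
      using f0 by (auto simp: indicator_def)
  qed
  have ih: "integrable lborel (\<lambda>u. indicator {a..} u * h u)"
    by (rule Bochner_Integration.integrable_bound[OF i\<gamma>]) (use habs in \<open>auto simp: indicator_def\<close>)
  have "(\<integral>u. indicator {a..} u * (h u * (r u - r a)) \<partial>lborel)
      = (\<integral>u. indicator {a..} u * (h u * r u) - r a * (indicator {a..} u * h u) \<partial>lborel)"
    by (intro Bochner_Integration.integral_cong) (auto simp: algebra_simps)
  also have "\<dots> = (\<integral>u. indicator {a..} u * (h u * r u) \<partial>lborel) - r a * H a"
    using ihr ih by (simp add: H_def)
  finally have "(\<integral>u. indicator {a..} u * (h u * r u) \<partial>lborel) = r a * H a + (\<integral>x. g x * H x \<partial>lborel)"
    using swap by simp
  moreover have "(\<integral>u. indicator {a..} u * ((indicator A u - p) * f u) \<partial>lborel) = (\<integral>u. indicator {a..} u * (h u * r u) \<partial>lborel)"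
    by (intro Bochner_Integration.integral_cong) (auto simp: h_def fr)
  moreover have "\<bar>r a * H a\<bar> \<le> 3 * \<sigma> * f a"
  proof -
    have ra: "r a \<ge> 0" using f0[of a] \<gamma>0[of a] by (simp add: r_def)
    have "\<bar>r a * H a\<bar> = r a * \<bar>H a\<bar>" using ra by (simp add: abs_mult)
    also have "\<dots> \<le> r a * (3 * \<sigma> * ?\<gamma> a)" by (rule mult_left_mono[OF H ra])
    finally show ?thesis by (simp add: fr[of a] mult_ac)
  qed
  moreover have "\<bar>\<integral>x. g x * H x \<partial>lborel\<bar> \<le> 3 * \<sigma> * (\<integral>u. indicator {a..} u * (f u * \<bar>sc u\<bar>) \<partial>lborel)"
  proof -
    have "\<bar>\<integral>x. g x * H x \<partial>lborel\<bar> \<le> (\<integral>x. \<bar>g x * H x\<bar> \<partial>lborel)"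
      by (rule integral_abs_bound)
    also have "\<dots> \<le> (\<integral>x. 3 * \<sigma> * (indicator {a..} x * (f x * \<bar>sc x\<bar>)) \<partial>lborel)"
    proof (rule integral_mono)
      have "integrable lborel (\<lambda>x. \<integral>u. g x * (indicator {x..} u * h u) \<partial>lborel)"
        using lborel_pair.integrable_fst[OF ik] by simp
      then show "integrable lborel (\<lambda>x. \<bar>g x * H x\<bar>)" by (simp add: H_def)
      show "integrable lborel (\<lambda>x. 3 * \<sigma> * (indicator {a..} x * (f x * \<bar>sc x\<bar>)))"
        by (rule integrable_mult_right[OF isc])
      fix x
      have "\<bar>g x * H x\<bar> \<le> \<bar>g x\<bar> * (3 * \<sigma> * ?\<gamma> x)"
        unfolding abs_mult by (rule mult_left_mono[OF H]) simp
      also have "\<bar>g x\<bar> * (3 * \<sigma> * ?\<gamma> x) = 3 * \<sigma> * (\<bar>g x\<bar> * ?\<gamma> x)" by simp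
      finally show "\<bar>g x * H x\<bar> \<le> 3 * \<sigma> * (indicator {a..} x * (f x * \<bar>sc x\<bar>))"
        unfolding g\<gamma> .
    qed
    finally show ?thesis by simp
  qed
  ultimately show ?thesis by (simp add: distrib_left)
qed

section \<open>The law of the squared distance\<close>

context steiner_bulk
begin

lemma qq_thr: "qq thr \<le> eta"
  using qd_low[of thr] thr_pos eta_pos by (simp add: qd_qq mult_left_le order_trans)

lemma Q_expectation_lborel:
  assumes [measurable]: "f \<in> borel_measurable borel"
  shows "Q.expectation f = (\<integral>u. qd u * f u \<partial>lborel)"
    "integrable Q f \<longleftrightarrow> integrable lborel (\<lambda>u. qd u * f u)"
  unfolding Q_def using qd_nonneg by (auto simp: integral_real_density integrable_real_density)

text \<open>The boundary term of the comparison is \<open>qq thr\<close>, which is at most \<open>eta\<close>.\<close>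

lemma score_comparison:
  assumes A [measurable]: "A \<in> sets borel"
  defines "p \<equiv> (\<integral>u. indicator A u * normal_density mu (sqrt var) u \<partial>lborel)"
  shows "\<bar>Q.expectation (\<lambda>u. indicator {thr..} u * (indicator A u - p))\<bar>
    \<le> 3 * sqrt var * (eta + Q.expectation (\<lambda>u. indicator {thr..} u * \<bar>score u\<bar>))"
proof -
  have e1: "indicator {thr..} u * (qq u * \<bar>score u\<bar>) = qd u * (indicator {thr..} u * \<bar>score u\<bar>)" for u
    using thr_pos by (auto simp: qd_qq indicator_def)
  have e2: "indicator {thr..} u * qq u = qd u * indicator {thr..} u" for u
    using thr_pos by (auto simp: qd_qq indicator_def)
  have e3: "indicator {thr..} u * ((indicator A u - p) * qq u) = qd u * (indicator {thr..} u * (indicator A u - p))" for u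
    using thr_pos by (auto simp: qd_qq indicator_def)
  have v: "sqrt var > 0" "(sqrt var)\<^sup>2 = var" using var_pos by auto
  have "\<bar>\<integral>u. indicator {thr..} u * ((indicator A u - p) * qq u) \<partial>lborel\<bar>
      \<le> 3 * sqrt var * (qq thr + (\<integral>u. indicator {thr..} u * (qq u * \<bar>score u\<bar>) \<partial>lborel))"
    unfolding p_def
  proof (rule gaussian_comparison[OF v(1) A])
    show "qq u \<ge> 0" if "u \<ge> thr" for u using that thr_pos by (intro qq_nonneg) simp
    show "(qq has_real_derivative qq u * (score u - (u - mu) / (sqrt var)\<^sup>2)) (at u)" if "u \<ge> thr" for u
      using DERIV_qq[of u] that thr_pos unfolding v(2) score_def by simp
    show "continuous_on {thr..} score"
      unfolding score_def
    proof (intro continuous_on_add continuous_on_diff continuous_on_divide continuous_on_id continuous_on_const)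
      show "continuous_on {thr..} M"
      proof (intro continuous_at_imp_continuous_on ballI)
        fix u assume "u \<in> {thr..}"
        then have "u > 0" using thr_pos by simp
        then show "isCont M u" by (intro DERIV_isCont[OF DERIV_M])
      qed
      show "\<forall>u\<in>{thr..}. u \<noteq> 0" using thr_pos by auto
      show "\<forall>u\<in>{thr..}. var \<noteq> 0" using var_pos by auto
    qed
    show "integrable lborel (\<lambda>u. indicator {thr..} u * (qq u * \<bar>score u\<bar>))"
      unfolding e1 using score_expectation(1) by (subst (asm) Q_expectation_lborel(2)) auto
    have "integrable Q (\<lambda>u. indicator {thr..} u :: real)"
      by (rule Q.integrable_const_bound[where B = 1]) auto
    then show "integrable lborel (\<lambda>u. indicator {thr..} u * qq u)"
      unfolding e2 by (subst (asm) Q_expectation_lborel(2)) auto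
  qed measurable
  also have "\<dots> \<le> 3 * sqrt var * (eta + (\<integral>u. indicator {thr..} u * (qq u * \<bar>score u\<bar>) \<partial>lborel))"
    using qq_thr var_pos by (intro mult_left_mono add_right_mono) auto
  finally show ?thesis
    unfolding e1 e3 by (subst (1 2) Q_expectation_lborel(1)) auto
qed

text \<open>Removing an independent exponential summand from the law \<open>Q\<close> adds to the distribution function its derivative \<open>qq\<close>. So above the threshold the law \<open>L\<close>
  has density \<open>qd + qq'\<close>, which is \<open>qd u * (M u / u)\<close>.\<close>

lemma law_on_bulk:
  assumes L: "prob_space L" "sets L = sets borel"
    and cdf: "\<And>y. y > 0 \<Longrightarrow> measure L {..y} = (\<integral>u. indicator {..y} u * qd u \<partial>lborel) + qq y"
    and A [measurable]: "A \<in> sets borel"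
  shows "measure L (A \<inter> {thr<..}) = Q.expectation (\<lambda>u. indicator {thr..} u * (indicator A u * (M u / u)))"
    and "integrable Q (\<lambda>u. indicator {thr..} u * (indicator A u * (M u / u)))"
proof -
  interpret L: prob_space L by (rule L(1))
  have spL: "space L = UNIV" using sets_eq_imp_space_eq[OF L(2)] by simp
  define \<rho> where "\<rho> u = indicator {thr<..} u * (qd u * (M u / u))" for u
  have \<rho>m [measurable]: "\<rho> \<in> borel_measurable borel" unfolding \<rho>_def by measurable
  have \<rho>0: "\<rho> u \<ge> 0" for u
    using qd_nonneg[of u] M_nonneg[of u] thr_pos by (auto simp: \<rho>_def indicator_def)
  have iQ: "integrable Q (\<lambda>u. indicator {thr..} u * (indicator B u * (M u / u)))" if [measurable]: "B \<in> sets borel" for B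
  proof (rule Q.integrable_const_bound[where B = "D / 2 / thr"])
    have "norm (indicator {thr..} u * (indicator B u * (M u / u))) \<le> D / 2 / thr" for u
    proof (cases "u \<ge> thr \<and> u \<in> B")
      case True
      have "M u / u \<le> D / 2 / thr" using True thr_pos M_le[of u] M_nonneg[of u] by (intro frac_le) auto
      then show ?thesis using True M_nonneg[of u] thr_pos by simp
    next
      case False
      then show ?thesis using thr_pos by (auto simp: indicator_def)
    qed
    then show "AE u in Q. norm (indicator {thr..} u * (indicator B u * (M u / u))) \<le> D / 2 / thr" by simp
  qed simp
  then show "integrable Q (\<lambda>u. indicator {thr..} u * (indicator A u * (M u / u)))" by simp
  have AEthr: "AE u in lborel. u \<noteq> thr" by (rule AE_lborel_singleton)
  have i\<rho>B: "integrable lborel (\<lambda>u. indicator B u * \<rho> u)"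
    and e\<rho>: "(\<integral>u. indicator B u * \<rho> u \<partial>lborel) = Q.expectation (\<lambda>u. indicator {thr..} u * (indicator B u * (M u / u)))"
    if [measurable]: "B \<in> sets borel" for B
  proof -
    have AE: "AE u in lborel. qd u * (indicator {thr..} u * (indicator B u * (M u / u))) = indicator B u * \<rho> u"
      using AEthr by eventually_elim (auto simp: \<rho>_def indicator_def)
    have i: "integrable lborel (\<lambda>u. qd u * (indicator {thr..} u * (indicator B u * (M u / u))))"
      using iQ[OF that] by (subst (asm) Q_expectation_lborel(2)) auto
    show "integrable lborel (\<lambda>u. indicator B u * \<rho> u)"
      using i by (rule integrable_cong_AE_imp) (use AE in \<open>auto elim: eventually_mono\<close>)
    show "(\<integral>u. indicator B u * \<rho> u \<partial>lborel) = Q.expectation (\<lambda>u. indicator {thr..} u * (indicator B u * (M u / u)))"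
    proof (rule sym)
      have "Q.expectation (\<lambda>u. indicator {thr..} u * (indicator B u * (M u / u)))
          = (\<integral>u. qd u * (indicator {thr..} u * (indicator B u * (M u / u))) \<partial>lborel)"
        by (rule Q_expectation_lborel(1)) measurable
      also have "\<dots> = (\<integral>u. indicator B u * \<rho> u \<partial>lborel)"
        by (rule integral_cong_AE[OF _ _ AE]) measurable
      finally show "Q.expectation (\<lambda>u. indicator {thr..} u * (indicator B u * (M u / u))) = (\<integral>u. indicator B u * \<rho> u \<partial>lborel)" .
    qed
  qed
  define N1 where "N1 = density L (indicator {thr<..})"
  define N2 where "N2 = density lborel (\<lambda>u. ennreal (\<rho> u))"
  have m1: "measure N1 B = measure L (B \<inter> {thr<..})" if "B \<in> sets borel" for B
    using that L(2) unfolding N1_def measure_def by (subst emeasure_restricted) (auto simp: Int_commute)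
  have em2: "emeasure N2 B = ennreal (\<integral>u. indicator B u * \<rho> u \<partial>lborel)" if [measurable]: "B \<in> sets borel" for B
  proof -
    have "emeasure N2 B = (\<integral>\<^sup>+u. ennreal (\<rho> u) * indicator B u \<partial>lborel)"
      unfolding N2_def by (rule emeasure_density) auto
    also have "\<dots> = (\<integral>\<^sup>+u. ennreal (indicator B u * \<rho> u) \<partial>lborel)"
      by (intro nn_integral_cong) (auto simp: indicator_def)
    also have "\<dots> = ennreal (\<integral>u. indicator B u * \<rho> u \<partial>lborel)"
      using \<rho>0 by (intro nn_integral_eq_integral i\<rho>B) auto
    finally show ?thesis .
  qed
  have m2: "measure N2 B = (\<integral>u. indicator B u * \<rho> u \<partial>lborel)" if [measurable]: "B \<in> sets borel" for B
    unfolding measure_def em2[OF that] using \<rho>0 by (intro enn2real_ennreal integral_nonneg_AE) auto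
  have f1: "finite_borel_measure N1"
  proof (intro finite_borel_measure.intro finite_measureI finite_borel_measure_axioms.intro)
    have "emeasure N1 (space N1) = emeasure L {thr<..}"
      using L(2) spL unfolding N1_def by (simp add: emeasure_restricted)
    then show "emeasure N1 (space N1) \<noteq> \<infinity>" by (simp add: L.emeasure_eq_measure)
    show "sets N1 = sets borel" using L(2) by (simp add: N1_def)
  qed
  have f2: "finite_borel_measure N2"
  proof (intro finite_borel_measure.intro finite_measureI finite_borel_measure_axioms.intro)
    show "emeasure N2 (space N2) \<noteq> \<infinity>" using em2[of UNIV] by (simp add: N2_def)
    show "sets N2 = sets borel" by (simp add: N2_def)
  qed
  have "cdf N1 = cdf N2"
  proof
    fix x
    show "cdf N1 x = cdf N2 x"
    proof (cases "x \<le> thr")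
      case True
      then have z: "{..x} \<inter> {thr<..} = {}" "\<And>u. indicator {..x} u * \<rho> u = 0"
        by (auto simp: \<rho>_def indicator_def)
      have "cdf N1 x = 0" unfolding cdf_def2 m1[of "{..x}", simplified] z(1) by simp
      moreover have "cdf N2 x = 0" unfolding cdf_def2 m2[of "{..x}", simplified] z(2) by simp
      ultimately show ?thesis by simp
    next
      case False
      then have x: "thr < x" by simp
      have x0: "x > 0" using x thr_pos by simp
      have "{..x} \<inter> {thr<..} = {..x} - {..thr}" by auto
      then have "cdf N1 x = measure L ({..x} - {..thr})" unfolding cdf_def2 by (simp add: m1)
      also have "\<dots> = measure L {..x} - measure L {..thr}"
        using x L(2) by (intro L.finite_measure_Diff) auto
      also have "\<dots> = ((\<integral>u. indicator {..x} u * qd u \<partial>lborel) - (\<integral>u. indicator {..thr} u * qd u \<partial>lborel)) + (qq x - qq thr)"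
        using cdf[OF x0] cdf[OF thr_pos] by simp
      also have "qq x - qq thr = (\<integral>u. indicator {thr..x} u *\<^sub>R (qq u * (M u / u - 1)) \<partial>lborel)"
      proof (rule integral_FTC_Icc[symmetric])
        show "thr \<le> x" using x by simp
        show "(qq has_vector_derivative qq u * (M u / u - 1)) (at u within {thr..x})" if "thr \<le> u" "u \<le> x" for u
          using DERIV_qq[of u] that thr_pos
          by (auto simp: has_real_derivative_iff_has_vector_derivative intro: has_vector_derivative_at_within)
        show "continuous_on {thr..x} (\<lambda>u. qq u * (M u / u - 1))"
        proof (intro continuous_intros)
          show "continuous_on {thr..x} qq"
            by (intro continuous_at_imp_continuous_on ballI DERIV_isCont[OF DERIV_qq]) (use thr_pos in auto)
          show "continuous_on {thr..x} M"
            by (intro continuous_at_imp_continuous_on ballI DERIV_isCont[OF DERIV_M]) (use thr_pos in auto)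
        qed (use thr_pos in auto)
      qed
      also have "(\<integral>u. indicator {..x} u * qd u \<partial>lborel) - (\<integral>u. indicator {..thr} u * qd u \<partial>lborel)
          = (\<integral>u. indicator {..x} u * qd u - indicator {..thr} u * qd u \<partial>lborel)"
      proof (rule Bochner_Integration.integral_diff[symmetric])
        have "integrable lborel qd" using moments(1) by (simp add: has_bochner_integral_iff)
        then show "integrable lborel (\<lambda>u. indicator {..x} u * qd u)" "integrable lborel (\<lambda>u. indicator {..thr} u * qd u)"
          by (auto intro: integrable_indicator_times)
      qed
      also have "\<dots> = (\<integral>u. indicator {thr<..x} u * qd u \<partial>lborel)"
        using x by (intro Bochner_Integration.integral_cong) (auto simp: indicator_def)
      also have "(\<integral>u. indicator {thr<..x} u * qd u \<partial>lborel) + (\<integral>u. indicator {thr..x} u *\<^sub>R (qq u * (M u / u - 1)) \<partial>lborel)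
          = (\<integral>u. indicator {..x} u * \<rho> u \<partial>lborel)"
      proof -
        have iq: "integrable lborel (\<lambda>u. indicator {thr<..x} u * qd u)"
          using moments(1) by (intro integrable_indicator_times) (auto simp: has_bochner_integral_iff)
        have ir: "integrable lborel (\<lambda>u. indicator {..x} u * \<rho> u)" by (rule i\<rho>B) simp
        have AE: "AE u in lborel. indicator {..x} u * \<rho> u - indicator {thr<..x} u * qd u = indicator {thr..x} u *\<^sub>R (qq u * (M u / u - 1))"
          using AEthr
        proof eventually_elim
          case (elim u)
          then show ?case
            using thr_pos by (auto simp: \<rho>_def qd_qq indicator_def algebra_simps)
        qed
        have "(\<integral>u. indicator {thr..x} u *\<^sub>R (qq u * (M u / u - 1)) \<partial>lborel)
            = (\<integral>u. indicator {..x} u * \<rho> u - indicator {thr<..x} u * qd u \<partial>lborel)"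
          by (rule integral_cong_AE) (use AE in \<open>auto elim: eventually_mono\<close>)
        also have "\<dots> = (\<integral>u. indicator {..x} u * \<rho> u \<partial>lborel) - (\<integral>u. indicator {thr<..x} u * qd u \<partial>lborel)"
          by (rule Bochner_Integration.integral_diff[OF ir iq])
        finally show ?thesis by simp
      qed
      also have "\<dots> = cdf N2 x" unfolding cdf_def2 by (simp add: m2)
      finally show ?thesis .
    qed
  qed
  then have "N1 = N2" by (rule cdf_unique'[OF f1 f2])
  then show "measure L (A \<inter> {thr<..}) = Q.expectation (\<lambda>u. indicator {thr..} u * (indicator A u * (M u / u)))"
    using m1[OF A] m2[OF A] e\<rho>[OF A] by simp
qed

text \<open>The law of \<open>Y\<close> is compared with \<open>Q\<close>, and \<open>Q\<close> with the normal law. Above the threshold the first difference is at most the mean of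
  \<open>\<bar>M u / u - 1\<bar>\<close>, which is the score up to \<open>\<bar>u - mu\<bar> / var\<close> and so of order \<open>1 / sqrt D\<close>; the second is at most \<open>3 * sqrt var\<close>
  times the mean of \<open>\<bar>score\<bar>\<close>. Below the threshold the law of \<open>Y\<close> and \<open>Q\<close> have mass of order \<open>eta\<close>.\<close>

theorem law_normal_approximation:
  assumes L: "prob_space L" "sets L = sets borel"
    and cdf: "\<And>y. y > 0 \<Longrightarrow> measure L {..y} = (\<integral>u. indicator {..y} u * qd u \<partial>lborel) + qq y"
    and A [measurable]: "A \<in> sets borel"
  shows "\<bar>measure L A - (\<integral>u. indicator A u * normal_density mu (sqrt var) u \<partial>lborel)\<bar> \<le> 20000 * (del / D + 1 / rt)"
proof -
  interpret L: prob_space L by (rule L(1))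
  define p where "p = (\<integral>u. indicator A u * normal_density mu (sqrt var) u \<partial>lborel)"
  have i\<gamma>: "integrable lborel (normal_density mu (sqrt var))" using var_pos by (intro integrable_normal_density) simp
  have p01: "0 \<le> p" "p \<le> 1"
  proof -
    show "0 \<le> p" unfolding p_def by (rule integral_nonneg_AE) simp
    have "integrable lborel (\<lambda>u. indicator A u * normal_density mu (sqrt var) u)"
      using i\<gamma> by (intro integrable_indicator_times) auto
    then have "p \<le> (\<integral>u. normal_density mu (sqrt var) u \<partial>lborel)" unfolding p_def
      using i\<gamma> by (intro integral_mono) (auto simp: indicator_def)
    then show "p \<le> 1" using var_pos by simp
  qed
  define Es where "Es = Q.expectation (\<lambda>u. indicator {thr..} u * \<bar>score u\<bar>)"
  have Es0: "Es \<ge> 0" unfolding Es_def by (rule integral_nonneg_AE) simp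
  have iT: "integrable Q (\<lambda>u. indicator {thr..} u * (indicator A u :: real))"
    by (rule Q.integrable_const_bound[where B = 1]) (auto simp: indicator_def)
  have iT': "integrable Q (\<lambda>u. indicator {thr..} u :: real)"
    by (rule Q.integrable_const_bound[where B = 1]) (auto simp: indicator_def)
  have "measure L A = measure L (A \<inter> {thr<..}) + measure L (A \<inter> {..thr})"
  proof -
    have "A = (A \<inter> {thr<..}) \<union> (A \<inter> {..thr})" by auto
    moreover have "measure L ((A \<inter> {thr<..}) \<union> (A \<inter> {..thr})) = measure L (A \<inter> {thr<..}) + measure L (A \<inter> {..thr})"
      using L(2) by (intro L.finite_measure_Union) auto
    ultimately show ?thesis by simp
  qed
  moreover have "p = p * Q.expectation (\<lambda>u. indicator {thr..} u) + p * Q.expectation low"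
  proof -
    have "Q.expectation (\<lambda>u. indicator {thr..} u + low u) = Q.expectation (\<lambda>u. 1)"
      by (intro Bochner_Integration.integral_cong) (auto simp: low_cases indicator_def)
    then have "Q.expectation (\<lambda>u. indicator {thr..} u) + Q.expectation low = 1"
      using iT' integrable_low by simp
    then show ?thesis by (metis distrib_left mult.right_neutral)
  qed
  moreover have "Q.expectation (\<lambda>u. indicator {thr..} u * (indicator A u - p))
      = Q.expectation (\<lambda>u. indicator {thr..} u * indicator A u) - p * Q.expectation (\<lambda>u. indicator {thr..} u)"
  proof -
    have "indicator {thr..} u * (indicator A u - p) = indicator {thr..} u * indicator A u - p * indicator {thr..} u" for u :: real
      by (simp add: algebra_simps)
    then show ?thesis using iT iT' by simp
  qed
  moreover define F where "F = Q.expectation (\<lambda>u. indicator {thr..} u * (indicator A u * (M u / u - 1)))"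
  moreover have "F = measure L (A \<inter> {thr<..}) - Q.expectation (\<lambda>u. indicator {thr..} u * indicator A u)"
  proof -
    have "indicator {thr..} u * (indicator A u * (M u / u - 1)) = indicator {thr..} u * (indicator A u * (M u / u)) - indicator {thr..} u * indicator A u" for u :: real
      by (simp add: algebra_simps)
    then have "F = Q.expectation (\<lambda>u. indicator {thr..} u * (indicator A u * (M u / u)) - indicator {thr..} u * indicator A u)"
      unfolding F_def by (intro Bochner_Integration.integral_cong refl)
    also have "\<dots> = Q.expectation (\<lambda>u. indicator {thr..} u * (indicator A u * (M u / u)))
        - Q.expectation (\<lambda>u. indicator {thr..} u * indicator A u)"
      by (rule Bochner_Integration.integral_diff[OF law_on_bulk(2)[OF L cdf A] iT])
    finally show ?thesis using law_on_bulk(1)[OF L cdf A] by (simp only:)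
  qed
  ultimately have split: "measure L A - p = F + Q.expectation (\<lambda>u. indicator {thr..} u * (indicator A u - p))
      + (measure L (A \<inter> {..thr}) - p * Q.expectation low)" by linarith
  have "\<bar>Q.expectation (\<lambda>u. indicator {thr..} u * (indicator A u - p))\<bar> \<le> 3 * sqrt var * (eta + Es)"
    unfolding p_def Es_def by (rule score_comparison[OF A])
  also have "\<dots> \<le> 3 * rt * (eta + Es)"
    using var_le_D eta_pos Es0 unfolding rt_def by (intro mult_right_mono mult_left_mono real_sqrt_le_mono) auto
  finally have B1: "\<bar>Q.expectation (\<lambda>u. indicator {thr..} u * (indicator A u - p))\<bar> \<le> 3 * rt * (eta + Es)" .
  have B2: "\<bar>F\<bar> \<le> Es + 6 / rt"
  proof -
    have i: "integrable Q (\<lambda>u. indicator {thr..} u * \<bar>score u\<bar> + 4 / D * \<bar>u - mu\<bar>)"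
      using score_expectation(1) Q_abs_moment(1)[of 1 mu] by simp
    have pt: "\<bar>indicator {thr..} u * (indicator A u * (M u / u - 1))\<bar> \<le> indicator {thr..} u * \<bar>score u\<bar> + 4 / D * \<bar>u - mu\<bar>" for u
    proof (cases "u \<ge> thr")
      case True
      have iv: "1 / var \<le> 4 / D" using var_lower var_pos big by (simp add: field_simps)
      have "M u / u - 1 = score u - (u - mu) / var" by (simp add: score_def)
      then have "\<bar>M u / u - 1\<bar> \<le> \<bar>score u\<bar> + \<bar>(u - mu) / var\<bar>" by linarith
      also have "\<bar>(u - mu) / var\<bar> = 1 / var * \<bar>u - mu\<bar>" using var_pos by simp
      also have "\<dots> \<le> 4 / D * \<bar>u - mu\<bar>" by (rule mult_right_mono[OF iv]) simp
      finally have "\<bar>M u / u - 1\<bar> \<le> \<bar>score u\<bar> + 4 / D * \<bar>u - mu\<bar>" by simp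
      moreover have "\<bar>indicator {thr..} u * (indicator A u * (M u / u - 1))\<bar> \<le> \<bar>M u / u - 1\<bar>"
        by (auto simp: indicator_def)
      ultimately show ?thesis using True by simp
    next
      case False
      then show ?thesis using big by simp
    qed
    have "\<bar>F\<bar> \<le> Q.expectation (\<lambda>u. \<bar>indicator {thr..} u * (indicator A u * (M u / u - 1))\<bar>)"
      unfolding F_def by (rule integral_abs_bound)
    also have "\<dots> \<le> Q.expectation (\<lambda>u. indicator {thr..} u * \<bar>score u\<bar> + 4 / D * \<bar>u - mu\<bar>)"
      by (rule Q_mono[OF Q_integrable_bound[OF i] i pt]) (use pt in auto)
    also have "\<dots> = Es + 4 / D * Q.expectation (\<lambda>u. \<bar>u - mu\<bar>)"
      unfolding Es_def using score_expectation(1) Q_abs_moment(1)[of 1 mu] by simp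
    also have "\<dots> \<le> Es + 4 / D * (3 / 2 * rt)" using abs_dev(2) by (intro add_left_mono mult_left_mono) auto
    also have "4 / D * (3 / 2 * rt) = 6 / rt" using rt big by (simp add: field_simps rt(2)[symmetric])
    finally show ?thesis .
  qed
  have B3: "\<bar>measure L (A \<inter> {..thr}) - p * Q.expectation low\<bar> \<le> 2 * eta"
  proof -
    have "measure L (A \<inter> {..thr}) \<le> measure L {..thr}"
      using L(2) by (intro L.finite_measure_mono) auto
    also have "\<dots> = (\<integral>u. indicator {..thr} u * qd u \<partial>lborel) + qq thr" by (rule cdf[OF thr_pos])
    also have "(\<integral>u. indicator {..thr} u * qd u \<partial>lborel) = Q.expectation low"
      by (subst Q_expectation_lborel(1))
        (auto intro!: integral_cong_AE eventually_mono[OF AE_lborel_singleton[of thr]] simp: low_def indicator_def)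
    finally have "measure L (A \<inter> {..thr}) \<le> 2 * eta" using expectation_low qq_thr by linarith
    moreover have "p * Q.expectation low \<le> 1 * eta"
      using p01 expectation_low expectation_low_nonneg by (intro mult_mono) auto
    moreover have "0 \<le> p * Q.expectation low" using p01 expectation_low_nonneg by simp
    moreover have "0 \<le> measure L (A \<inter> {..thr})" by simp
    ultimately show ?thesis using eta_pos by linarith
  qed
  have rtD: "rt / D = 1 / rt" using rt by (simp add: rt(2)[symmetric])
  have EsB: "rt * Es \<le> 4800 * (del / D) + 288 * (1 / rt)"
  proof -
    have "rt * Es \<le> rt * (32 / D * (150 * del / rt + 9))"
      unfolding Es_def using rt by (intro mult_left_mono score_expectation(2)) simp
    also have "\<dots> = 4800 * (del / D) + 288 * (rt / D)" using rt big by (simp add: field_simps)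
    finally show ?thesis unfolding rtD .
  qed
  have Es1: "Es \<le> rt * Es" using Es0 rt by (simp add: mult_le_cancel_right1)
  have eta1: "rt * eta \<le> 1 / rt"
  proof -
    have "rt * eta \<le> rt * (1 / D\<^sup>2)" using eta_le rt by (intro mult_left_mono) auto
    also have "\<dots> = rt / D * (1 / D)" by (simp add: power2_eq_square)
    also have "\<dots> = 1 / rt * (1 / D)" unfolding rtD ..
    also have "\<dots> \<le> 1 / rt * 1" using rt big by (intro mult_left_mono) auto
    finally show ?thesis by simp
  qed
  have eta2: "eta \<le> rt * eta" using eta_pos rt by (simp add: mult_le_cancel_right1)
  have "\<bar>measure L A - p\<bar> \<le> (Es + 6 / rt) + 3 * rt * (eta + Es) + 2 * eta"
    unfolding split using B1 B2 B3 by linarith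
  also have "3 * rt * (eta + Es) = 3 * (rt * eta) + 3 * (rt * Es)" by (simp add: algebra_simps)
  finally have "\<bar>measure L A - p\<bar> \<le> 4 * (4800 * (del / D) + 288 * (1 / rt)) + 6 * (1 / rt) + 5 * (1 / rt)"
    using EsB Es1 eta1 eta2 by simp
  also have "\<dots> \<le> 20000 * (del / D + 1 / rt)"
  proof -
    have ar: "4 * (4800 * X + 288 * Y) + 6 * Y + 5 * Y \<le> 20000 * (X + Y)" if "X \<ge> 0" "Y \<ge> 0" for X Y :: real
      using that by simp
    have "0 \<le> del / D" "0 \<le> 1 / rt" using del_nonneg rt(1) by simp_all
    from ar[OF this] show ?thesis .
  qed
  finally show ?thesis unfolding p_def .
qed

end

section \<open>From the body to its profile\<close>

text \<open>Substituting \<open>t = sqrt (u / pi)\<close> in Steiner's formula makes the volume of the level sets of \<open>Yf = pi * dist\<^sup>2\<close> the profile \<open>v\<close>.\<close>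

locale wills_body = steiner_body +
  fixes R :: real
  assumes d1: "d \<ge> 1" and c0: "\<And>k. 0 \<le> c k"
    and R: "\<And>x y. x \<in> K \<Longrightarrow> y \<in> K \<Longrightarrow> dist_Rd d x y \<le> R"
begin

definition b :: "nat \<Rightarrow> real" where "b k = c k / sqrt pi ^ k"

lemma b_power: "b k * s ^ k = c k * (s / sqrt pi) ^ k"
  by (simp add: b_def power_divide)

lemma R0: "R \<ge> 0"
proof -
  obtain y where "y \<in> K" using K by blast
  from R[OF this this] show ?thesis by simp
qed

sublocale steiner_profile d b "R * sqrt pi"
proof
  show "b k \<ge> 0" for k using c0 by (simp add: b_def)
  have "0 < parallel_vol d K (1 / sqrt pi)" by (rule parallel_vol_pos[OF K(1,3)]) simp
  also have "\<dots> = (\<Sum>k\<le>d. b k * 1 ^ k)" unfolding b_power by (rule V) simp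
  finally show "0 < (\<Sum>k\<le>d. b k)" by simp
  show "0 \<le> R * sqrt pi" using R0 by simp
next
  fix s :: real assume s: "s > 0"
  then have t: "s / sqrt pi > 0" by simp
  show "(\<Sum>k\<le>d. real (d - k) * real (d - k - 1) * (b k * s ^ k)) * (\<Sum>k\<le>d. b k * s ^ k)
      \<le> (\<Sum>k\<le>d. real (d - k) * (b k * s ^ k))\<^sup>2"
    unfolding b_power by (rule steiner_variance_le[OF t])
  have "real d * (s / sqrt pi) * (\<Sum>k\<le>d. b k * s ^ k) \<le> (R + s / sqrt pi) * (\<Sum>k\<le>d. real k * (b k * s ^ k))"
    unfolding b_power by (rule steiner_degree_ge[OF t R])
  then have "sqrt pi * (real d * (s / sqrt pi) * (\<Sum>k\<le>d. b k * s ^ k))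
      \<le> sqrt pi * ((R + s / sqrt pi) * (\<Sum>k\<le>d. real k * (b k * s ^ k)))"
    by (rule mult_left_mono) simp
  moreover have "sqrt pi * (real d * (s / sqrt pi) * X) = real d * s * X" for X by simp
  moreover have "sqrt pi * ((R + s / sqrt pi) * X) = (R * sqrt pi + s) * X" for X
    by (simp add: algebra_simps)
  ultimately show "real d * s * (\<Sum>k\<le>d. b k * s ^ k) \<le> (R * sqrt pi + s) * (\<Sum>k\<le>d. real k * (b k * s ^ k))"
    by simp
qed

definition Yf :: "(nat \<Rightarrow> real) \<Rightarrow> real" where "Yf x = pi * (infdist_Rd d x K)\<^sup>2"

lemma Yf_nonneg: "Yf x \<ge> 0" by (simp add: Yf_def)

lemma measurable_Yf [measurable]: "Yf \<in> borel_measurable (lborel_Rd d)"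
  unfolding Yf_def by measurable

lemma emeasure_level:
  assumes s: "s \<ge> 0"
  shows "emeasure (lborel_Rd d) {x \<in> space (lborel_Rd d). Yf x \<le> s} = ennreal (v s)"
proof -
  have "Yf x \<le> s \<longleftrightarrow> infdist_Rd d x K \<le> sqrt (s / pi)" for x
  proof -
    have "Yf x \<le> s \<longleftrightarrow> (infdist_Rd d x K)\<^sup>2 \<le> s / pi" by (simp add: Yf_def field_simps)
    also have "\<dots> \<longleftrightarrow> infdist_Rd d x K \<le> sqrt (s / pi)"
      using real_le_rsqrt real_sqrt_le_iff by (metis infdist_Rd_nonneg real_sqrt_le_mono real_sqrt_pow2_iff real_sqrt_unique sqrt_le_D)
    finally show ?thesis .
  qed
  then have "emeasure (lborel_Rd d) {x \<in> space (lborel_Rd d). Yf x \<le> s} = ennreal (parallel_vol d K (sqrt (s / pi)))"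
    using parallel_vol_eq[OF K(1,3)] by simp
  also have "parallel_vol d K (sqrt (s / pi)) = (\<Sum>k\<le>d. c k * sqrt (s / pi) ^ k)" by (rule V) (use s in simp)
  also have "\<dots> = v s" unfolding v_def b_power by (simp add: real_sqrt_divide)
  finally show ?thesis .
qed

text \<open>Integrating a function of the form \<open>\<Phi> y = integral of \<phi> over [y, \<infinity>)\<close> along \<open>y = Yf x\<close> gives, by exchanging the integrals, \<open>\<phi>\<close>
  integrated against the volume of the level sets.\<close>

lemma layer_cake:
  assumes [measurable]: "\<phi> \<in> borel_measurable borel"
  shows "(\<integral>\<^sup>+x. (\<integral>\<^sup>+s. indicator {Yf x..} s * \<phi> s \<partial>lborel) \<partial>lborel_Rd d)
    = (\<integral>\<^sup>+s. \<phi> s * (indicator {0..} s * ennreal (v s)) \<partial>lborel)"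
proof -
  interpret product_sigma_finite "\<lambda>_::nat. lborel :: real measure" ..
  interpret Mu: sigma_finite_measure "lborel_Rd d" by (rule sigma_finite) auto
  interpret P: pair_sigma_finite "lborel_Rd d" "lborel :: real measure" ..
  have "(\<integral>\<^sup>+x. (\<integral>\<^sup>+s. indicator {Yf x..} s * \<phi> s \<partial>lborel) \<partial>lborel_Rd d)
      = (\<integral>\<^sup>+s. (\<integral>\<^sup>+x. indicator {Yf x..} s * \<phi> s \<partial>lborel_Rd d) \<partial>lborel)"
  proof (rule P.Fubini'[symmetric])
    have "(\<lambda>p. (if Yf (fst p) \<le> snd p then 1 else 0) * \<phi> (snd p)) \<in> borel_measurable (lborel_Rd d \<Otimes>\<^sub>M lborel)"
      by measurable
    then show "(\<lambda>(x, s). indicator {Yf x..} s * \<phi> s) \<in> borel_measurable (lborel_Rd d \<Otimes>\<^sub>M lborel)"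
      by (simp add: case_prod_beta' indicator_def)
  qed
  also have "\<dots> = (\<integral>\<^sup>+s. \<phi> s * (indicator {0..} s * ennreal (v s)) \<partial>lborel)"
  proof (intro nn_integral_cong)
    fix s :: real
    let ?L = "{x \<in> space (lborel_Rd d). Yf x \<le> s}"
    have "(\<integral>\<^sup>+x. indicator {Yf x..} s * \<phi> s \<partial>lborel_Rd d) = (\<integral>\<^sup>+x. indicator ?L x * \<phi> s \<partial>lborel_Rd d)"
      by (intro nn_integral_cong) (auto simp: indicator_def)
    also have "\<dots> = emeasure (lborel_Rd d) ?L * \<phi> s"
      by (subst nn_integral_multc) auto
    also have "emeasure (lborel_Rd d) ?L = indicator {0..} s * ennreal (v s)"
    proof (cases "s \<ge> 0")
      case True
      then show ?thesis using emeasure_level by simp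
    next
      case False
      then have "?L = {}" using Yf_nonneg by (auto simp: not_le intro: less_le_trans)
      then show ?thesis using False by (simp only: emeasure_empty) simp
    qed
    finally show "(\<integral>\<^sup>+x. indicator {Yf x..} s * \<phi> s \<partial>lborel_Rd d) = \<phi> s * (indicator {0..} s * ennreal (v s))"
      by (simp add: mult.commute)
  qed
  finally show ?thesis .
qed

lemma profile_integral:
  assumes [measurable]: "g \<in> borel_measurable borel" and g0: "\<And>s. s > 0 \<Longrightarrow> g s \<ge> 0"
    and i: "has_bochner_integral lborel (\<lambda>u. qd u * g u) x"
  shows "(\<integral>\<^sup>+s. ennreal (g s * exp (- s)) * (indicator {0..} s * ennreal (v s)) \<partial>lborel) = ennreal (W * x)"
proof -
  have "AE s in lborel. s \<noteq> (0::real)" by (rule AE_lborel_singleton)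
  then have "AE s in lborel. ennreal (g s * exp (- s)) * (indicator {0..} s * ennreal (v s)) = ennreal (W * (qd s * g s))"
  proof eventually_elim
    case (elim s)
    show ?case
    proof (cases "s > 0")
      case True
      then have "g s * exp (- s) * v s = W * (qd s * g s)" using W_pos by (simp add: qd_def)
      moreover have "ennreal (g s * exp (- s)) * ennreal (v s) = ennreal (g s * exp (- s) * v s)"
        using True g0[OF True] v_nonneg[of s] by (intro ennreal_mult[symmetric]) auto
      ultimately show ?thesis using True by (simp only: indicator_def) simp
    next
      case False
      then show ?thesis using elim by (simp add: qd_def)
    qed
  qed
  then have "(\<integral>\<^sup>+s. ennreal (g s * exp (- s)) * (indicator {0..} s * ennreal (v s)) \<partial>lborel) = (\<integral>\<^sup>+s. ennreal (W * (qd s * g s)) \<partial>lborel)"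
    by (rule nn_integral_cong_AE)
  also have "\<dots> = ennreal (\<integral>s. W * (qd s * g s) \<partial>lborel)"
  proof (rule nn_integral_eq_integral)
    show "integrable lborel (\<lambda>s. W * (qd s * g s))"
      using i by (intro integrable_mult_right) (auto simp: has_bochner_integral_iff)
    have "0 \<le> W * (qd s * g s)" for s
    proof (cases "s > 0")
      case True
      then show ?thesis
        by (intro mult_nonneg_nonneg qd_nonneg g0 less_imp_le[OF W_pos])
    next
      case False
      then show ?thesis by (simp add: qd_def)
    qed
    then show "AE s in lborel. 0 \<le> W * (qd s * g s)" by simp
  qed
  also have "(\<integral>s. W * (qd s * g s) \<partial>lborel) = W * x"
    using i by (simp add: has_bochner_integral_iff)
  finally show ?thesis .
qed

text \<open>The tail functions for \<open>\<phi> s = s ^ n * exp (- s)\<close>; together they determine the integrals of \<open>Yf ^ n * exp (- Yf)\<close> for \<open>n \<le> 2\<close>.\<close>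

lemma exp_tails:
  fixes y :: real
  assumes y: "y \<ge> 0"
  shows "(\<integral>\<^sup>+s. indicator {y..} s * ennreal (1 * exp (- s)) \<partial>lborel) = ennreal (exp (- y))"
    "(\<integral>\<^sup>+s. indicator {y..} s * ennreal (s * exp (- s)) \<partial>lborel) = ennreal ((y + 1) * exp (- y))"
    "(\<integral>\<^sup>+s. indicator {y..} s * ennreal (s\<^sup>2 * exp (- s)) \<partial>lborel) = ennreal ((y\<^sup>2 + 2 * y + 2) * exp (- y))"
proof -
  have l: "((\<lambda>x::real. x ^ k * exp (- x)) \<longlongrightarrow> 0) at_top" for k
    using tendsto_power_div_exp_0[of k] by (simp add: exp_minus divide_inverse)
  have l0: "((\<lambda>x::real. exp (- x)) \<longlongrightarrow> 0) at_top" using l[of 0] by simp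
  have l1: "((\<lambda>x::real. x * exp (- x)) \<longlongrightarrow> 0) at_top" using l[of 1] by simp
  have "(\<integral>\<^sup>+s. ennreal (1 * exp (- s)) * indicator {y..} s \<partial>lborel) = ennreal (0 - (- exp (- y)))"
  proof (rule nn_integral_FTC_atLeast)
    show "((\<lambda>s::real. - exp (- s)) \<longlongrightarrow> 0) at_top" using tendsto_minus[OF l0] by simp
  qed (auto intro!: derivative_eq_intros)
  then show "(\<integral>\<^sup>+s. indicator {y..} s * ennreal (1 * exp (- s)) \<partial>lborel) = ennreal (exp (- y))"
    by (simp add: mult.commute)
  have "(\<integral>\<^sup>+s. ennreal (s * exp (- s)) * indicator {y..} s \<partial>lborel) = ennreal (0 - (- ((y + 1) * exp (- y))))"
  proof (rule nn_integral_FTC_atLeast)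
    have "((\<lambda>s::real. - (s * exp (- s) + exp (- s))) \<longlongrightarrow> - (0 + 0)) at_top"
      by (intro tendsto_minus tendsto_add l0 l1)
    then show "((\<lambda>s::real. - ((s + 1) * exp (- s))) \<longlongrightarrow> 0) at_top" by (simp add: distrib_right)
    show "((\<lambda>s. - ((s + 1) * exp (- s))) has_real_derivative x * exp (- x)) (at x)" for x :: real
      by (auto intro!: derivative_eq_intros simp: algebra_simps)
  qed (use y in auto)
  then show "(\<integral>\<^sup>+s. indicator {y..} s * ennreal (s * exp (- s)) \<partial>lborel) = ennreal ((y + 1) * exp (- y))"
    by (simp add: mult.commute)
  have "(\<integral>\<^sup>+s. ennreal (s\<^sup>2 * exp (- s)) * indicator {y..} s \<partial>lborel) = ennreal (0 - (- ((y\<^sup>2 + 2 * y + 2) * exp (- y))))"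
  proof (rule nn_integral_FTC_atLeast)
    have "((\<lambda>s::real. - (s\<^sup>2 * exp (- s) + 2 * (s * exp (- s)) + 2 * exp (- s))) \<longlongrightarrow> - (0 + 2 * 0 + 2 * 0)) at_top"
      by (intro tendsto_minus tendsto_add tendsto_mult tendsto_const l0 l1 l)
    then show "((\<lambda>s::real. - ((s\<^sup>2 + 2 * s + 2) * exp (- s))) \<longlongrightarrow> 0) at_top" by (simp add: distrib_right mult.assoc)
    show "((\<lambda>s. - ((s\<^sup>2 + 2 * s + 2) * exp (- s))) has_real_derivative x\<^sup>2 * exp (- x)) (at x)" for x :: real
      by (auto intro!: derivative_eq_intros simp: algebra_simps power2_eq_square)
  qed (use y in auto)
  then show "(\<integral>\<^sup>+s. indicator {y..} s * ennreal (s\<^sup>2 * exp (- s)) \<partial>lborel) = ennreal ((y\<^sup>2 + 2 * y + 2) * exp (- y))"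
    by (simp add: mult.commute)
qed

lemma space_moments:
  "has_bochner_integral (lborel_Rd d) (\<lambda>x. exp (- Yf x)) W"
  "has_bochner_integral (lborel_Rd d) (\<lambda>x. exp (- Yf x) * Yf x) (W * mu)"
  "has_bochner_integral (lborel_Rd d) (\<lambda>x. exp (- Yf x) * (Yf x)\<^sup>2) (W * (kap + mu))"
proof -
  have mk: "mu \<ge> 0" "kap \<ge> 0"
  proof -
    have "wt k \<ge> 0" for k using b0 W_pos by (simp add: wt_def Gamma_real_nonneg)
    then show "mu \<ge> 0" "kap \<ge> 0" unfolding mu_def kap_def by (auto intro!: sum_nonneg)
  qed
  have "(\<integral>\<^sup>+x. ennreal (exp (- Yf x)) \<partial>lborel_Rd d) = ennreal (W * 1)"
    using layer_cake[of "\<lambda>s. ennreal (1 * exp (- s))"] profile_integral[OF _ _ moments(1)]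
    by (simp only: exp_tails(1)[OF Yf_nonneg]) simp
  then show i0: "has_bochner_integral (lborel_Rd d) (\<lambda>x. exp (- Yf x)) W"
    using W_pos by (intro has_bochner_integral_nn_integral) auto
  have "(\<integral>\<^sup>+x. ennreal ((Yf x + 1) * exp (- Yf x)) \<partial>lborel_Rd d) = ennreal (W * (mu + 1))"
    using layer_cake[of "\<lambda>s. ennreal (s * exp (- s))"] profile_integral[OF _ _ moments(2)]
    by (simp only: exp_tails(2)[OF Yf_nonneg]) simp
  then have "has_bochner_integral (lborel_Rd d) (\<lambda>x. (Yf x + 1) * exp (- Yf x)) (W * (mu + 1))"
    using W_pos mk Yf_nonneg by (intro has_bochner_integral_nn_integral) auto
  from has_bochner_integral_diff[OF this i0]
  show i1: "has_bochner_integral (lborel_Rd d) (\<lambda>x. exp (- Yf x) * Yf x) (W * mu)"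
    by (simp add: algebra_simps)
  have "(\<integral>\<^sup>+x. ennreal (((Yf x)\<^sup>2 + 2 * Yf x + 2) * exp (- Yf x)) \<partial>lborel_Rd d) = ennreal (W * (kap + 3 * mu + 2))"
    using layer_cake[of "\<lambda>s. ennreal (s\<^sup>2 * exp (- s))"] profile_integral[OF _ _ moments(3)]
    by (simp only: exp_tails(3)[OF Yf_nonneg]) simp
  then have "has_bochner_integral (lborel_Rd d) (\<lambda>x. ((Yf x)\<^sup>2 + 2 * Yf x + 2) * exp (- Yf x)) (W * (kap + 3 * mu + 2))"
    using W_pos mk Yf_nonneg by (intro has_bochner_integral_nn_integral) auto
  from has_bochner_integral_diff[OF has_bochner_integral_diff[OF this has_bochner_integral_mult_right[OF i1, of 2]] has_bochner_integral_mult_right[OF i0, of 2]]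
  show "has_bochner_integral (lborel_Rd d) (\<lambda>x. exp (- Yf x) * (Yf x)\<^sup>2) (W * (kap + mu))"
    by (simp add: algebra_simps)
qed

lemma wills_eq: "wills d K = W"
  using has_bochner_integral_integral_eq[OF space_moments(1)] by (simp add: wills_def Yf_def)

lemma wills_density_eq: "wills_density d K x = exp (- Yf x) / W"
  by (simp add: wills_density_def wills_eq Yf_def)

text \<open>Pointwise, \<open>exp (- Yf x) * 1[Yf x \<le> y]\<close> is the integral of \<open>exp (- s)\<close> over \<open>[Yf x, y]\<close> plus \<open>exp (- y)\<close> on the level set. The
  second part produces the density term \<open>qq y\<close>.\<close>

lemma space_cdf:
  assumes y: "y > 0"
  shows "(\<integral>\<^sup>+x. ennreal (exp (- Yf x)) * indicator {..y} (Yf x) \<partial>lborel_Rd d)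
    = ennreal (W * ((\<integral>u. indicator {..y} u * qd u \<partial>lborel) + qq y))"
proof -
  have pt: "ennreal (exp (- Yf x)) * indicator {..y} (Yf x)
      = (\<integral>\<^sup>+s. indicator {Yf x..} s * ennreal (indicator {..y} s * exp (- s)) \<partial>lborel)
        + ennreal (exp (- y)) * indicator {x \<in> space (lborel_Rd d). Yf x \<le> y} x"
    if x: "x \<in> space (lborel_Rd d)" for x
  proof (cases "Yf x \<le> y")
    case True
    have "(\<integral>\<^sup>+s. ennreal (exp (- s)) * indicator {Yf x..y} s \<partial>lborel) = ennreal (- exp (- y) - (- exp (- Yf x)))"
      by (rule nn_integral_FTC_Icc) (use True in \<open>auto intro!: derivative_eq_intros\<close>)
    moreover have "ennreal (exp (- s)) * indicator {Yf x..y} s = indicator {Yf x..} s * ennreal (indicator {..y} s * exp (- s))" for s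
      by (auto simp: indicator_def)
    ultimately have "(\<integral>\<^sup>+s. indicator {Yf x..} s * ennreal (indicator {..y} s * exp (- s)) \<partial>lborel) = ennreal (exp (- Yf x) - exp (- y))"
      by simp
    then show ?thesis using True x by (simp add: ennreal_plus[symmetric] del: ennreal_plus)
  next
    case False
    then have z: "indicator {Yf x..} s * ennreal (indicator {..y} s * exp (- s)) = 0" for s
      by (auto simp: indicator_def)
    show ?thesis unfolding z using False by simp
  qed
  have iq: "integrable lborel (\<lambda>u. indicator {..y} u * qd u)"
    using moments(1) by (intro integrable_indicator_times) (auto simp: has_bochner_integral_iff)
  have I0: "(\<integral>u. indicator {..y} u * qd u \<partial>lborel) \<ge> 0"
    by (rule integral_nonneg_AE) (simp add: qd_nonneg)
  have "(\<integral>\<^sup>+x. ennreal (exp (- Yf x)) * indicator {..y} (Yf x) \<partial>lborel_Rd d)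
      = (\<integral>\<^sup>+x. (\<integral>\<^sup>+s. indicator {Yf x..} s * ennreal (indicator {..y} s * exp (- s)) \<partial>lborel)
        + ennreal (exp (- y)) * indicator {x \<in> space (lborel_Rd d). Yf x \<le> y} x \<partial>lborel_Rd d)"
    by (intro nn_integral_cong pt)
  also have "\<dots> = (\<integral>\<^sup>+x. (\<integral>\<^sup>+s. indicator {Yf x..} s * ennreal (indicator {..y} s * exp (- s)) \<partial>lborel) \<partial>lborel_Rd d)
      + (\<integral>\<^sup>+x. ennreal (exp (- y)) * indicator {x \<in> space (lborel_Rd d). Yf x \<le> y} x \<partial>lborel_Rd d)"
  proof (rule nn_integral_add)
    have "(\<lambda>p. (if Yf (fst p) \<le> snd p then 1 else 0) * ennreal (indicator {..y} (snd p) * exp (- snd p))) \<in> borel_measurable (lborel_Rd d \<Otimes>\<^sub>M lborel)"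
      by measurable
    then have "(\<lambda>x. \<integral>\<^sup>+s. (if Yf x \<le> s then 1 else 0) * ennreal (indicator {..y} s * exp (- s)) \<partial>lborel) \<in> borel_measurable (lborel_Rd d)"
      by (intro lborel.borel_measurable_nn_integral) (simp add: case_prod_beta')
    then show "(\<lambda>x. \<integral>\<^sup>+s. indicator {Yf x..} s * ennreal (indicator {..y} s * exp (- s)) \<partial>lborel) \<in> borel_measurable (lborel_Rd d)"
      by (simp add: indicator_def)
  qed simp
  also have "(\<integral>\<^sup>+x. (\<integral>\<^sup>+s. indicator {Yf x..} s * ennreal (indicator {..y} s * exp (- s)) \<partial>lborel) \<partial>lborel_Rd d)
      = ennreal (W * (\<integral>u. indicator {..y} u * qd u \<partial>lborel))"
    unfolding layer_cake[of "\<lambda>s. ennreal (indicator {..y} s * exp (- s))", simplified]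
    by (rule profile_integral) (use iq in \<open>auto simp: has_bochner_integral_iff mult.commute\<close>)
  also have "(\<integral>\<^sup>+x. ennreal (exp (- y)) * indicator {x \<in> space (lborel_Rd d). Yf x \<le> y} x \<partial>lborel_Rd d) = ennreal (W * qq y)"
  proof -
    have "(\<integral>\<^sup>+x. ennreal (exp (- y)) * indicator {x \<in> space (lborel_Rd d). Yf x \<le> y} x \<partial>lborel_Rd d)
        = ennreal (exp (- y)) * ennreal (v y)"
      using y by (subst nn_integral_cmult_indicator) (auto simp: emeasure_level)
    then show ?thesis using W_pos v_nonneg[of y] y by (simp add: qq_def ennreal_mult[symmetric] mult.commute)
  qed
  also have "ennreal (W * (\<integral>u. indicator {..y} u * qd u \<partial>lborel)) + ennreal (W * qq y)
      = ennreal (W * ((\<integral>u. indicator {..y} u * qd u \<partial>lborel) + qq y))"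
    using W_pos I0 qq_nonneg[of y] y by (simp add: distrib_left ennreal_plus[symmetric] del: ennreal_plus)
  finally show ?thesis .
qed

end

section \<open>Normal approximation\<close>

text \<open>A random vector \<open>Z\<close> with the density of the statement; \<open>Yf Z\<close> has mean \<open>mu\<close> and variance \<open>var\<close>.\<close>

locale wills_variable = wills_body + P: prob_space P for P :: "'w measure" +
  fixes Z :: "'w \<Rightarrow> nat \<Rightarrow> real"
  assumes Z: "distributed P (lborel_Rd d) Z (\<lambda>x. ennreal (wills_density d K x))"
begin

lemma measurable_Z [measurable]: "Z \<in> measurable P (lborel_Rd d)"
  using Z by (rule distributed_measurable)

lemma wills_density_nonneg: "0 \<le> wills_density d K x"
  using W_pos by (simp add: wills_density_eq)

lemma wills_variable_integral:
  fixes g :: "(nat \<Rightarrow> real) \<Rightarrow> real"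
  assumes g: "g \<in> borel_measurable (lborel_Rd d)"
    and i: "has_bochner_integral (lborel_Rd d) (\<lambda>x. exp (- Yf x) * g x) (W * m)"
  shows "integrable P (\<lambda>\<omega>. g (Z \<omega>))" "P.expectation (\<lambda>\<omega>. g (Z \<omega>)) = m"
proof -
  have eq: "(\<lambda>x. wills_density d K x * g x) = (\<lambda>x. exp (- Yf x) * g x / W)"
    by (simp add: wills_density_eq)
  have "has_bochner_integral (lborel_Rd d) (\<lambda>x. exp (- Yf x) * g x / W) (W * m / W)"
    by (intro has_bochner_integral_divide_zero i)
  then have *: "has_bochner_integral (lborel_Rd d) (\<lambda>x. wills_density d K x * g x) m"
    unfolding eq using W_pos by simp
  show "integrable P (\<lambda>\<omega>. g (Z \<omega>))"
    using distributed_integrable[OF Z g wills_density_nonneg] * by (simp add: has_bochner_integral_iff)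
  show "P.expectation (\<lambda>\<omega>. g (Z \<omega>)) = m"
    using distributed_integral[OF Z g wills_density_nonneg] * by (simp add: has_bochner_integral_iff)
qed

lemma F_body_eq: "F_body P Z d K \<omega> = (Yf (Z \<omega>) - mu) / sqrt var"
proof -
  let ?h = "\<lambda>\<omega>. (infdist_Rd d (Z \<omega>) K)\<^sup>2"
  have h: "?h = (\<lambda>\<omega>. Yf (Z \<omega>) / pi)" by (simp add: Yf_def)
  note m1 = wills_variable_integral[OF measurable_Yf space_moments(2)]
  note m2 = wills_variable_integral[OF borel_measurable_power[OF measurable_Yf] space_moments(3)]
  have h2: "(\<lambda>\<omega>. (?h \<omega>)\<^sup>2) = (\<lambda>\<omega>. (Yf (Z \<omega>))\<^sup>2 / pi\<^sup>2)" by (simp add: Yf_def power_mult_distrib)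
  have i: "integrable P ?h" "integrable P (\<lambda>\<omega>. (?h \<omega>)\<^sup>2)"
    unfolding h2 unfolding h by (intro integrable_divide_zero m1(1) m2(1))+
  have E: "P.expectation ?h = mu / pi" unfolding h using m1 by simp
  have "P.variance ?h = P.expectation (\<lambda>\<omega>. (?h \<omega>)\<^sup>2) - (P.expectation ?h)\<^sup>2"
    by (rule P.variance_eq[OF i])
  also have "P.expectation (\<lambda>\<omega>. (?h \<omega>)\<^sup>2) = (kap + mu) / pi\<^sup>2"
    unfolding h2 using m2(2) by simp
  also have "(kap + mu) / pi\<^sup>2 - (P.expectation ?h)\<^sup>2 = var / pi\<^sup>2"
    unfolding E by (simp add: var_def power_divide diff_divide_distrib)
  finally have V: "P.variance ?h = var / pi\<^sup>2" .
  have "F_body P Z d K \<omega> = (Yf (Z \<omega>) / pi - mu / pi) / sqrt (var / pi\<^sup>2)"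
    unfolding F_body_def standardize_def V unfolding E by (simp add: Yf_def)
  also have "\<dots> = ((Yf (Z \<omega>) - mu) / pi) / (sqrt var / pi)"
    by (simp add: diff_divide_distrib real_sqrt_divide)
  finally show ?thesis by simp
qed

lemma level_cdf:
  assumes y: "y > 0"
  shows "P.prob {\<omega> \<in> space P. Yf (Z \<omega>) \<le> y} = (\<integral>u. indicator {..y} u * qd u \<partial>lborel) + qq y"
proof -
  have I0: "(\<integral>u. indicator {..y} u * qd u \<partial>lborel) \<ge> 0"
    by (rule integral_nonneg_AE) (simp add: qd_nonneg)
  have "ennreal (P.prob {\<omega> \<in> space P. Yf (Z \<omega>) \<le> y}) = (\<integral>\<^sup>+\<omega>. indicator {..y} (Yf (Z \<omega>)) \<partial>P)"
  proof -
    have "emeasure P {\<omega> \<in> space P. Yf (Z \<omega>) \<le> y} = (\<integral>\<^sup>+\<omega>. indicator {\<omega> \<in> space P. Yf (Z \<omega>) \<le> y} \<omega> \<partial>P)"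
      by (rule nn_integral_indicator[symmetric]) measurable
    also have "\<dots> = (\<integral>\<^sup>+\<omega>. indicator {..y} (Yf (Z \<omega>)) \<partial>P)"
      by (intro nn_integral_cong) (simp add: indicator_def)
    finally show ?thesis by (simp only: P.emeasure_eq_measure)
  qed
  also have "\<dots> = (\<integral>\<^sup>+x. ennreal (wills_density d K x) * indicator {..y} (Yf x) \<partial>lborel_Rd d)"
    by (rule distributed_nn_integral[OF Z, symmetric]) measurable
  also have "\<dots> = (\<integral>\<^sup>+x. ennreal (1 / W) * (ennreal (exp (- Yf x)) * indicator {..y} (Yf x)) \<partial>lborel_Rd d)"
    using W_pos by (intro nn_integral_cong)
      (simp add: wills_density_eq mult.assoc[symmetric] ennreal_mult[symmetric])
  also have "\<dots> = ennreal (1 / W) * (\<integral>\<^sup>+x. ennreal (exp (- Yf x)) * indicator {..y} (Yf x) \<partial>lborel_Rd d)"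
    by (rule nn_integral_cmult) measurable
  also have "\<dots> = ennreal (1 / W * (W * ((\<integral>u. indicator {..y} u * qd u \<partial>lborel) + qq y)))"
    unfolding space_cdf[OF y]
    using W_pos I0 qq_nonneg[of y] y by (intro ennreal_mult[symmetric]) auto
  also have "1 / W * (W * ((\<integral>u. indicator {..y} u * qd u \<partial>lborel) + qq y)) = (\<integral>u. indicator {..y} u * qd u \<partial>lborel) + qq y"
    using W_pos by simp
  finally show ?thesis
    by (subst (asm) ennreal_inj) (use I0 qq_nonneg[of y] y in auto)
qed

text \<open>An event \<open>F \<in> A\<close> is the event that \<open>Yf Z\<close> lies in the preimage \<open>A'\<close> of \<open>A\<close> under standardisation, and \<open>N \<in> A\<close> is the event that the normal variable
  \<open>mu + sqrt var * N\<close> lies in \<open>A'\<close>.\<close>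

lemma normal_approximation:
  assumes big: "real d \<ge> 1000" and small: "real d / 2 - M (real d / 32) \<le> real d / 64"
    and S: "prob_space S" and N: "distributed S lborel N (\<lambda>x. ennreal (std_normal_density x))"
    and A: "A \<in> sets borel"
  shows "\<bar>\<P>(\<omega> in S. N \<omega> \<in> A) - \<P>(\<omega> in P. F_body P Z d K \<omega> \<in> A)\<bar>
     \<le> 20000 * ((real d / 2 - M (real d / 32)) / real d + 1 / sqrt (real d))"
proof -
  interpret steiner_bulk d b "R * sqrt pi" by unfold_locales (fact big, fact small)
  interpret S: prob_space S by (rule S)
  define L where "L = distr P borel (\<lambda>\<omega>. Yf (Z \<omega>))"
  have mY [measurable]: "(\<lambda>\<omega>. Yf (Z \<omega>)) \<in> borel_measurable P" by measurable
  have L: "prob_space L" unfolding L_def by (rule P.prob_space_distr[OF mY])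
  have measL: "measure L B = P.prob {\<omega> \<in> space P. Yf (Z \<omega>) \<in> B}" if "B \<in> sets borel" for B
    unfolding L_def measure_distr[OF mY that] by (rule arg_cong[where f = P.prob]) auto
  have cdf: "measure L {..y} = (\<integral>u. indicator {..y} u * qd u \<partial>lborel) + qq y" if "y > 0" for y
    using level_cdf[OF that] by (subst measL) simp_all
  define A' where "A' = (\<lambda>u. (u - mu) / sqrt var) -` A"
  have "(\<lambda>u. (u - mu) / sqrt var) -` A \<inter> space borel \<in> sets borel"
    by (rule measurable_sets[OF _ A]) measurable
  then have A' [measurable]: "A' \<in> sets borel" by (simp add: A'_def)
  have sv: "sqrt var > 0" using var_pos by simp
  have F: "\<P>(\<omega> in P. F_body P Z d K \<omega> \<in> A) = measure L A'"
    unfolding measL[OF A'] F_body_eq by (simp add: A'_def)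
  have n: "distributed S lborel (\<lambda>\<omega>. mu + sqrt var * N \<omega>) (normal_density (mu + sqrt var * 0) (\<bar>sqrt var\<bar> * 1))"
    by (rule S.normal_density_affine[OF N]) (use sv in simp_all)
  have n': "distributed S lborel (\<lambda>\<omega>. mu + sqrt var * N \<omega>) (normal_density mu (sqrt var))"
    using n sv by simp
  have "(\<integral>u. normal_density mu (sqrt var) u * indicator A' u \<partial>lborel) = (\<integral>\<omega>. indicator A' (mu + sqrt var * N \<omega>) \<partial>S)"
    by (rule distributed_integral[OF n']) (use A' in simp_all)
  also have "\<dots> = (\<integral>\<omega>. indicator {\<omega> \<in> space S. N \<omega> \<in> A} \<omega> \<partial>S)"
    using sv by (intro Bochner_Integration.integral_cong refl) (auto simp: indicator_def A'_def)
  also have "\<dots> = \<P>(\<omega> in S. N \<omega> \<in> A)"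
  proof -
    have "{\<omega> \<in> space S. N \<omega> \<in> A} = N -` A \<inter> space S" by auto
    also have "\<dots> \<in> sets S"
      by (rule measurable_sets[OF distributed_measurable[OF N]]) (use A in simp)
    finally have "{\<omega> \<in> space S. N \<omega> \<in> A} \<in> sets S" .
    then show ?thesis by simp
  qed
  finally have G: "\<P>(\<omega> in S. N \<omega> \<in> A) = (\<integral>u. indicator A' u * normal_density mu (sqrt var) u \<partial>lborel)"
    by (simp add: mult.commute)
  have "\<bar>measure L A' - (\<integral>u. indicator A' u * normal_density mu (sqrt var) u \<partial>lborel)\<bar> \<le> 20000 * (del / D + 1 / rt)"
    by (rule law_normal_approximation[OF L _ cdf A']) (simp add: L_def)
  then show ?thesis unfolding F G del_def thr_def rt_def by (simp add: abs_minus_commute)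
qed

lemma event_difference_le_1:
  assumes "prob_space S"
  shows "\<bar>\<P>(\<omega> in S. N \<omega> \<in> A) - \<P>(\<omega> in P. F \<omega> \<in> A)\<bar> \<le> 1"
  using prob_space.prob_le_1[OF assms, of "{\<omega> \<in> space S. N \<omega> \<in> A}"] P.prob_le_1[of "{\<omega> \<in> space P. F \<omega> \<in> A}"]
    measure_nonneg[of S "{\<omega> \<in> space S. N \<omega> \<in> A}"] measure_nonneg[of P "{\<omega> \<in> space P. F \<omega> \<in> A}"]
  by linarith

text \<open>The bound of the bulk case, with \<open>del \<le> 6 * R * sqrt d\<close> from the diameter. In the remaining cases \<open>sqrt d < 32\<close> or
  \<open>sqrt d < 384 * R\<close>, and the right-hand side exceeds 1.\<close>

lemma event_difference_le:
  assumes S: "prob_space S" and N: "distributed S lborel N (\<lambda>x. ennreal (std_normal_density x))"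
    and A: "A \<in> sets borel"
  shows "\<bar>\<P>(\<omega> in S. N \<omega> \<in> A) - \<P>(\<omega> in P. F_body P Z d K \<omega> \<in> A)\<bar> \<le> 120000 * (1 + R) / sqrt (real d)"
    (is "?T \<le> _")
proof -
  define r where "r = sqrt (real d)"
  have r: "r > 0" "r * r = real d" using d1 by (simp_all add: r_def)
  define g where "g = real d / 2 - M (real d / 32)"
  \<comment> \<open>The factor \<open>sqrt 32\<close> comes from \<open>u = d / 32\<close> in \<open>M_ge\<close>.\<close>
  have "sqrt pi * sqrt 32 \<le> 11"
  proof -
    have "sqrt pi * sqrt 32 = sqrt (pi * 32)" by (simp only: real_sqrt_mult)
    also have "\<dots> \<le> sqrt (11\<^sup>2)" using pi_less_4 pi_approx by (intro real_sqrt_le_mono) simp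
    finally show ?thesis by simp
  qed
  then have pR: "R * (sqrt pi * sqrt 32) \<le> R * 11" using R0 by (rule mult_left_mono)
  have "g \<le> real d / 2 * (R * sqrt pi / sqrt (real d / 32))"
    unfolding g_def by (rule M_ge) (use d1 in simp)
  also have "\<dots> = r / 2 * (R * (sqrt pi * sqrt 32))"
    using r by (simp add: real_sqrt_divide r_def[symmetric] r(2)[symmetric] field_simps)
  also have "\<dots> \<le> r / 2 * (R * 11)" by (rule mult_left_mono[OF pR]) (use r in simp)
  finally have g: "g \<le> r * (6 * R)"
    using mult_nonneg_nonneg[OF less_imp_le[OF r(1)] R0] by (simp add: algebra_simps)
  have triv: ?thesis if "r \<le> 120000 * (1 + R)"
  proof -
    have "1 \<le> 120000 * (1 + R) / r" using that r by simp
    then show ?thesis using event_difference_le_1[OF S, of N A "F_body P Z d K"] unfolding r_def[symmetric] by linarith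
  qed
  consider "r < 32" | "r \<ge> 32" "g > real d / 64" | "r \<ge> 32" "g \<le> real d / 64" by linarith
  then show ?thesis
  proof cases
    case 1
    then show ?thesis using R0 by (intro triv) (simp add: distrib_left)
  next
    case 2
    have "r * r / 64 < r * (6 * R)" using 2 g r by linarith
    then have "r * (r / 64) < r * (6 * R)" by simp
    then have "r / 64 < 6 * R" using r by (simp only: mult_less_cancel_left_pos)
    then show ?thesis using R0 by (intro triv) (simp add: distrib_left)
  next
    case 3
    have "32 * 32 \<le> r * r" using 3 by (intro mult_mono) auto
    then have big: "real d \<ge> 1000" using r by linarith
    have "?T \<le> 20000 * (g / real d + 1 / r)"
      using normal_approximation[OF big _ S N A] 3 unfolding g_def r_def by blast
    also have "g / real d \<le> 6 * R / r"
    proof -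
      have "g / real d \<le> r * (6 * R) / (r * r)" using g r by (simp add: divide_right_mono)
      also have "\<dots> = 6 * R / r" using r(1) by simp
      finally show ?thesis .
    qed
    also have "20000 * (6 * R / r + 1 / r) \<le> 120000 * (1 + R) / r"
    proof -
      have "20000 * (6 * R / r + 1 / r) = (20000 * (6 * R + 1)) / r" by (simp add: add_divide_distrib)
      also have "\<dots> \<le> 120000 * (1 + R) / r" using R0 r by (intro divide_right_mono) auto
      finally show ?thesis .
    qed
    finally show ?thesis unfolding r_def by simp
  qed
qed

end

lemma d_TV_leI:
  assumes "\<And>A. A \<in> sets borel \<Longrightarrow> \<bar>\<P>(\<omega> in M'. G \<omega> \<in> A) - \<P>(\<omega> in M. F \<omega> \<in> A)\<bar> \<le> B"
  shows "d_TV M F M' G \<le> B"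
  unfolding d_TV_def using assms by (intro cSUP_least) auto

lemma event_difference_le_d_TV:
  assumes "prob_space M" "prob_space M'" "A \<in> sets borel"
  shows "\<bar>\<P>(\<omega> in M'. G \<omega> \<in> A) - \<P>(\<omega> in M. F \<omega> \<in> A)\<bar> \<le> d_TV M F M' G"
  unfolding d_TV_def
proof (rule cSUP_upper[OF assms(3)], rule bdd_aboveI2)
  fix A
  show "\<bar>\<P>(\<omega> in M'. G \<omega> \<in> A) - \<P>(\<omega> in M. F \<omega> \<in> A)\<bar> \<le> 1"
    using prob_space.prob_le_1[OF assms(1), of "{\<omega> \<in> space M. F \<omega> \<in> A}"]
      prob_space.prob_le_1[OF assms(2), of "{\<omega> \<in> space M'. G \<omega> \<in> A}"]
      measure_nonneg[of M "{\<omega> \<in> space M. F \<omega> \<in> A}"] measure_nonneg[of M' "{\<omega> \<in> space M'. G \<omega> \<in> A}"]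
    by linarith
qed

lemma dist_Rd_le_diameter:
  assumes K: "compactin (top_Rd d) K" and xy: "x \<in> K" "y \<in> K"
  shows "dist_Rd d x y \<le> diameter_Rd d K"
proof -
  obtain R where R: "\<And>z. z \<in> K \<Longrightarrow> dist_Rd d x z \<le> R" using compactin_Rd_bounded[OF K] by blast
  have "bdd_above ((\<lambda>(x, y). dist_Rd d x y) ` (K \<times> K))"
  proof (rule bdd_aboveI2)
    fix p assume "p \<in> K \<times> K"
    then obtain u w where p: "p = (u, w)" "u \<in> K" "w \<in> K" by blast
    have "dist_Rd d u w \<le> dist_Rd d u x + dist_Rd d x w" by (rule dist_Rd_triangle)
    also have "\<dots> \<le> R + R" using R[OF p(2)] R[OF p(3)] by (simp add: dist_Rd_commute[of d u x])
    finally show "(\<lambda>(x, y). dist_Rd d x y) p \<le> R + R" using p(1) by simp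
  qed
  then have "(\<lambda>(x, y). dist_Rd d x y) (x, y) \<le> (SUP (x, y)\<in>K \<times> K. dist_Rd d x y)"
    by (intro cSUP_upper) (use xy in auto)
  then show ?thesis using xy by (auto simp: diameter_Rd_def)
qed

text \<open>A bound with absolute constants, from which both assertions follow: \<open>1 + diameter\<close> is at most a constant times \<open>d powr \<alpha>\<close>
  under either hypothesis, since \<open>\<alpha> \<ge> 0\<close>.\<close>

theorem d_TV_convex_body_le:
  assumes d: "d \<ge> 1" and K: "convex_body d K" and P: "prob_space P"
    and Z: "distributed P (lborel_Rd d) Z (\<lambda>x. ennreal (wills_density d K x))"
    and S: "prob_space S" and N: "distributed S lborel N (\<lambda>x. ennreal (std_normal_density x))"
  shows "d_TV P (F_body P Z d K) S N \<le> 120000 * (1 + diameter_Rd d K) / sqrt (real d)"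
proof -
  have K': "compactin (top_Rd d) K" "convex_Rd d K" using K by (simp_all add: convex_body_def)
  have "K \<noteq> {}" using K interior_of_subset[of "top_Rd d" K] unfolding convex_body_def by blast
  note K' = K' this
  obtain c where c: "\<And>k. 0 \<le> c k" "\<And>t. t \<ge> 0 \<Longrightarrow> parallel_vol d K t = (\<Sum>k\<le>d. c k * t ^ k)"
    using steiner_polynomial[OF K'] by blast
  interpret P: prob_space P by (rule P)
  interpret wills_variable d K c "diameter_Rd d K" P Z
    by unfold_locales (use K' c d Z dist_Rd_le_diameter[OF K'(1)] in blast)+
  show ?thesis by (rule d_TV_leI, rule event_difference_le[OF S N])
qed

theorem theorem1p1:
  fixes M :: "nat \<Rightarrow> (nat \<Rightarrow> real) set \<Rightarrow> 'w measure"
    and X :: "nat \<Rightarrow> (nat \<Rightarrow> real) set \<Rightarrow> 'w \<Rightarrow> nat \<Rightarrow> real"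
    and S :: "'v measure"
    and N :: "'v \<Rightarrow> real"
  assumes M: "\<And>d K. d \<ge> 1 \<Longrightarrow> convex_body d K \<Longrightarrow> prob_space (M d K)"
    and X: "\<And>d K. d \<ge> 1 \<Longrightarrow> convex_body d K \<Longrightarrow>
              distributed (M d K) (lborel_Rd d) (X d K) (\<lambda>x. ennreal (wills_density d K x))"
    and S: "prob_space S"
    and N: "distributed S lborel N (\<lambda>x. ennreal (std_normal_density x))"
  shows "(\<forall>\<alpha>\<ge>0. \<forall>c>0.
            (SUP d\<in>{1..}. SUP K\<in>{K. convex_body d K \<and> diameter_Rd d K \<le> 2 * c * real d powr \<alpha>}.
               ereal (real d powr (1/2 - \<alpha>) * d_TV (M d K) (F_body (M d K) (X d K) d K) S N)) < \<infinity>)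
       \<and> (\<forall>\<alpha> (d :: nat \<Rightarrow> nat) (K :: nat \<Rightarrow> (nat \<Rightarrow> real) set).
            0 \<le> \<alpha> \<and> \<alpha> < 1/2 \<and>
            (\<forall>n. d n \<ge> 1) \<and> filterlim d at_top sequentially \<and>
            (\<forall>n. convex_body (d n) (K n)) \<and>
            (\<lambda>n. diameter_Rd (d n) (K n)) \<in> O(\<lambda>n. real (d n) powr \<alpha>)
            \<longrightarrow> weak_conv_m
                  (\<lambda>n. distr (M (d n) (K n)) borel
                         (F_body (M (d n) (K n)) (X (d n) (K n)) (d n) (K n)))
                  std_normal_distribution)"
proof (intro conjI allI impI)
  fix \<alpha> c :: real assume \<alpha>: "0 \<le> \<alpha>" and c: "0 < c"
  have "(SUP d\<in>{1..}. SUP K\<in>{K. convex_body d K \<and> diameter_Rd d K \<le> 2 * c * real d powr \<alpha>}.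
      ereal (real d powr (1/2 - \<alpha>) * d_TV (M d K) (F_body (M d K) (X d K) d K) S N)) \<le> ereal (120000 * (1 + 2 * c))"
  proof (intro SUP_least)
    fix d K assume "d \<in> {1::nat..}" and K: "K \<in> {K. convex_body d K \<and> diameter_Rd d K \<le> 2 * c * real d powr \<alpha>}"
    then have d: "d \<ge> 1" by simp
    have "1 \<le> real d powr \<alpha>" using d \<alpha> by (intro ge_one_powr_ge_zero) auto
    then have "1 + diameter_Rd d K \<le> (1 + 2 * c) * real d powr \<alpha>" using K by (simp add: distrib_right)
    then have "120000 * (1 + diameter_Rd d K) / sqrt (real d) \<le> 120000 * ((1 + 2 * c) * real d powr \<alpha>) / sqrt (real d)"
      by (intro divide_right_mono mult_left_mono) auto
    moreover have "d_TV (M d K) (F_body (M d K) (X d K) d K) S N \<le> 120000 * (1 + diameter_Rd d K) / sqrt (real d)"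
      using K by (intro d_TV_convex_body_le[OF d _ M[OF d] X[OF d] S N]) auto
    ultimately have "d_TV (M d K) (F_body (M d K) (X d K) d K) S N \<le> 120000 * ((1 + 2 * c) * real d powr \<alpha>) / sqrt (real d)"
      by linarith
    then have "real d powr (1/2 - \<alpha>) * d_TV (M d K) (F_body (M d K) (X d K) d K) S N
        \<le> real d powr (1/2 - \<alpha>) * (120000 * ((1 + 2 * c) * real d powr \<alpha>) / sqrt (real d))"
      by (intro mult_left_mono) auto
    also have "\<dots> = 120000 * (1 + 2 * c)"
      using d by (simp add: powr_diff powr_half_sqrt)
    finally show "ereal (real d powr (1/2 - \<alpha>) * d_TV (M d K) (F_body (M d K) (X d K) d K) S N)
        \<le> ereal (120000 * (1 + 2 * c))" by simp
  qed
  then show "(SUP d\<in>{1..}. SUP K\<in>{K. convex_body d K \<and> diameter_Rd d K \<le> 2 * c * real d powr \<alpha>}.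
      ereal (real d powr (1/2 - \<alpha>) * d_TV (M d K) (F_body (M d K) (X d K) d K) S N)) < \<infinity>"
    by (rule le_less_trans) simp
next
  fix \<alpha> :: real and d :: "nat \<Rightarrow> nat" and K :: "nat \<Rightarrow> (nat \<Rightarrow> real) set"
  assume *: "0 \<le> \<alpha> \<and> \<alpha> < 1/2 \<and> (\<forall>n. d n \<ge> 1) \<and> filterlim d at_top sequentially \<and>
    (\<forall>n. convex_body (d n) (K n)) \<and> (\<lambda>n. diameter_Rd (d n) (K n)) \<in> O(\<lambda>n. real (d n) powr \<alpha>)"
  then have \<alpha>: "0 \<le> \<alpha>" "\<alpha> < 1/2" and d: "\<And>n. d n \<ge> 1" and lim: "filterlim d at_top sequentially"
    and K: "\<And>n. convex_body (d n) (K n)" and diam: "(\<lambda>n. diameter_Rd (d n) (K n)) \<in> O(\<lambda>n. real (d n) powr \<alpha>)"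
    by auto
  define F where "F n = F_body (M (d n) (K n)) (X (d n) (K n)) (d n) (K n)" for n
  define tv where "tv n = d_TV (M (d n) (K n)) (F n) S N" for n
  obtain C where C: "\<forall>\<^sub>F n in sequentially. norm (diameter_Rd (d n) (K n)) \<le> C * norm (real (d n) powr \<alpha>)"
    using diam by (elim landau_o.bigE)
  have rd: "filterlim (\<lambda>n. real (d n)) at_top sequentially"
    by (rule filterlim_compose[OF filterlim_real_sequentially lim])
  have "(\<lambda>n. real (d n) powr (\<alpha> - 1/2)) \<longlonglongrightarrow> 0"
    by (rule tendsto_neg_powr[OF _ rd]) (use \<alpha> in simp)
  from tendsto_mult_right_zero[OF this, of "120000 * (1 + C)"]
  have up: "(\<lambda>n. 120000 * (1 + C) * real (d n) powr (\<alpha> - 1/2)) \<longlonglongrightarrow> 0" .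
  have tv_le: "\<forall>\<^sub>F n in sequentially. tv n \<le> 120000 * (1 + C) * real (d n) powr (\<alpha> - 1/2)"
    using C
  proof eventually_elim
    case (elim n)
    have "1 \<le> real (d n) powr \<alpha>" using d[of n] \<alpha> by (intro ge_one_powr_ge_zero) auto
    then have "1 + diameter_Rd (d n) (K n) \<le> (1 + C) * real (d n) powr \<alpha>"
      using elim by (simp add: distrib_right)
    then have "120000 * (1 + diameter_Rd (d n) (K n)) / sqrt (real (d n))
        \<le> 120000 * ((1 + C) * real (d n) powr \<alpha>) / sqrt (real (d n))"
      by (intro divide_right_mono mult_left_mono) auto
    also have "\<dots> = 120000 * (1 + C) * real (d n) powr (\<alpha> - 1/2)"
      using d[of n] by (simp add: powr_diff powr_half_sqrt)
    finally have "120000 * (1 + diameter_Rd (d n) (K n)) / sqrt (real (d n)) \<le> \<dots>" .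
    moreover have "tv n \<le> 120000 * (1 + diameter_Rd (d n) (K n)) / sqrt (real (d n))"
      unfolding tv_def F_def by (rule d_TV_convex_body_le[OF d K M[OF d K] X[OF d K] S N])
    ultimately show ?case by linarith
  qed
  have cdf: "\<bar>cdf std_normal_distribution x - cdf (distr (M (d n) (K n)) borel (F n)) x\<bar> \<le> tv n" for n x
  proof -
    have mF: "F n \<in> borel_measurable (M (d n) (K n))"
    proof -
      have [measurable]: "X (d n) (K n) \<in> measurable (M (d n) (K n)) (lborel_Rd (d n))"
        using X[OF d K] by (rule distributed_measurable)
      show ?thesis unfolding F_def F_body_def standardize_def by measurable
    qed
    have "std_normal_distribution = distr S borel N"
      using distributed_distr_eq_density[OF N] by (simp cong: distr_cong)
    then have 1: "cdf std_normal_distribution x = \<P>(\<omega> in S. N \<omega> \<in> {..x})"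
      using distributed_measurable[OF N] by (simp add: cdf_def measure_distr vimage_def Int_def conj_commute)
    have 2: "cdf (distr (M (d n) (K n)) borel (F n)) x = \<P>(\<omega> in M (d n) (K n). F n \<omega> \<in> {..x})"
      using mF by (simp add: cdf_def measure_distr vimage_def Int_def conj_commute)
    show ?thesis unfolding 1 2 tv_def by (rule event_difference_le_d_TV[OF M[OF d K] S]) simp
  qed
  have tv0: "tv \<longlonglongrightarrow> 0"
  proof (rule tendsto_sandwich[OF _ tv_le tendsto_const up])
    show "\<forall>\<^sub>F n in sequentially. 0 \<le> tv n"
      using cdf order_trans[OF abs_ge_zero] by (intro always_eventually allI) blast
  qed
  have "(\<lambda>n. cdf (distr (M (d n) (K n)) borel (F n)) x) \<longlonglongrightarrow> cdf std_normal_distribution x" for x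
  proof (rule LIM_zero_cancel, rule Lim_null_comparison[OF _ tv0])
    show "\<forall>\<^sub>F n in sequentially. norm (cdf (distr (M (d n) (K n)) borel (F n)) x - cdf std_normal_distribution x) \<le> tv n"
      using cdf[of x] by (intro always_eventually allI) (simp add: abs_minus_commute)
  qed
  then show "weak_conv_m (\<lambda>n. distr (M (d n) (K n)) borel (F_body (M (d n) (K n)) (X (d n) (K n)) (d n) (K n)))
      std_normal_distribution"
    unfolding weak_conv_m_def weak_conv_def F_def by blast
qed

end
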